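(* The normalized bi-parameter Haar system $\big(h_I\otimes h_J/\|h_I\otimes h_J\|_{L^1(L^1)}\big)_{I,J\in\mathcal D^+}$ of $L^1(L^1)$ (which is isometrically isomorphic to $L^1([0,1]^2)$) has the $1/\delta$-factorization property.
   Context: All spaces are real. $\mathcal D$ is the set of dyadic intervals $[\frac{i-1}{2^j},\frac{i}{2^j})$, $j\ge0$, $1\le i\le2^j$; for $I\in\mathcal D$ with left half $I^+$ and right half $I^-$, $h_I=\chi_{I^+}-\chi_{I^-}$. $\mathcal D^+=\mathcal D\cup\{\emptyset\}$, $h_\emptyset=\chi_{[0,1)}$; $(h_I\otimes h_J)(s,t)=h_I(s)h_J(t)$. Suitably linearly ordered, the normalized bi-parameter Haar system is a Schauder basis of $L^1(L^1)$, with biorthogonal functionals given by integration against $h_I\otimes h_J$. For a bounded linear operator $T:X\to X$ and $K>0$, the identity $K$-factors through $T$ if there are bounded linear $R,S:X\to X$ with $\|R\|\|S\|\le K$ and $I=STR$; it almost $K$-factors through $T$ if it $(K+\varepsilon)$-factors through $T$ for all $\varepsilon>0$. Given $K:(0,\infty)\to\mathbb R$, a normalized Schauder basis $(e_n)$ of $X$ with biorthogonal functionals $(e_n^* )$ has the $K(\delta)$-factorization property if for every $\delta>0$ and every bounded linear operator $T:X\to X$ with $\inf_n|e_n^*(T(e_n))|\ge\delta$, the identity almost $K(\delta)$-factors through $T$ (a property independent of the order of the basis). Here $K(\delta)=1/\delta$. *)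

theory Defs
  imports "HOL-Analysis.Analysis"
begin

section \<open>The Bochner space \<open>L\<^sup>1([0,1); 'b)\<close>\<close>

abbreviation unit_measure :: "real measure" where
  "unit_measure \<equiv> restrict_space lborel {0..<1}"

text \<open>
  The classes modulo almost everywhere equality of Bochner integrable functions.  The value space
  has to be separable, as \<open>integrable\<close> requires; the new type is shown to be a separable Banach
  space again, so that the construction can be iterated.
\<close>
definition L1_rel :: "(real \<Rightarrow> 'b::{banach, second_countable_topology}) \<Rightarrow> (real \<Rightarrow> 'b) \<Rightarrow> bool" where
  "L1_rel f g \<longleftrightarrow> integrable unit_measure f \<and> integrable unit_measure g \<and>
     (AE x in unit_measure. f x = g x)"

lemma part_equivp_L1_rel: "part_equivp L1_rel"
proof (rule part_equivpI)
  show "\<exists>f. L1_rel f f"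
    by (rule exI[of _ "\<lambda>_. 0"]) (simp add: L1_rel_def)
  show "symp L1_rel"
    by (auto intro!: sympI simp: L1_rel_def)
  show "transp L1_rel"
  proof (rule transpI)
    fix f g h :: "real \<Rightarrow> 'b"
    assume "L1_rel f g" "L1_rel g h"
    moreover from this have "AE x in unit_measure. f x = h x"
      unfolding L1_rel_def by (auto elim: AE_mp)
    ultimately show "L1_rel f h"
      unfolding L1_rel_def by blast
  qed
qed

quotient_type (overloaded) 'b L1 = "real \<Rightarrow> 'b::{banach, second_countable_topology}" / partial: L1_rel
  by (rule part_equivp_L1_rel)

instantiation L1 :: ("{banach, second_countable_topology}") real_vector
begin

lift_definition zero_L1 :: "'a L1" is "\<lambda>_. 0"
  by (simp add: L1_rel_def)

lift_definition plus_L1 :: "'a L1 \<Rightarrow> 'a L1 \<Rightarrow> 'a L1" is "\<lambda>f g x. f x + g x"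
  by (auto simp: L1_rel_def)

lift_definition minus_L1 :: "'a L1 \<Rightarrow> 'a L1 \<Rightarrow> 'a L1" is "\<lambda>f g x. f x - g x"
  by (auto simp: L1_rel_def)

lift_definition uminus_L1 :: "'a L1 \<Rightarrow> 'a L1" is "\<lambda>f x. - f x"
  by (auto simp: L1_rel_def)

lift_definition scaleR_L1 :: "real \<Rightarrow> 'a L1 \<Rightarrow> 'a L1" is "\<lambda>c f x. c *\<^sub>R f x"
  by (auto simp: L1_rel_def)

instance
proof
  fix a b :: real and f g h :: "'a L1"
  show "f + g + h = f + (g + h)"
    by transfer (auto simp: L1_rel_def algebra_simps)
  show "f + g = g + f"
    by transfer (auto simp: L1_rel_def algebra_simps)
  show "0 + f = f"
    by transfer (auto simp: L1_rel_def)
  show "- f + f = 0"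
    by transfer (auto simp: L1_rel_def)
  show "f - g = f + - g"
    by transfer (auto simp: L1_rel_def)
  show "a *\<^sub>R (f + g) = a *\<^sub>R f + a *\<^sub>R g"
    by transfer (auto simp: L1_rel_def algebra_simps)
  show "(a + b) *\<^sub>R f = a *\<^sub>R f + b *\<^sub>R f"
    by transfer (auto simp: L1_rel_def algebra_simps)
  show "a *\<^sub>R b *\<^sub>R f = (a * b) *\<^sub>R f"
    by transfer (auto simp: L1_rel_def)
  show "1 *\<^sub>R f = f"
    by transfer (auto simp: L1_rel_def)
qed

end

instantiation L1 :: ("{banach, second_countable_topology}") real_normed_vector
begin

lift_definition norm_L1 :: "'a L1 \<Rightarrow> real" is "\<lambda>f. LINT x|unit_measure. norm (f x)"
  by (rule integral_cong_AE) (auto simp: L1_rel_def)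

definition dist_L1 :: "'a L1 \<Rightarrow> 'a L1 \<Rightarrow> real" where
  "dist_L1 f g = norm (f - g)"

definition sgn_L1 :: "'a L1 \<Rightarrow> 'a L1" where
  "sgn_L1 f = f /\<^sub>R norm f"

definition uniformity_L1 :: "('a L1 \<times> 'a L1) filter" where
  "uniformity_L1 = (INF e\<in>{0<..}. principal {(x, y). dist x y < e})"

definition open_L1 :: "'a L1 set \<Rightarrow> bool" where
  "open_L1 U = (\<forall>x\<in>U. eventually (\<lambda>(x', y). x' = x \<longrightarrow> y \<in> U) uniformity)"

instance
proof
  fix a :: real and f g :: "'a L1"
  show "dist f g = norm (f - g)"
    by (rule dist_L1_def)
  show "sgn f = f /\<^sub>R norm f"
    by (rule sgn_L1_def)
  show "uniformity = (INF e\<in>{0<..}. principal {(x::'a L1, y). dist x y < e})"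
    by (rule uniformity_L1_def)
  show "open U = (\<forall>x\<in>U. eventually (\<lambda>(x', y). x' = x \<longrightarrow> y \<in> U) uniformity)"
    for U :: "'a L1 set"
    by (rule open_L1_def)
  show "norm f = 0 \<longleftrightarrow> f = 0"
    by transfer (auto simp: L1_rel_def integral_nonneg_eq_0_iff_AE)
  show "norm (f + g) \<le> norm f + norm g"
  proof transfer
    fix f g :: "real \<Rightarrow> 'a"
    assume "L1_rel f f" "L1_rel g g"
    then have [simp]: "integrable unit_measure f" "integrable unit_measure g"
      by (auto simp: L1_rel_def)
    have "(LINT x|unit_measure. norm (f x + g x)) \<le>
        (LINT x|unit_measure. norm (f x) + norm (g x))"
      by (rule integral_mono) (auto intro: norm_triangle_ineq)
    then show "(LINT x|unit_measure. norm (f x + g x)) \<le>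
        (LINT x|unit_measure. norm (f x)) + (LINT x|unit_measure. norm (g x))"
      by simp
  qed
  show "norm (a *\<^sub>R f) = \<bar>a\<bar> * norm f"
    by transfer (simp add: L1_rel_def)
qed

end

abbreviation L1_integrable :: "(real \<Rightarrow> 'b::{banach, second_countable_topology}) \<Rightarrow> bool" where
  "L1_integrable \<equiv> integrable unit_measure"

lemma space_unit_measure: "space unit_measure = {0..<1}"
  by (simp add: space_restrict_space)

lemma finite_unit_measure: "finite_measure unit_measure"
  by (rule finite_measureI) (simp add: emeasure_restrict_space space_unit_measure)

lemma L1_integrable_const [simp]: "L1_integrable (\<lambda>_. c)"
  using finite_measure.integrable_const[OF finite_unit_measure] .

lemma L1_measurable: "f \<in> borel_measurable borel \<Longrightarrow> f \<in> borel_measurable unit_measure"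
  by (intro measurable_restrict_space1) simp

lemma rep_L1_integrable: "L1_integrable (rep_L1 F)"
  using Quotient3_rep_reflp[OF Quotient3_L1, of F] by (simp add: L1_rel_def)

lemma abs_rep_L1: "abs_L1 (rep_L1 F) = F"
  by (rule Quotient3_abs_rep[OF Quotient3_L1])

lemma rep_abs_L1:
  assumes "L1_integrable f"
  shows "AE x in unit_measure. rep_L1 (abs_L1 f) x = f x"
proof -
  have "L1_rel f f" using assms by (simp add: L1_rel_def)
  then have "L1_rel (rep_L1 (abs_L1 f)) f"
    by (rule rep_abs_rsp_left[OF Quotient3_L1])
  then show ?thesis by (simp add: L1_rel_def)
qed

lemma abs_L1_eqI:
  assumes "L1_integrable f" "L1_integrable g" "AE x in unit_measure. f x = g x"
  shows "abs_L1 f = abs_L1 g"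
  using assms by (intro Quotient3_rel_abs[OF Quotient3_L1]) (auto simp: L1_rel_def)

lemma L1_ops:
  assumes "L1_integrable f" "L1_integrable g"
  shows "abs_L1 f + abs_L1 g = abs_L1 (\<lambda>x. f x + g x)"
    and "abs_L1 f - abs_L1 g = abs_L1 (\<lambda>x. f x - g x)"
  using assms
  by (auto simp: L1_rel_def plus_L1.abs_eq minus_L1.abs_eq)

lemma scaleR_abs_L1:
  "L1_integrable f \<Longrightarrow> c *\<^sub>R abs_L1 f = abs_L1 (\<lambda>x. c *\<^sub>R f x)"
  by (simp add: L1_rel_def scaleR_L1.abs_eq)

lemma norm_abs_L1:
  "L1_integrable f \<Longrightarrow> norm (abs_L1 f) = (LINT x|unit_measure. norm (f x))"
  by (simp add: L1_rel_def norm_L1.abs_eq)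

lemma L1_zero: "0 = abs_L1 (\<lambda>_. 0)"
  by (simp add: zero_L1_def)

instance L1 :: ("{banach, second_countable_topology}") banach
proof
  fix X :: "nat \<Rightarrow> 'a L1"
  assume "Cauchy X"
  define s where "s n = rep_L1 (X n)" for n
  have [simp]: "L1_integrable (s n)" for n
    unfolding s_def by (rule rep_L1_integrable)
  have X: "X n = abs_L1 (s n)" for n
    unfolding s_def by (simp add: abs_rep_L1)
  have dX: "dist (X i) (X j) = (LINT x|unit_measure. norm (s i x - s j x))" for i j
    by (simp add: dist_norm X L1_ops norm_abs_L1)
  have meas [measurable]: "s n \<in> borel_measurable unit_measure" for n
    by (rule borel_measurable_integrable) simp
  have cau: "\<exists>N. \<forall>i\<ge>N. \<forall>j\<ge>N. (LINT x|unit_measure. norm (s i x - s j x)) < e"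
    if "e > 0" for e
    using metric_CauchyD[OF \<open>Cauchy X\<close> that] by (simp add: dX)
  obtain r where r: "strict_mono r" "AE x in unit_measure. Cauchy (\<lambda>i. s (r i) x)"
    by (rule cauchy_L1_AE_cauchy_subseq[of unit_measure s]) (simp, rule cau)
  define f where "f x = lim (\<lambda>i. s (r i) x)" for x
  have [measurable]: "f \<in> borel_measurable unit_measure"
    unfolding f_def by (rule borel_measurable_lim_metric) simp
  have lim: "AE x in unit_measure. (\<lambda>i. s (r i) x) \<longlonglongrightarrow> f x"
    using r(2) by eventually_elim (simp add: f_def flip: convergent_LIMSEQ_iff Cauchy_convergent_iff)
  have bnd: "(\<integral>\<^sup>+x. norm (s n x - f x) \<partial>unit_measure) \<le> ennreal e"
    if N: "\<And>i j. i \<ge> N \<Longrightarrow> j \<ge> N \<Longrightarrow> dist (X i) (X j) < e" and n: "n \<ge> N" for n N e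
  proof -
    have "(\<integral>\<^sup>+x. norm (s n x - f x) \<partial>unit_measure) =
        (\<integral>\<^sup>+x. liminf (\<lambda>i. ennreal (norm (s n x - s (r i) x))) \<partial>unit_measure)"
    proof (rule nn_integral_cong_AE)
      show "AE x in unit_measure. ennreal (norm (s n x - f x)) =
          liminf (\<lambda>i. ennreal (norm (s n x - s (r i) x)))"
        using lim
      proof eventually_elim
        case (elim x)
        then have "(\<lambda>i. ennreal (norm (s n x - s (r i) x))) \<longlonglongrightarrow> ennreal (norm (s n x - f x))"
          by (intro tendsto_intros)
        then show ?case
          by (rule lim_imp_Liminf[OF sequentially_bot, symmetric])
      qed
    qed
    also have "\<dots> \<le> liminf (\<lambda>i. \<integral>\<^sup>+x. ennreal (norm (s n x - s (r i) x)) \<partial>unit_measure)"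
      by (rule nn_integral_liminf) measurable
    also have "\<dots> \<le> liminf (\<lambda>i. ennreal e)"
    proof (rule Liminf_mono)
      show "\<forall>\<^sub>F i in sequentially.
          (\<integral>\<^sup>+x. ennreal (norm (s n x - s (r i) x)) \<partial>unit_measure) \<le> ennreal e"
        using eventually_ge_at_top[of N]
      proof eventually_elim
        case (elim i)
        then have "r i \<ge> N"
          using seq_suble[OF r(1), of i] by linarith
        then have "dist (X n) (X (r i)) \<le> e"
          using N n by (simp add: less_imp_le)
        then show ?case
          by (subst nn_integral_eq_integral) (auto simp: dX ennreal_leI)
      qed
    qed
    finally show ?thesis
      by (simp add: Liminf_const)
  qed
  obtain N1 where N1: "\<And>i j. i \<ge> N1 \<Longrightarrow> j \<ge> N1 \<Longrightarrow> dist (X i) (X j) < 1"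
    using metric_CauchyD[OF \<open>Cauchy X\<close>, of 1] by auto
  have "L1_integrable (\<lambda>x. s N1 x - f x)"
  proof (rule integrableI_bounded)
    show "(\<integral>\<^sup>+x. norm (s N1 x - f x) \<partial>unit_measure) < \<infinity>"
      using order.strict_trans1[OF bnd[OF N1 order_refl]] by simp
  qed simp
  then have "L1_integrable (\<lambda>x. s N1 x - (s N1 x - f x))"
    by (rule Bochner_Integration.integrable_diff[rotated]) simp
  then have f [simp]: "L1_integrable f"
    by simp
  have "X \<longlonglongrightarrow> abs_L1 f"
  proof (rule metric_LIMSEQ_I)
    fix e :: real assume "e > 0"
    then obtain N where N: "\<And>i j. i \<ge> N \<Longrightarrow> j \<ge> N \<Longrightarrow> dist (X i) (X j) < e / 2"
      using metric_CauchyD[OF \<open>Cauchy X\<close>, of "e / 2"] by auto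
    have "dist (X n) (abs_L1 f) < e" if "n \<ge> N" for n
    proof -
      have "(\<integral>\<^sup>+x. norm (s n x - f x) \<partial>unit_measure) \<le> ennreal (e / 2)"
        using N that by (rule bnd)
      then have "ennreal (LINT x|unit_measure. norm (s n x - f x)) \<le> ennreal (e / 2)"
        by (subst (asm) nn_integral_eq_integral) auto
      then show ?thesis
        using \<open>e > 0\<close> by (simp add: ennreal_le_iff dist_norm X L1_ops norm_abs_L1)
    qed
    then show "\<exists>N. \<forall>n\<ge>N. dist (X n) (abs_L1 f) < e"
      by blast
  qed
  then show "convergent X"
    by (auto simp: convergent_def)
qed

lemma L1_dominated_convergence:
  assumes [simp]: "L1_integrable f" "\<And>i. L1_integrable (s i)"
    and lim: "\<And>x. x \<in> {0..<1} \<Longrightarrow> (\<lambda>i. s i x) \<longlonglongrightarrow> f x"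
    and bnd: "\<And>i x. x \<in> {0..<1} \<Longrightarrow> norm (s i x) \<le> w x"
    and [simp]: "L1_integrable w"
  shows "(\<lambda>i. abs_L1 (s i)) \<longlonglongrightarrow> abs_L1 f"
proof -
  have "(\<lambda>i. LINT x|unit_measure. norm (s i x - f x)) \<longlonglongrightarrow> (LINT x|unit_measure. (0::real))"
  proof (rule integral_dominated_convergence[where w = "\<lambda>x. w x + norm (f x)"])
    show "AE x in unit_measure. (\<lambda>i. norm (s i x - f x)) \<longlonglongrightarrow> 0"
      using lim by (intro AE_I2) (auto simp: space_unit_measure LIM_zero tendsto_norm_zero)
    show "AE x in unit_measure. norm (norm (s i x - f x)) \<le> w x + norm (f x)" for i
    proof (rule AE_I2)
      fix x assume "x \<in> space unit_measure"
      then have "norm (s i x) \<le> w x"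
        using bnd by (simp add: space_unit_measure)
      then show "norm (norm (s i x - f x)) \<le> w x + norm (f x)"
        using norm_triangle_ineq4[of "s i x" "f x"] by simp
    qed
    show "(\<lambda>x. norm (s i x - f x)) \<in> borel_measurable unit_measure" for i
      by (intro borel_measurable_integrable) simp
  qed auto
  moreover have "norm (abs_L1 (s i) - abs_L1 f) = (LINT x|unit_measure. norm (s i x - f x))" for i
    by (subst L1_ops, simp, simp, rule norm_abs_L1) simp
  ultimately show ?thesis
    by (subst Lim_null) (rule tendsto_norm_zero_cancel, simp)
qed

lemma L1_integrable_indicator [simp]:
  "A \<in> sets borel \<Longrightarrow> L1_integrable (\<lambda>x. indicator A x *\<^sub>R c)"
  by (rule Bochner_Integration.integrable_bound[of _ "\<lambda>_. c"])
    (auto simp: indicator_def intro!: L1_measurable)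

lemma L1_separable:
  "\<exists>S::'b::{banach, second_countable_topology} L1 set. countable S \<and> closure S = UNIV"
proof -
  obtain D :: "'b set" where D: "countable D" "\<And>U. open U \<Longrightarrow> U \<noteq> {} \<Longrightarrow> \<exists>d\<in>D. d \<in> U"
    using countable_dense_exists by blast
  have clD: "c \<in> closure D" for c
    unfolding closure_approachable using D(2)[of "ball c e" for e] by (force simp: dist_commute)
  define g where "g = (\<lambda>(q, d). abs_L1 (\<lambda>x. indicator {..<q::real} x *\<^sub>R (d::'b)))"
  define S where "S = (\<lambda>l. sum_list (map g l)) ` lists (\<rat> \<times> D)"
  have cS: "countable S"
    unfolding S_def using D(1) countable_rat by auto
  have S0: "0 \<in> S"
    unfolding S_def by (rule image_eqI[of _ _ "[]"]) auto
  have Sadd: "x + y \<in> S" if "x \<in> S" "y \<in> S" for x y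
  proof -
    from that obtain k l where kl: "k \<in> lists (\<rat> \<times> D)" "l \<in> lists (\<rat> \<times> D)"
      "x = sum_list (map g k)" "y = sum_list (map g l)"
      unfolding S_def by blast
    show ?thesis
      unfolding S_def using kl by (intro image_eqI[of _ _ "k @ l"]) auto
  qed
  have Sg: "g (q, d) \<in> S" if "q \<in> \<rat>" "d \<in> D" for q d
    unfolding S_def using that by (intro image_eqI[of _ _ "[(q, d)]"]) auto
  define C where "C = closure S"
  have C0: "0 \<in> C"
    unfolding C_def using S0 closure_subset by blast
  have Cadd: "x + y \<in> C" if "x \<in> C" "y \<in> C" for x y
  proof -
    from that obtain u v where "\<And>n. u n \<in> S" "u \<longlonglongrightarrow> x" "\<And>n. v n \<in> S" "v \<longlonglongrightarrow> y"
      unfolding C_def closure_sequential by blast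
    then show ?thesis
      unfolding C_def closure_sequential
      by (intro exI[of _ "\<lambda>n. u n + v n"]) (auto intro: Sadd tendsto_add)
  qed
  have Clim: "l \<in> C" if "\<And>n. u n \<in> C" "u \<longlonglongrightarrow> l" for u l
    using that closed_closure[of S] unfolding C_def closed_sequential_limits by blast
  have basic: "abs_L1 (\<lambda>x. indicator {..<a} x *\<^sub>R c) \<in> C" for a :: real and c :: 'b
  proof -
    have "\<exists>q\<in>\<rat>. a - 1 / Suc n < q \<and> q < a" for n
      by (rule Rats_dense_in_real) simp
    then obtain q where q: "\<And>n. q n \<in> \<rat>" "\<And>n. a - 1 / Suc n < q n" "\<And>n. q n < a"
      by metis
    have qa: "q \<longlonglongrightarrow> a"
    proof (rule tendsto_sandwich[of "\<lambda>n. a - 1 / Suc n" _ _ "\<lambda>_. a"])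
      have "(\<lambda>n. 1 / real (Suc n)) \<longlonglongrightarrow> 0"
        by (rule LIMSEQ_Suc[OF lim_1_over_n])
      from tendsto_diff[OF tendsto_const this, of a]
      show "(\<lambda>n. a - 1 / Suc n) \<longlonglongrightarrow> a" by simp
    qed (use q(2,3) in \<open>auto intro!: always_eventually less_imp_le simp del: of_nat_Suc\<close>)
    obtain d where d: "\<And>n. d n \<in> D" "d \<longlonglongrightarrow> c"
      using clD[of c] unfolding closure_sequential by blast
    obtain B where B: "\<And>n. norm (d n) \<le> B"
      using convergent_imp_Bseq[of d] d(2) unfolding convergent_def Bseq_def by blast
    have "(\<lambda>n. abs_L1 (\<lambda>x. indicator {..<q n} x *\<^sub>R d n)) \<longlonglongrightarrow>
        abs_L1 (\<lambda>x. indicator {..<a} x *\<^sub>R c)"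
    proof (rule L1_dominated_convergence[where w = "\<lambda>_. B"])
      fix x :: real
      have "\<forall>\<^sub>F n in sequentially. indicator {..<q n} x = (indicator {..<a} x :: real)"
      proof (cases "x < a")
        case True
        then show ?thesis
          using order_tendstoD(1)[OF qa True] by (auto elim: eventually_mono)
      next
        case False
        then show ?thesis
          using q(3) by (intro always_eventually) (auto simp: indicator_def intro: less_trans)
      qed
      then have "(\<lambda>n. indicator {..<q n} x :: real) \<longlonglongrightarrow> indicator {..<a} x"
        by (rule tendsto_eventually)
      then show "(\<lambda>n. indicator {..<q n} x *\<^sub>R d n) \<longlonglongrightarrow> indicator {..<a} x *\<^sub>R c"
        using d(2) by (rule tendsto_scaleR)
      show "norm (indicator {..<q n} x *\<^sub>R d n) \<le> B" for n
        using B[of n] order_trans[OF norm_ge_zero B[of n]] by (simp add: indicator_def)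
    qed simp_all
    moreover have "abs_L1 (\<lambda>x. indicator {..<q n} x *\<^sub>R d n) \<in> C" for n
      using Sg[OF q(1) d(1), of n n] closure_subset[of S] by (auto simp: g_def C_def)
    ultimately show ?thesis
      by (rule Clim[rotated])
  qed
  have const: "abs_L1 (\<lambda>x. c) \<in> C" for c :: 'b
  proof -
    have "abs_L1 (\<lambda>x. c) = abs_L1 (\<lambda>x. indicator {..<1} x *\<^sub>R c)"
      by (rule abs_L1_eqI) (auto intro!: AE_I2 simp: space_unit_measure)
    then show ?thesis using basic by simp
  qed
  have ind: "\<forall>c::'b. abs_L1 (\<lambda>x. indicator A x *\<^sub>R c) \<in> C" if "A \<in> sets borel" for A :: "real set"
  proof -
    have bor: "sets (borel :: real measure) = sigma_sets UNIV (range lessThan)"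
      by (subst borel_Iio) simp
    have stable: "Int_stable (range (lessThan :: real \<Rightarrow> _))"
    proof -
      have "{..<a} \<inter> {..<b} = {..<min a b}" for a b :: real by auto
      then show ?thesis unfolding Int_stable_def by auto
    qed
    have "A \<in> sigma_sets UNIV (range lessThan)"
      using that bor by simp
    from stable subset_UNIV[of "range lessThan", folded Pow_UNIV] this show ?thesis
    proof (induction rule: sigma_sets_induct_disjoint)
      case (basic A)
      then show ?case using \<open>\<And>a c. abs_L1 (\<lambda>x. indicator {..<a} x *\<^sub>R c) \<in> C\<close> by auto
    next
      case empty
      then show ?case using C0 by (simp add: L1_zero)
    next
      case (compl A)
      then have [simp]: "A \<in> sets borel" by (simp add: bor)
      show ?case
      proof
        fix c :: 'b
        have "(\<lambda>x. indicator (UNIV - A) x *\<^sub>R c) = (\<lambda>x. c + indicator A x *\<^sub>R (- c))"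
          by (auto simp: indicator_def fun_eq_iff)
        then have "abs_L1 (\<lambda>x. indicator (UNIV - A) x *\<^sub>R c) =
            abs_L1 (\<lambda>x. c) + abs_L1 (\<lambda>x. indicator A x *\<^sub>R (- c))"
          by (simp only: L1_ops(1) L1_integrable_const L1_integrable_indicator \<open>A \<in> sets borel\<close>)
        then show "abs_L1 (\<lambda>x. indicator (UNIV - A) x *\<^sub>R c) \<in> C"
          using Cadd[OF const[of c]] compl(2)[rule_format, of "- c"] by (simp only:)
      qed
    next
      case (union A)
      then have [simp]: "A i \<in> sets borel" for i by (auto simp: bor)
      show ?case
      proof
        fix c :: 'b
        define u where "u n x = indicator (\<Union>i<n. A i) x *\<^sub>R c" for n and x :: real
        have [simp]: "L1_integrable (u n)" for n
          unfolding u_def by (rule L1_integrable_indicator) auto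
        have "abs_L1 (u n) \<in> C" for n
        proof (induction n)
          case 0
          then show ?case using C0 by (simp add: u_def L1_zero)
        next
          case (Suc n)
          have "u (Suc n) x = u n x + indicator (A n) x *\<^sub>R c" for x
          proof (cases "x \<in> A n")
            case True
            then have "x \<notin> A i" if "i < n" for i
              using disjoint_family_onD[OF union(1), of i n] that by blast
            then show ?thesis
              using True by (auto simp: u_def indicator_def lessThan_Suc)
          next
            case False
            then show ?thesis
              by (auto simp: u_def indicator_def lessThan_Suc)
          qed
          then have "u (Suc n) = (\<lambda>x. u n x + indicator (A n) x *\<^sub>R c)"
            by (rule ext)
          then have "abs_L1 (u (Suc n)) = abs_L1 (u n) + abs_L1 (\<lambda>x. indicator (A n) x *\<^sub>R c)"
            by (simp only: L1_ops(1) \<open>L1_integrable (u n)\<close> L1_integrable_indicator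
                \<open>A n \<in> sets borel\<close>)
          moreover have "abs_L1 (\<lambda>x. indicator (A n) x *\<^sub>R c) \<in> C"
            using union(3) by blast
          ultimately show ?case
            using Cadd[OF Suc] by simp
        qed
        moreover have "(\<lambda>n. abs_L1 (u n)) \<longlonglongrightarrow> abs_L1 (\<lambda>x. indicator (\<Union>i. A i) x *\<^sub>R c)"
        proof (rule L1_dominated_convergence[where w = "\<lambda>_. norm c"])
          fix x :: real
          show "(\<lambda>n. u n x) \<longlonglongrightarrow> indicator (\<Union>i. A i) x *\<^sub>R c"
            unfolding u_def by (intro tendsto_scaleR tendsto_const LIMSEQ_indicator_UN)
          show "norm (u n x) \<le> norm c" for n
            by (simp add: u_def indicator_def)
        next
          show "L1_integrable (\<lambda>x. indicator (\<Union>i. A i) x *\<^sub>R c)"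
            by (rule L1_integrable_indicator) auto
        qed simp_all
        ultimately show "abs_L1 (\<lambda>x. indicator (\<Union>i. A i) x *\<^sub>R c) \<in> C"
          by (rule Clim)
      qed
    qed
  qed
  have all: "abs_L1 f \<in> C" if "L1_integrable f" for f :: "real \<Rightarrow> 'b"
    using that
  proof (induction rule: integrable_induct)
    case (base A c)
    then obtain B where B: "B \<in> sets borel" "A = {0..<1} \<inter> B"
      by (auto simp: sets_restrict_space)
    have "abs_L1 (\<lambda>x. indicator A x *\<^sub>R c) = abs_L1 (\<lambda>x. indicator B x *\<^sub>R c)"
    proof (rule abs_L1_eqI)
      show "AE x in unit_measure. indicator A x *\<^sub>R c = indicator B x *\<^sub>R c"
        using B by (intro AE_I2) (auto simp: space_unit_measure indicator_def)
    qed (use B in simp_all)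
    then show ?case using ind[OF B(1)] by simp
  next
    case (add f g)
    then show ?case using Cadd[of "abs_L1 f" "abs_L1 g"] by (simp add: L1_ops(1))
  next
    case (lim f s)
    have "(\<lambda>i. abs_L1 (s i)) \<longlonglongrightarrow> abs_L1 f"
      using lim by (intro L1_dominated_convergence[where w = "\<lambda>x. 2 * norm (f x)"])
        (simp_all add: space_unit_measure)
    with lim.IH show ?case
      by (rule Clim)
  qed
  have "F \<in> C" for F
    using all[OF rep_L1_integrable[of F]] by (simp add: abs_rep_L1)
  then show ?thesis
    using cS by (auto simp: C_def)
qed

instance L1 :: ("{banach, second_countable_topology}") second_countable_topology
proof
  obtain S :: "'a L1 set" where S: "countable S" "closure S = UNIV"
    using L1_separable by blast
  define B where "B = (\<lambda>(x, q). ball x q) ` (S \<times> \<rat>)"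
  have B: "topological_basis B"
  proof (rule topological_basisI)
    fix U and x :: "'a L1"
    assume "open U" "x \<in> U"
    then obtain e where e: "e > 0" "ball x e \<subseteq> U"
      by (meson openE)
    obtain q where q: "q \<in> \<rat>" "e / 4 < q" "q < e / 2"
      using Rats_dense_in_real[of "e / 4" "e / 2"] e(1) by auto
    have "x \<in> closure S" using S by simp
    then obtain y where y: "y \<in> S" "dist y x < e / 4"
      unfolding closure_approachable using e(1) by (metis zero_less_divide_iff zero_less_numeral)
    have "ball y q \<subseteq> ball x e"
    proof
      fix z assume "z \<in> ball y q"
      then show "z \<in> ball x e"
        using dist_triangle[of x z y] y q e(1) by (simp add: dist_commute)
    qed
    moreover have "x \<in> ball y q" using y q by simp
    moreover have "ball y q \<in> B"
      unfolding B_def using q(1) y(1) by (intro image_eqI[of _ _ "(y, q)"]) simp_all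
    ultimately show "\<exists>B'\<in>B. x \<in> B' \<and> B' \<subseteq> U"
      using e(2) by (meson order_trans)
  qed (auto simp: B_def)
  have "countable B"
    unfolding B_def using S(1) countable_rat by auto
  then show "\<exists>B::'a L1 set set. countable B \<and> open = generate_topology B"
    using topological_basis_imp_subbasis[OF B] by (intro exI[of _ B] conjI)
qed


section \<open>Schauder bases and the factorization property\<close>

definition schauder_basis :: "(nat \<Rightarrow> 'a::banach) \<Rightarrow> bool" where
  "schauder_basis e \<longleftrightarrow> (\<forall>x. \<exists>!a. (\<lambda>n. a n *\<^sub>R e n) sums x)"

text \<open>
  A system indexed by a countably infinite set \<open>A\<close> rather than by the natural numbers; only
  the existence of some linear order making it a Schauder basis is required.  The functionals \<open>e'\<close>
  are bounded and biorthogonal to \<open>e\<close>, hence are the coordinate functionals for every such order.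
\<close>
definition normalized_basis_on ::
    "'i set \<Rightarrow> ('i \<Rightarrow> 'a::banach) \<Rightarrow> ('i \<Rightarrow> 'a \<Rightarrow> real) \<Rightarrow> bool" where
  "normalized_basis_on A e e' \<longleftrightarrow>
     (\<exists>\<pi>::nat \<Rightarrow> 'i. bij_betw \<pi> UNIV A \<and> schauder_basis (\<lambda>n. e (\<pi> n))) \<and>
     (\<forall>i\<in>A. norm (e i) = 1) \<and>
     (\<forall>i\<in>A. bounded_linear (e' i)) \<and>
     (\<forall>i\<in>A. \<forall>j\<in>A. e' i (e j) = (if i = j then 1 else 0))"

definition id_factors_through :: "real \<Rightarrow> ('a::real_normed_vector \<Rightarrow>\<^sub>L 'a) \<Rightarrow> bool" where
  "id_factors_through K T \<longleftrightarrow>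
     (\<exists>R S :: 'a \<Rightarrow>\<^sub>L 'a. norm R * norm S \<le> K \<and> S o\<^sub>L T o\<^sub>L R = id_blinfun)"

definition id_almost_factors_through :: "real \<Rightarrow> ('a::real_normed_vector \<Rightarrow>\<^sub>L 'a) \<Rightarrow> bool" where
  "id_almost_factors_through K T \<longleftrightarrow> (\<forall>\<epsilon>>0. id_factors_through (K + \<epsilon>) T)"

definition factorization_property ::
    "(real \<Rightarrow> real) \<Rightarrow> 'i set \<Rightarrow> ('i \<Rightarrow> 'a::banach) \<Rightarrow> ('i \<Rightarrow> 'a \<Rightarrow> real) \<Rightarrow> bool" where
  "factorization_property K A e e' \<longleftrightarrow>
     normalized_basis_on A e e' \<and>
     (\<forall>\<delta>>0. \<forall>T :: 'a \<Rightarrow>\<^sub>L 'a. (INF i\<in>A. \<bar>e' i (blinfun_apply T (e i))\<bar>) \<ge> \<delta> \<longrightarrow>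
        id_almost_factors_through (K \<delta>) T)"


section \<open>The bi-parameter Haar system\<close>

definition dyadic :: "real set set" where
  "dyadic = {{(real i - 1) / 2 ^ j ..< real i / 2 ^ j} | i j :: nat. 1 \<le> i \<and> i \<le> 2 ^ j}"

definition dyadic_plus :: "real set set" where
  "dyadic_plus = insert {} dyadic"

definition left_half :: "real set \<Rightarrow> real set" where
  "left_half I = {Inf I ..< (Inf I + Sup I) / 2}"

definition right_half :: "real set \<Rightarrow> real set" where
  "right_half I = {(Inf I + Sup I) / 2 ..< Sup I}"

definition haar :: "real set \<Rightarrow> real \<Rightarrow> real" where
  "haar I t = (if I = {} then indicator {0..<1} t
     else indicator (left_half I) t - indicator (right_half I) t)"

text \<open>
  \<open>abs_L1 f\<close> is the class of an integrable function \<open>f\<close>, and \<open>rep_L1 F\<close> is some representative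
  of \<open>F\<close>.  Thus \<open>real L1 L1\<close> is \<open>L\<^sup>1(L\<^sup>1)\<close>, and the function \<open>(s, t) \<mapsto> f s * g t\<close> is the
  class of the vector-valued function sending \<open>s\<close> to \<open>f s\<close> times the class of \<open>g\<close>.
\<close>
definition tensor_L1 :: "(real \<Rightarrow> real) \<Rightarrow> (real \<Rightarrow> real) \<Rightarrow> real L1 L1" where
  "tensor_L1 f g = abs_L1 (\<lambda>s. f s *\<^sub>R abs_L1 g)"

definition normalized_haar2 :: "real set \<times> real set \<Rightarrow> real L1 L1" where
  "normalized_haar2 = (\<lambda>(I, J). tensor_L1 (haar I) (haar J) /\<^sub>R norm (tensor_L1 (haar I) (haar J)))"

text \<open>
  Integration against \<open>h\<^sub>I \<otimes> h\<^sub>J\<close>.  No normalizing factor is needed for biorthogonality to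
  the normalized system, since \<open>\<bar>h\<^sub>I \<otimes> h\<^sub>J\<bar> = (h\<^sub>I \<otimes> h\<^sub>J)\<^sup>2\<close>.
\<close>
definition haar2_functional :: "real set \<times> real set \<Rightarrow> real L1 L1 \<Rightarrow> real" where
  "haar2_functional = (\<lambda>(I, J) F. LINT s|unit_measure. haar I s *
     (LINT t|unit_measure. haar J t * rep_L1 (rep_L1 F s) t))"

end

theory Submission
  imports Defs "HOL-Library.Discrete_Functions"
begin

text \<open>
  The factorization is read off from the diagonal entries at squares \<open>I \<times> J\<close>.  Interleaving the
  binary digits of the two coordinates identifies \<open>L\<^sup>1(L\<^sup>1)\<close> isometrically with \<open>L\<^sup>1\<close> of \<open>[0, 1)\<close>; squares
  of side \<open>1 / 2 ^ l\<close> become dyadic intervals of length \<open>1 / 4 ^ l\<close>, and \<open>h\<^sub>I \<otimes> h\<^sub>J\<close> becomes the pattern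
  \<open>+ - - +\<close> on the four quarters of an interval (\<open>fold_square\<close>, \<open>fold_square_quad\<close>).

  Let \<open>T\<close> be a bounded operator on \<open>L\<^sup>1\<close> of the interval and write \<open>\<chi>\<^sub>j\<close> for the indicator of a dyadic
  interval \<open>j\<close>.  The mass of \<open>T \<chi>\<^sub>j\<close> outside \<open>j\<close>, summed over the intervals \<open>j\<close> of one level, increases with
  the level and is bounded by the norm of \<open>T\<close>.  Therefore the mass that stays within the ancestor of
  level \<open>n\<close> but leaves \<open>j\<close> has a sum that tends to 0 with \<open>n\<close>, uniformly in the level of \<open>j\<close>
  (\<open>off_diagonal_vanishes\<close>).  It follows that the sums of \<open>\<chi>\<^sub>j T \<chi>\<^sub>j\<close> over the levels converge in \<open>L\<^sup>1\<close> to a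
  function \<open>a\<close>, the multiplication part of \<open>T\<close>, and that the averages of \<open>a\<close> are close to the diagonal
  entries of \<open>T\<close>.  If these are at least \<open>\<delta>\<close> in modulus, then \<open>\<bar>a\<bar> \<ge> \<delta>\<close> almost everywhere
  (\<open>diagonal_limit_large\<close>).

  A stopping argument discards the intervals on which \<open>T\<close> differs too much from multiplication by \<open>a\<close>
  relative to their length.  What is left is a set \<open>E\<close> of positive measure inside one dyadic interval \<open>Q\<close>
  such that \<open>f \<mapsto> \<chi>\<^sub>Q a\<^sup>-\<^sup>1 T f\<close> is nearly the identity on functions supported in \<open>E\<close>
  (\<open>good_set\<close>, \<open>almost_multiplication_on_good_set\<close>).  Since \<open>L\<^sup>1(E)\<close> contains a copy of \<open>L\<^sup>1\<close> that is the
  range of a contractive projection, and dividing by \<open>a\<close> has norm at most \<open>1 / \<delta>\<close>, the identity factors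
  through \<open>T\<close> with a constant as close to \<open>1 / \<delta>\<close> as desired (\<open>L1_identity_factors\<close>).

  The Haar system is a basis because its partial sums in the order of the dyadic tree are averages
  over partitions (\<open>haar_sum_eq_average\<close>).  In two parameters rectangular partial sums are then
  contractions, and in an enumeration by square shells every partial sum is made of three of them
  (\<open>norm_shell_sum_le\<close>).
\<close>

section \<open>The binary tree of dyadic intervals\<close>

definition node_length :: "nat \<Rightarrow> real" where
  "node_length k = 1 / 2 ^ floor_log k"

text \<open>
  The dyadic intervals are numbered like the nodes of a binary heap: node 1 is \<open>[0, 1)\<close>, and the
  halves of node \<open>k\<close> are the nodes \<open>2 k\<close> and \<open>2 k + 1\<close>.  Halving the index is passing to the parent,
  and the intervals of length \<open>1 / 2 ^ l\<close> are the nodes \<open>2 ^ l, \<dots>, 2 ^ (l + 1) - 1\<close>.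
\<close>
definition node :: "nat \<Rightarrow> real set" where
  "node k = {real k * node_length k - 1 ..< real (Suc k) * node_length k - 1}"

lemma node_length_pos [simp]: "node_length k > 0"
  by (simp add: node_length_def)

lemma node_length_nonneg [simp]: "node_length k \<ge> 0"
  by (simp add: node_length_def)

lemma node_length_neq_0 [simp]: "node_length k \<noteq> 0"
  by (simp add: node_length_def)

lemma node_length_1 [simp]: "node_length 1 = 1" "node_length (Suc 0) = 1"
  by (simp_all add: node_length_def)

lemma floor_log_double_Suc [simp]: "k \<ge> 1 \<Longrightarrow> floor_log (Suc (2 * k)) = Suc (floor_log k)"
  by (subst floor_log_rec) auto

lemma node_length_children:
  assumes "k \<ge> 1"
  shows "node_length (2 * k) = node_length k / 2" "node_length (Suc (2 * k)) = node_length k / 2"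
  using assms by (simp_all add: node_length_def)

lemma node_length_level:
  assumes "k \<in> {2 ^ l..<2 * 2 ^ l}"
  shows "node_length k = 1 / 2 ^ l"
  using assms floor_log_eqI[of k l] by (simp add: node_length_def)

lemma node_nonempty [simp]: "node k \<noteq> {}"
  by (simp add: node_def)

lemma node_borel [measurable, simp]: "node k \<in> sets borel"
  by (simp add: node_def)

lemma node_1: "node 1 = {0..<1}"
  by (simp add: node_def)

lemma node_children:
  assumes "k \<ge> 1"
  shows "node (2 * k) \<union> node (Suc (2 * k)) = node k" "node (2 * k) \<inter> node (Suc (2 * k)) = {}"
proof -
  have split: "{a..<b} \<union> {b..<c} = {a..<c}" "{a..<b} \<inter> {b..<c} = {}" if "a < b" "b < c" for a b c :: real
    using that by auto
  have "real k * node_length k - 1 < (real k + 1/2) * node_length k - 1"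
    "(real k + 1/2) * node_length k - 1 < real (Suc k) * node_length k - 1"
    using node_length_pos[of k] by (simp_all add: algebra_simps)
  moreover have "node (2 * k) = {real k * node_length k - 1 ..< (real k + 1/2) * node_length k - 1}"
    "node (Suc (2 * k)) = {(real k + 1/2) * node_length k - 1 ..< real (Suc k) * node_length k - 1}"
    unfolding node_def node_length_children[OF assms] by (simp_all add: algebra_simps add_divide_distrib)
  ultimately show "node (2 * k) \<union> node (Suc (2 * k)) = node k"
    "node (2 * k) \<inter> node (Suc (2 * k)) = {}"
    using split unfolding node_def by simp_all
qed

lemma indicator_node_children:
  assumes "k \<ge> 1"
  shows "(indicator (node k) x :: real) = indicator (node (2 * k)) x + indicator (node (Suc (2 * k))) x"
  using node_children[OF assms] by (auto simp: indicator_def)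

lemma node_parent_subset:
  assumes "k \<ge> 2"
  shows "node k \<subseteq> node (k div 2)"
proof -
  have "k = 2 * (k div 2) \<or> k = Suc (2 * (k div 2))" by presburger
  then show ?thesis
    using node_children(1)[of "k div 2"] assms by auto
qed

lemma node_subset_unit: "k \<ge> 1 \<Longrightarrow> node k \<subseteq> {0..<1}"
proof (induction k rule: less_induct)
  case (less k)
  show ?case
  proof (cases "k = 1")
    case False
    then show ?thesis
      using less.IH[of "k div 2"] node_parent_subset[of k] less.prems by fastforce
  qed (use node_1 in simp)
qed

lemma sum_split_node:
  fixes f :: "nat \<Rightarrow> 'a::ab_group_add"
  assumes "N \<ge> 1"
  shows "sum f {Suc N..<2 * Suc N} = sum f {N..<2 * N} - f N + f (2 * N) + f (Suc (2 * N))"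
proof -
  have "sum f {N..<2 * N} = f N + sum f {Suc N..<2 * N}"
    using assms by (intro sum.atLeast_Suc_lessThan) simp
  moreover have "2 * Suc N = Suc (Suc (2 * N))" by simp
  ultimately show ?thesis
    using assms by (simp add: algebra_simps)
qed

lemma sum_children:
  fixes f :: "nat \<Rightarrow> 'a::comm_monoid_add"
  assumes "N \<le> M"
  shows "sum f {2 * N..<2 * M} = (\<Sum>k\<in>{N..<M}. f (2 * k) + f (Suc (2 * k)))"
  using assms by (induction M rule: dec_induct) (simp_all add: add.assoc)

text \<open>
  Splitting the node \<open>N\<close> turns the nodes \<open>N, \<dots>, 2 N - 1\<close> into the nodes \<open>N + 1, \<dots>, 2 N + 1\<close>, so
  every block \<open>{N..<2 * N}\<close> is a partition of the unit interval.
\<close>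
lemma sum_indicator_nodes:
  assumes "N \<ge> 1" "x \<in> {0..<1}"
  shows "(\<Sum>k\<in>{N..<2 * N}. indicator (node k) x) = (1::real)"
  using assms(1)
proof (induction N rule: dec_induct)
  case base
  have "{1..<2 * 1} = {1::nat}" by auto
  then show ?case using assms(2) node_1 by (simp add: indicator_def)
next
  case (step N)
  then show ?case
    by (simp add: sum_split_node indicator_node_children[of N] del: mult_Suc_right)
qed

lemma nodes_disjoint:
  assumes "i \<in> {N..<2 * N}" "j \<in> {N..<2 * N}" "i \<noteq> j"
  shows "node i \<inter> node j = {}"
proof (rule ccontr)
  assume "node i \<inter> node j \<noteq> {}"
  then obtain x where x: "x \<in> node i" "x \<in> node j" by blast
  have N: "N \<ge> 1" using assms by auto
  have "x \<in> {0..<1}" using x node_subset_unit[of i] assms by auto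
  then have "1 = (\<Sum>k\<in>{N..<2 * N}. indicator (node k) x :: real)"
    using sum_indicator_nodes[OF N] by simp
  also have "\<dots> \<ge> (\<Sum>k\<in>{i, j}. indicator (node k) x :: real)"
    using assms by (intro sum_mono2) auto
  also have "(\<Sum>k\<in>{i, j}. indicator (node k) x :: real) = 2"
    using x assms by simp
  finally show False by simp
qed

lemma node_exists:
  assumes "N \<ge> 1" "x \<in> {0..<1}"
  obtains k where "k \<in> {N..<2 * N}" "x \<in> node k"
proof -
  have "\<exists>k\<in>{N..<2 * N}. x \<in> node k"
  proof (rule ccontr)
    assume "\<not> ?thesis"
    then have "(\<Sum>k\<in>{N..<2 * N}. indicator (node k) x :: real) = 0"
      by (intro sum.neutral) auto
    then show False using sum_indicator_nodes[OF assms] by simp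
  qed
  then show thesis using that by blast
qed

lemma sum_over_nodes:
  fixes y :: "nat \<Rightarrow> 'a::real_vector"
  assumes "j \<in> {N..<2 * N}" "x \<in> node j"
  shows "(\<Sum>k\<in>{N..<2 * N}. indicator (node k) x *\<^sub>R y k) = y j"
proof -
  have "(\<Sum>k\<in>{N..<2 * N}. indicator (node k) x *\<^sub>R y k) = (\<Sum>k\<in>{j}. indicator (node k) x *\<^sub>R y k)"
    using assms nodes_disjoint[OF assms(1)] by (intro sum.mono_neutral_right) (fastforce simp: indicator_def)+
  then show ?thesis using assms by simp
qed

lemma node_below:
  assumes "j \<le> i" "1 \<le> j"
  shows "node i \<inter> node j = {} \<or> node i \<subseteq> node j"
  using assms
proof (induction i rule: less_induct)
  case (less i)
  show ?case
  proof (cases "i < 2 * j")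
    case True
    then show ?thesis using nodes_disjoint[of i j j] less.prems by (cases "i = j") auto
  next
    case False
    then have "j \<le> i div 2" "i div 2 < i" "i \<ge> 2" using less.prems by auto
    then show ?thesis using less.IH[of "i div 2"] node_parent_subset[of i] less.prems by blast
  qed
qed

lemma nodes_nested:
  assumes "i \<ge> 1" "j \<ge> 1"
  shows "node i \<inter> node j = {} \<or> node i \<subseteq> node j \<or> node j \<subseteq> node i"
  using node_below[of j i] node_below[of i j] assms by (cases "i \<ge> j") auto

section \<open>Elementary operations on \<open>L\<^sup>1\<close>\<close>

lemma space_unit [simp]: "space unit_measure = {0..<1}"
  by (rule space_unit_measure)

lemma measure_node: "k \<ge> 1 \<Longrightarrow> measure unit_measure (node k) = node_length k"
  using node_subset_unit[of k]
  by (simp add: measure_restrict_space node_def algebra_simps)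

lemma sets_unit: "A \<in> sets unit_measure \<longleftrightarrow> A \<subseteq> {0..<1} \<and> A \<in> sets borel"
  by (subst sets_restrict_space_iff) auto

lemma rep_L1_measurable [measurable]: "rep_L1 F \<in> borel_measurable unit_measure"
  by (rule borel_measurable_integrable[OF rep_L1_integrable])

lemma integrable_scaled:
  fixes f :: "real \<Rightarrow> 'b::{banach, second_countable_topology}"
  assumes [measurable]: "\<phi> \<in> borel_measurable unit_measure" and B: "\<And>x. x \<in> {0..<1} \<Longrightarrow> \<bar>\<phi> x\<bar> \<le> B"
    and f: "L1_integrable f"
  shows "L1_integrable (\<lambda>x. \<phi> x *\<^sub>R f x)"
proof (rule Bochner_Integration.integrable_bound)
  show "L1_integrable (\<lambda>x. B * norm (f x))"
    using f by simp
  show "AE x in unit_measure. norm (\<phi> x *\<^sub>R f x) \<le> norm (B * norm (f x))"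
  proof (rule AE_I2)
    fix x assume "x \<in> space unit_measure"
    then have "\<bar>\<phi> x\<bar> \<le> \<bar>B\<bar>" using B[of x] by simp
    then show "norm (\<phi> x *\<^sub>R f x) \<le> norm (B * norm (f x))"
      by (simp add: abs_mult mult_right_mono)
  qed
qed (use f in measurable)

lemma rep_L1_ops:
  shows "AE x in unit_measure. rep_L1 (F + G) x = rep_L1 F x + rep_L1 G x"
    and "AE x in unit_measure. rep_L1 (F - G) x = rep_L1 F x - rep_L1 G x"
    and "AE x in unit_measure. rep_L1 (c *\<^sub>R F) x = c *\<^sub>R rep_L1 F x"
proof -
  have *: "L1_integrable (rep_L1 F)" "L1_integrable (rep_L1 G)" by (rule rep_L1_integrable)+
  have "F + G = abs_L1 (\<lambda>x. rep_L1 F x + rep_L1 G x)" "F - G = abs_L1 (\<lambda>x. rep_L1 F x - rep_L1 G x)"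
    using L1_ops[OF *] by (simp_all add: abs_rep_L1)
  then show "AE x in unit_measure. rep_L1 (F + G) x = rep_L1 F x + rep_L1 G x"
    "AE x in unit_measure. rep_L1 (F - G) x = rep_L1 F x - rep_L1 G x"
    using * by (simp_all add: rep_abs_L1)
  have "c *\<^sub>R F = abs_L1 (\<lambda>x. c *\<^sub>R rep_L1 F x)"
    using scaleR_abs_L1[OF *(1), of c] by (simp add: abs_rep_L1)
  then show "AE x in unit_measure. rep_L1 (c *\<^sub>R F) x = c *\<^sub>R rep_L1 F x"
    using * by (simp add: rep_abs_L1)
qed

lemma norm_L1_rep: "norm F = (LINT x|unit_measure. norm (rep_L1 F x))"
  using norm_abs_L1[OF rep_L1_integrable[of F]] by (simp add: abs_rep_L1)

text \<open>
  With \<open>l\<close> the identity of the reals this is integration against \<open>\<phi>\<close>; with \<open>l\<close> a functional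
  on the value space it is integration against \<open>\<phi> \<otimes> l\<close>.
\<close>
definition weighted_integral ::
    "(real \<Rightarrow> real) \<Rightarrow> ('b::{banach, second_countable_topology} \<Rightarrow> real) \<Rightarrow> 'b L1 \<Rightarrow> real" where
  "weighted_integral \<phi> l F = (LINT x|unit_measure. \<phi> x * l (rep_L1 F x))"

lemma weighted_integrable:
  fixes l :: "'b::{banach, second_countable_topology} \<Rightarrow> real"
  assumes "\<phi> \<in> borel_measurable unit_measure" "\<And>x. x \<in> {0..<1} \<Longrightarrow> \<bar>\<phi> x\<bar> \<le> B"
    and "bounded_linear l" "L1_integrable f"
  shows "L1_integrable (\<lambda>x. \<phi> x * l (f x))"
  using integrable_scaled[of \<phi> B "\<lambda>x. l (f x)"] integrable_bounded_linear[OF assms(3,4)] assms(1,2) by simp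

lemma weighted_integral_abs:
  assumes [measurable]: "\<phi> \<in> borel_measurable unit_measure" and "bounded_linear l"
    and [simp]: "L1_integrable f"
  shows "weighted_integral \<phi> l (abs_L1 f) = (LINT x|unit_measure. \<phi> x * l (f x))"
proof -
  have [measurable]: "l \<in> borel_measurable borel"
    by (intro borel_measurable_continuous_onI bounded_linear.continuous_on[OF assms(2)] continuous_on_id)
  have [measurable]: "f \<in> borel_measurable unit_measure" by (rule borel_measurable_integrable) simp
  show ?thesis
    unfolding weighted_integral_def
    by (intro integral_cong_AE AE_mp[OF rep_abs_L1[OF assms(3)] AE_I2]) auto
qed

lemma bounded_linear_weighted_integral:
  fixes l :: "'b::{banach, second_countable_topology} \<Rightarrow> real"
  assumes phi [measurable]: "\<phi> \<in> borel_measurable unit_measure"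
    and B: "\<And>x. x \<in> {0..<1} \<Longrightarrow> \<bar>\<phi> x\<bar> \<le> B" and l: "bounded_linear l"
  shows "bounded_linear (weighted_integral \<phi> l)"
proof -
  interpret l: bounded_linear l by fact
  obtain C where C: "C \<ge> 0" "\<And>y. \<bar>l y\<bar> \<le> norm y * C"
    using l.nonneg_bounded by auto
  have [measurable]: "l \<in> borel_measurable borel"
    by (intro borel_measurable_continuous_onI l.continuous_on continuous_on_id)
  have "B \<ge> 0" using B[of 0] by simp
  note int = weighted_integrable[OF phi B l rep_L1_integrable]
  show ?thesis
  proof (rule bounded_linear_intro[where K = "B * C"])
    fix F G :: "'b L1" and c :: real
    have "weighted_integral \<phi> l (F + G) =
        (LINT x|unit_measure. \<phi> x * l (rep_L1 F x) + \<phi> x * l (rep_L1 G x))"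
      unfolding weighted_integral_def
      by (intro integral_cong_AE AE_mp[OF rep_L1_ops(1)[of F G] AE_I2]) (auto simp: l.add algebra_simps)
    then show "weighted_integral \<phi> l (F + G) = weighted_integral \<phi> l F + weighted_integral \<phi> l G"
      unfolding weighted_integral_def using int by simp
    have "weighted_integral \<phi> l (c *\<^sub>R F) = (LINT x|unit_measure. c * (\<phi> x * l (rep_L1 F x)))"
      unfolding weighted_integral_def
      by (intro integral_cong_AE AE_mp[OF rep_L1_ops(3)[of c F] AE_I2]) (auto simp: l.scaleR)
    then show "weighted_integral \<phi> l (c *\<^sub>R F) = c *\<^sub>R weighted_integral \<phi> l F"
      unfolding weighted_integral_def by simp
    have "norm (weighted_integral \<phi> l F) \<le> (LINT x|unit_measure. norm (rep_L1 F x) * (B * C))"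
      unfolding weighted_integral_def
    proof (rule Bochner_Integration.integral_norm_bound_integral[OF int])
      show "L1_integrable (\<lambda>x. norm (rep_L1 F x) * (B * C))"
        using rep_L1_integrable[of F] by simp
      fix x assume "x \<in> space unit_measure"
      then have "\<bar>\<phi> x\<bar> * \<bar>l (rep_L1 F x)\<bar> \<le> B * (norm (rep_L1 F x) * C)"
        using B C \<open>B \<ge> 0\<close> by (intro mult_mono) auto
      then show "norm (\<phi> x * l (rep_L1 F x)) \<le> norm (rep_L1 F x) * (B * C)"
        by (simp add: abs_mult mult_ac)
    qed
    then show "norm (weighted_integral \<phi> l F) \<le> norm F * (B * C)"
      by (simp add: norm_L1_rep)
  qed
qed

definition step :: "nat \<Rightarrow> 'b \<Rightarrow> 'b::{banach, second_countable_topology} L1" where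
  "step k y = abs_L1 (\<lambda>x. indicator (node k) x *\<^sub>R y)"

lemma sum_abs_L1:
  assumes "finite A" "\<And>i. i \<in> A \<Longrightarrow> L1_integrable (f i)"
  shows "(\<Sum>i\<in>A. abs_L1 (f i)) = abs_L1 (\<lambda>x. \<Sum>i\<in>A. f i x)"
  using assms by (induction A rule: finite_induct) (simp_all add: L1_zero L1_ops(1))

lemma norm_sum_step:
  fixes y :: "nat \<Rightarrow> 'b::{banach, second_countable_topology}"
  assumes "N \<ge> 1"
  shows "norm (\<Sum>k\<in>{N..<2 * N}. step k (y k)) = (\<Sum>k\<in>{N..<2 * N}. node_length k * norm (y k))"
proof -
  have "(\<Sum>k\<in>{N..<2 * N}. step k (y k)) = abs_L1 (\<lambda>x. \<Sum>k\<in>{N..<2 * N}. indicator (node k) x *\<^sub>R y k)"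
    unfolding step_def by (rule sum_abs_L1) auto
  also have "norm \<dots> = (LINT x|unit_measure. norm (\<Sum>k\<in>{N..<2 * N}. indicator (node k) x *\<^sub>R y k))"
    by (intro norm_abs_L1 Bochner_Integration.integrable_sum L1_integrable_indicator) simp
  also have "\<dots> = (LINT x|unit_measure. (\<Sum>k\<in>{N..<2 * N}. indicator (node k) x *\<^sub>R norm (y k)))"
  proof (rule Bochner_Integration.integral_cong[OF refl])
    fix x assume "x \<in> space unit_measure"
    then obtain j where j: "j \<in> {N..<2 * N}" "x \<in> node j" using node_exists[OF assms] by auto
    show "norm (\<Sum>k\<in>{N..<2 * N}. indicator (node k) x *\<^sub>R y k) =
        (\<Sum>k\<in>{N..<2 * N}. indicator (node k) x *\<^sub>R norm (y k))"
      unfolding sum_over_nodes[OF j] ..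
  qed
  also have "\<dots> = (\<Sum>k\<in>{N..<2 * N}. LINT x|unit_measure. indicator (node k) x *\<^sub>R norm (y k))"
    by (intro Bochner_Integration.integral_sum L1_integrable_indicator) simp
  also have "\<dots> = (\<Sum>k\<in>{N..<2 * N}. node_length k * norm (y k))"
    using assms node_subset_unit
    by (intro sum.cong refl) (auto simp: measure_node Int_absorb2)
  finally show ?thesis .
qed

lemma step_children: "k \<ge> 1 \<Longrightarrow> step k y = step (2 * k) y + step (Suc (2 * k)) y"
  by (simp add: step_def L1_ops(1) indicator_node_children[of k] scaleR_add_left)

lemma norm_step: "k \<ge> 1 \<Longrightarrow> norm (step k y) = node_length k * norm y"
  using node_subset_unit[of k]
  by (simp add: step_def norm_abs_L1 measure_node Int_absorb2)

lemma bounded_linear_step: "k \<ge> 1 \<Longrightarrow> bounded_linear (step k)"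
  by (rule bounded_linear_intro[where K = "node_length k"])
    (simp_all add: norm_step, simp_all add: step_def L1_ops(1) scaleR_abs_L1 scaleR_add_right mult_ac)

lemma weighted_integral_step:
  assumes "\<phi> \<in> borel_measurable unit_measure" "bounded_linear l" "k \<ge> 1"
  shows "weighted_integral \<phi> l (step k y) = (LINT x|unit_measure. \<phi> x * indicator (node k) x) * l y"
  unfolding step_def using assms
  by (simp add: weighted_integral_abs bounded_linear.linear linear_cmul mult.assoc flip: mult.assoc)

section \<open>Density of the dyadic step functions\<close>

text \<open>
  Every \<open>[0, a)\<close> is the union of the nodes that it contains.
\<close>
lemma sets_unit_measure_generated: "sets unit_measure = sigma_sets {0..<1} (insert {} (node ` {1..}))"
  (is "_ = sigma_sets _ ?G")
proof
  have G: "?G \<subseteq> Pow {0..<1}" using node_subset_unit by auto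
  have "?G \<subseteq> sets unit_measure" using G by (auto simp: sets_unit)
  then show "sigma_sets {0..<1} ?G \<subseteq> sets unit_measure"
    using sets.sigma_sets_subset[of ?G unit_measure] by simp
  have lt: "{0..<1} \<inter> {..<a} \<in> sigma_sets {0..<1} ?G" for a :: real
  proof -
    have "{0..<1} \<inter> {..<a} = (\<Union>k\<in>{k. k \<ge> 1 \<and> node k \<subseteq> {..<a}}. node k)"
    proof (intro equalityI subsetI)
      fix x assume x: "x \<in> {0..<1} \<inter> {..<a}"
      then obtain l where l: "1 / 2 ^ l < a - x"
        using real_arch_pow_inv[of "a - x" "1/2"] by (auto simp: power_divide)
      obtain k where k: "k \<in> {2 ^ l..<2 * 2 ^ l}" "x \<in> node k"
        using node_exists[of "2 ^ l" x] x by auto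
      have "y < a" if "y \<in> node k" for y
      proof -
        have "y - x < 1 / 2 ^ l"
          using that k(2) by (auto simp: node_def node_length_level[OF k(1)] add_divide_distrib)
        then show ?thesis using l by linarith
      qed
      moreover have "k \<ge> 1" using k(1) by (auto intro: order_trans[of 1 "2 ^ l"])
      ultimately show "x \<in> (\<Union>k\<in>{k. k \<ge> 1 \<and> node k \<subseteq> {..<a}}. node k)"
        using k by blast
    qed (use node_subset_unit in fastforce)
    also have "\<dots> \<in> sigma_sets {0..<1} ?G"
    proof -
      interpret sigma_algebra "{0..<1}" "sigma_sets {0..<1} ?G"
        by (rule sigma_algebra_sigma_sets[OF G])
      show ?thesis
        by (rule countable_UN') (auto intro: sigma_sets.Basic)
    qed
    finally show ?thesis .
  qed
  have "sets unit_measure = (\<inter>) {0..<1} ` sets (borel :: real measure)"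
    by (simp add: sets_restrict_space)
  also have "\<dots> = (\<inter>) {0..<1} ` sigma_sets UNIV (range lessThan)"
    by (subst borel_Iio) simp
  also have "\<dots> = sigma_sets {0..<1} ((\<inter>) {0..<1} ` range lessThan)"
  proof (rule sigma_sets_Int)
    have "{0..<1} \<in> sets (borel :: real measure)" by simp
    then show "{0..<1::real} \<in> sigma_sets UNIV (range lessThan)"
      by (subst (asm) borel_Iio) simp
  qed simp
  also have "\<dots> \<subseteq> sigma_sets {0..<1} ?G"
    using lt by (intro sigma_sets_mono) auto
  finally show "sets unit_measure \<subseteq> sigma_sets {0..<1} ?G" .
qed

text \<open>
  The nodes and the empty set form a generator of the Borel sets that is stable under
  intersection, because nodes are nested or disjoint.  The sets whose multiples of the indicator
  lie in \<open>C\<close> are closed under complements and disjoint countable unions, hence are all Borel sets.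
\<close>
lemma dyadic_steps_dense:
  fixes C :: "'b::{banach, second_countable_topology} L1 set"
  assumes C: "subspace C" "closed C" and step: "\<And>k y. k \<ge> 1 \<Longrightarrow> step k y \<in> C"
  shows "C = UNIV"
proof -
  have lim: "z \<in> C" if "\<And>n. s n \<in> C" "s \<longlonglongrightarrow> z" for s z
    using C(2) that unfolding closed_sequential_limits by blast
  have ind: "abs_L1 (\<lambda>x. indicator A x *\<^sub>R y) \<in> C" if "A \<in> sets unit_measure" for A and y :: 'b
  proof -
    have "Int_stable (insert {} (node ` {1..}))"
      unfolding Int_stable_def
    proof (intro ballI)
      fix A B assume "A \<in> insert {} (node ` {1..})" "B \<in> insert {} (node ` {1..})"
      then consider "A \<inter> B = {}" | i j where "i \<ge> 1" "j \<ge> 1" "A = node i" "B = node j"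
        by auto
      then show "A \<inter> B \<in> insert {} (node ` {1..})"
      proof cases
        case 2
        then show ?thesis
          using nodes_nested[of i j] by (auto simp: Int_absorb1 Int_absorb2)
      qed simp
    qed
    moreover have "insert {} (node ` {1..}) \<subseteq> Pow {0..<1}"
      using node_subset_unit by auto
    moreover have "A \<in> sigma_sets {0..<1} (insert {} (node ` {1..}))"
      using that by (simp add: sets_unit_measure_generated)
    ultimately show ?thesis
    proof (induction rule: sigma_sets_induct_disjoint)
      case (basic A)
      then show ?case
        using step subspace_0[OF C(1)] by (auto simp: step_def L1_zero)
    next
      case empty
      then show ?case using subspace_0[OF C(1)] by (simp add: L1_zero)
    next
      case (compl A)
      then have "A \<in> sets unit_measure" unfolding sets_unit_measure_generated by simp
      then have A: "A \<in> sets borel" by (simp add: sets_unit)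
      have "abs_L1 (\<lambda>x. indicator ({0..<1} - A) x *\<^sub>R y) = step 1 y - abs_L1 (\<lambda>x. indicator A x *\<^sub>R y)"
      proof -
        have [simp]: "L1_integrable (\<lambda>x. indicator B x *\<^sub>R y)" if "B \<in> {node 1, A, {0..<1} - A}" for B
          using A that by (intro L1_integrable_indicator) auto
        have "abs_L1 (\<lambda>x. indicator ({0..<1} - A) x *\<^sub>R y) =
            abs_L1 (\<lambda>x. indicator (node 1) x *\<^sub>R y - indicator A x *\<^sub>R y)"
        proof (rule abs_L1_eqI)
          show "AE x in unit_measure. indicator ({0..<1} - A) x *\<^sub>R y =
              indicator (node 1) x *\<^sub>R y - indicator A x *\<^sub>R y"
            unfolding node_1 by (rule AE_I2) (simp add: indicator_def)
        qed simp_all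
        then show ?thesis by (simp add: step_def L1_ops(2))
      qed
      then show ?case
        using subspace_diff[OF C(1) step[of 1 y] compl(2)] by simp
    next
      case (union A)
      then have A [simp]: "A i \<in> sets borel" for i
        unfolding sets_unit_measure_generated[symmetric] by (auto simp: sets_unit image_subset_iff)
      define u where "u n x = indicator (\<Union>i<n. A i) x *\<^sub>R y" for n and x :: real
      have "abs_L1 (u n) = (\<Sum>i<n. abs_L1 (\<lambda>x. indicator (A i) x *\<^sub>R y))" for n
      proof -
        have "indicator (\<Union>i<n. A i) x = (\<Sum>i<n. indicator (A i) x :: real)" for x
          using union(1) by (intro indicator_UN_disjoint) (auto simp: disjoint_family_on_def)
        then have u: "u n = (\<lambda>x. \<Sum>i<n. indicator (A i) x *\<^sub>R y)"
          by (simp add: u_def fun_eq_iff scaleR_sum_left del: indicator_UN_disjoint sum_of_bool_eq)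
        show ?thesis
          unfolding u by (rule sum_abs_L1[symmetric]) auto
      qed
      then have "abs_L1 (u n) \<in> C" for n
        using union(3) by (simp add: subspace_sum[OF C(1)])
      moreover have "(\<lambda>n. abs_L1 (u n)) \<longlonglongrightarrow> abs_L1 (\<lambda>x. indicator (\<Union>i. A i) x *\<^sub>R y)"
      proof (rule L1_dominated_convergence[where w = "\<lambda>_. norm y"])
        show "(\<lambda>n. u n x) \<longlonglongrightarrow> indicator (\<Union>i. A i) x *\<^sub>R y" for x
          unfolding u_def by (intro tendsto_scaleR tendsto_const LIMSEQ_indicator_UN)
        show "L1_integrable (\<lambda>x. indicator (\<Union>i. A i) x *\<^sub>R y)" "L1_integrable (u n)" for n
          unfolding u_def by (rule L1_integrable_indicator; auto)+
      qed (simp_all add: u_def indicator_def)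
      ultimately show ?case by (rule lim)
    qed
  qed
  have "abs_L1 f \<in> C" if "L1_integrable f" for f :: "real \<Rightarrow> 'b"
    using that
  proof (induction rule: integrable_induct)
    case (base A c)
    then show ?case by (intro ind)
  next
    case (add f g)
    then show ?case using subspace_add[OF C(1), of "abs_L1 f" "abs_L1 g"] by (simp add: L1_ops(1))
  next
    case (lim f s)
    have "(\<lambda>i. abs_L1 (s i)) \<longlonglongrightarrow> abs_L1 f"
      using lim by (intro L1_dominated_convergence[where w = "\<lambda>x. 2 * norm (f x)"]) simp_all
    with lim.IH show ?case by (rule \<open>\<And>s z. (\<And>n. s n \<in> C) \<Longrightarrow> s \<longlonglongrightarrow> z \<Longrightarrow> z \<in> C\<close>)
  qed
  then show ?thesis
    using rep_L1_integrable abs_rep_L1 by (metis UNIV_eq_I)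
qed

section \<open>The Haar functions along the tree\<close>

definition haar_index :: "nat \<Rightarrow> real set" where
  "haar_index i = (if i = 0 then {} else node i)"

abbreviation haar_fun :: "nat \<Rightarrow> real \<Rightarrow> real" where
  "haar_fun i \<equiv> haar (haar_index i)"

definition haar_weight :: "nat \<Rightarrow> real" where
  "haar_weight i = (if i = 0 then 1 else node_length i)"

text \<open>
  For the indicators of the nodes this is the \<open>i\<close>-th Haar function.  For integrals over the nodes, or
  for vectors attached to them, it gives the corresponding Haar coefficients and Haar vectors; all
  that is used about such families is that the value at a node is the sum of those at its halves.
\<close>
definition haar_diff :: "(nat \<Rightarrow> 'a::ab_group_add) \<Rightarrow> nat \<Rightarrow> 'a" where
  "haar_diff t i = (if i = 0 then t 1 else t (2 * i) - t (Suc (2 * i)))"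

lemma haar_weight_pos [simp]: "haar_weight i > 0" "haar_weight i \<noteq> 0"
  by (simp_all add: haar_weight_def)

lemma node_bounds:
  shows "Inf (node k) = real k * node_length k - 1" "Sup (node k) = real (Suc k) * node_length k - 1"
proof -
  have "real k * node_length k - 1 < real (Suc k) * node_length k - 1"
    using node_length_pos[of k] by (simp add: algebra_simps)
  then show "Inf (node k) = real k * node_length k - 1" "Sup (node k) = real (Suc k) * node_length k - 1"
    unfolding node_def by (simp_all only: cInf_atLeastLessThan cSup_atLeastLessThan)
qed

lemma halves_node:
  assumes "k \<ge> 1"
  shows "left_half (node k) = node (2 * k)" "right_half (node k) = node (Suc (2 * k))"
proof -
  have mid: "(Inf (node k) + Sup (node k)) / 2 = (real k + 1 / 2) * node_length k - 1"
    by (simp add: node_bounds field_simps)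
  show "left_half (node k) = node (2 * k)" "right_half (node k) = node (Suc (2 * k))"
    unfolding left_half_def right_half_def mid unfolding node_bounds
    by (simp_all only: node_def node_length_children[OF assms]) (simp_all add: algebra_simps)
qed

lemma haar_haar_index: "haar_fun i x = haar_diff (\<lambda>k. indicator (node k) x) i"
  using halves_node[of i] node_1
  by (simp add: haar_def haar_index_def haar_diff_def)

lemma haar_borel [measurable]: "haar_fun i \<in> borel_measurable borel"
proof -
  have "(\<lambda>x. haar_diff (\<lambda>k. indicator (node k) x :: real) i) \<in> borel_measurable borel"
    by (cases "i = 0") (simp_all add: haar_diff_def)
  then show ?thesis by (simp add: haar_haar_index flip: haar_haar_index)
qed

lemma haar_measurable [measurable]: "haar_fun i \<in> borel_measurable unit_measure"
  by (rule L1_measurable) measurable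

lemma haar_le_1: "\<bar>haar_fun i x\<bar> \<le> 1"
  by (simp add: haar_haar_index haar_diff_def indicator_def)

lemma inj_haar_index: "inj haar_index"
proof (rule injI)
  fix i j assume eq: "haar_index i = haar_index j"
  show "i = j"
  proof (cases "i = 0 \<or> j = 0")
    case False
    with eq have "node i = node j" by (simp add: haar_index_def)
    then have "real i * node_length i = real j * node_length j"
      "real (Suc i) * node_length i = real (Suc j) * node_length j"
      using node_bounds[of i] node_bounds[of j] by auto
    then have "node_length i = node_length j" by (simp add: algebra_simps)
    then show ?thesis
      using \<open>real i * node_length i = real j * node_length j\<close> by simp
  qed (use eq in \<open>auto simp: haar_index_def dest: sym split: if_splits\<close>)
qed

lemma node_image: "node ` {1..} = dyadic"
proof (intro equalityI subsetI)
  fix A assume "A \<in> node ` {1..}"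
  then obtain k where k: "k \<ge> 1" "A = node k" by auto
  define j where "j = floor_log k"
  have "2 ^ j \<le> k" "k < 2 * 2 ^ j"
    using k(1) floor_log_exp2_le[of k] floor_log_exp2_gt[of k] by (simp_all add: j_def)
  then have "A = {(real (Suc k - 2 ^ j) - 1) / 2 ^ j ..< real (Suc k - 2 ^ j) / 2 ^ j}"
    by (simp add: k node_def node_length_def j_def of_nat_diff field_simps)
  moreover have "1 \<le> Suc k - 2 ^ j" "Suc k - 2 ^ j \<le> 2 ^ j"
    using \<open>2 ^ j \<le> k\<close> \<open>k < 2 * 2 ^ j\<close> by auto
  ultimately show "A \<in> dyadic"
    unfolding dyadic_def by blast
next
  fix A assume "A \<in> dyadic"
  then obtain i j :: nat where ij: "1 \<le> i" "i \<le> 2 ^ j" "A = {(real i - 1) / 2 ^ j ..< real i / 2 ^ j}"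
    unfolding dyadic_def by blast
  define k where "k = i - 1 + 2 ^ j"
  have "k \<in> {2 ^ j..<2 * 2 ^ j}" using ij by (auto simp: k_def)
  then have "A = node k"
    using ij by (simp add: node_def node_length_level k_def of_nat_diff field_simps)
  moreover have "k \<ge> 1" by (simp add: k_def add_increasing)
  ultimately show "A \<in> node ` {1..}" by simp
qed

lemma bij_haar_index: "bij_betw haar_index UNIV dyadic_plus"
proof -
  have "range haar_index = insert {} (node ` {1..})"
  proof (intro equalityI subsetI)
    fix A assume "A \<in> insert {} (node ` {1..})"
    then consider "A = {}" | k where "k \<ge> 1" "A = node k" by blast
    then show "A \<in> range haar_index"
    proof cases
      case 1
      then show ?thesis by (intro image_eqI[of _ _ 0]) (simp_all add: haar_index_def)
    next
      case (2 k)
      then show ?thesis by (intro image_eqI[of _ _ k]) (simp_all add: haar_index_def)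
    qed
  qed (auto simp: haar_index_def)
  then show ?thesis
    using inj_haar_index unfolding bij_betw_def dyadic_plus_def node_image by simp
qed

text \<open>
  In the heap numbering a later Haar function lives on a smaller or a disjoint interval; this is
  what makes the system orthogonal.
\<close>
lemma haar_const_on_node:
  assumes "i < j"
  obtains c where "\<And>x. x \<in> node j \<Longrightarrow> haar_fun i x = c"
proof (cases "i = 0 \<or> j < 2 * i")
  case True
  then consider "i = 0" | "i \<ge> 1" "j < 2 * i" by linarith
  then show ?thesis
  proof cases
    case 1
    then show ?thesis
      using node_subset_unit[of j] assms node_1 by (intro that[of 1]) (auto simp: haar_haar_index haar_diff_def indicator_def)
  next
    case 2
    then have "node i \<inter> node j = {}"
      using assms by (intro nodes_disjoint[of i i j]) auto
    then show ?thesis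
      using node_children[of i] 2 by (intro that[of 0]) (auto simp: haar_haar_index haar_diff_def indicator_def)
  qed
next
  case False
  then have i: "i \<ge> 1" "2 * i \<le> j" by auto
  have sub: "node j \<inter> node k = {} \<or> node j \<subseteq> node k" if "k \<le> j" "k \<ge> 1" for k
    using node_below[OF that] .
  consider "j = 2 * i" | "Suc (2 * i) \<le> j" using i by linarith
  then show ?thesis
  proof cases
    case 1
    then show ?thesis
      using node_children[of i] i by (intro that[of 1]) (auto simp: haar_haar_index haar_diff_def indicator_def)
  next
    case 2
    have "node j \<inter> node (2 * i) = {} \<or> node j \<subseteq> node (2 * i)"
      "node j \<inter> node (Suc (2 * i)) = {} \<or> node j \<subseteq> node (Suc (2 * i))"
      using sub i 2 by auto
    then show ?thesis
      by (intro that[of "haar_fun i (Inf (node j))"])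
        (use i in \<open>auto simp: haar_haar_index haar_diff_def indicator_def node_bounds node_def\<close>)
  qed
qed

lemma integral_haar:
  assumes "j \<ge> 1"
  shows "(LINT x|unit_measure. haar_fun j x) = 0"
proof -
  have "(LINT x|unit_measure. haar_fun j x) =
      (LINT x|unit_measure. indicator (node (2 * j)) x - indicator (node (Suc (2 * j))) x)"
    using assms by (simp add: haar_haar_index haar_diff_def)
  also have "\<dots> = node_length (2 * j) - node_length (Suc (2 * j))"
    using assms L1_integrable_indicator[of _ "1::real"] node_subset_unit
    by (subst Bochner_Integration.integral_diff) (simp_all add: measure_node Int_absorb2)
  finally show ?thesis using assms by (simp add: node_length_children)
qed

lemma haar_orthogonal:
  "(LINT x|unit_measure. haar_fun i x * haar_fun j x) = (if i = j then haar_weight i else 0)"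
proof -
  have *: "(LINT x|unit_measure. haar_fun i x * haar_fun j x) = 0" if "i < j" for i j
  proof -
    obtain c where c: "\<And>x. x \<in> node j \<Longrightarrow> haar_fun i x = c"
      using haar_const_on_node[OF \<open>i < j\<close>] by blast
    have zero: "haar_fun j x = 0" if "x \<notin> node j" for x
      using that node_children[of j] \<open>i < j\<close> by (auto simp: haar_haar_index haar_diff_def indicator_def)
    have "(LINT x|unit_measure. haar_fun i x * haar_fun j x) =
        (LINT x|unit_measure. c * haar_fun j x)"
      using c zero by (intro Bochner_Integration.integral_cong refl) (metis mult_zero_right)
    then show ?thesis using integral_haar[of j] that by simp
  qed
  have sq: "haar_fun i x * haar_fun i x = indicator (node (max 1 i)) x" for i x
  proof (cases "i = 0")
    case False
    then have "i \<ge> 1" by simp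
    from node_children[OF this] show ?thesis
      using False by (auto simp: haar_haar_index haar_diff_def indicator_def)
  qed (simp add: haar_haar_index haar_diff_def indicator_def)
  consider "i < j" | "j < i" | "i = j" by linarith
  then show ?thesis
  proof cases
    case 3
    then show ?thesis
      using node_subset_unit[of "max 1 i"] measure_node[of "max 1 i"]
      by (auto simp: sq haar_weight_def max_def Int_absorb2)
  next
    case 2
    have "(LINT x|unit_measure. haar_fun i x * haar_fun j x) =
        (LINT x|unit_measure. haar_fun j x * haar_fun i x)"
      by (simp add: mult.commute)
    then show ?thesis using *[OF 2] 2 by simp
  qed (use * in simp)
qed

text \<open>
  The Haar expansion up to index \<open>N\<close> is the averaging over the partition \<open>{N..<2 * N}\<close>: splitting
  node \<open>N\<close> into its halves replaces one average by two, and the difference is the \<open>N\<close>-th term of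
  the Haar expansion, because
  \<open>(a - b) (a' - b') = 2 a a' + 2 b b' - (a + b) (a' + b')\<close>.
\<close>
lemma haar_sum_eq_average:
  fixes l :: "nat \<Rightarrow> real" and t :: "nat \<Rightarrow> 'a::real_vector"
  assumes "N \<ge> 1"
    and l: "\<And>k. k \<ge> 1 \<Longrightarrow> l k = l (2 * k) + l (Suc (2 * k))"
    and t: "\<And>k. k \<ge> 1 \<Longrightarrow> t k = t (2 * k) + t (Suc (2 * k))"
  shows "(\<Sum>i<N. (haar_diff l i / haar_weight i) *\<^sub>R haar_diff t i) =
    (\<Sum>k\<in>{N..<2 * N}. (l k / node_length k) *\<^sub>R t k)"
  using assms(1)
proof (induction N rule: dec_induct)
  case base
  have "{1..<2 * 1} = {1::nat}" by auto
  then show ?case by (simp add: haar_diff_def haar_weight_def)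
next
  case (step N)
  have split: "(p - q) *\<^sub>R (a - b) = (p + p) *\<^sub>R a + (q + q) *\<^sub>R b - (p + q) *\<^sub>R (a + b)"
    for p q and a b :: 'a
  proof -
    have "(p + p) *\<^sub>R a = p *\<^sub>R a + p *\<^sub>R a" "(q + q) *\<^sub>R b = q *\<^sub>R b + q *\<^sub>R b"
      by (rule scaleR_add_left)+
    then show ?thesis
      by (simp only:) (simp add: algebra_simps)
  qed
  have "N \<ge> 1" by fact
  have "(\<Sum>i<Suc N. (haar_diff l i / haar_weight i) *\<^sub>R haar_diff t i) =
      (\<Sum>k\<in>{N..<2 * N}. (l k / node_length k) *\<^sub>R t k) +
      (l (2 * N) / node_length N - l (Suc (2 * N)) / node_length N) *\<^sub>R (t (2 * N) - t (Suc (2 * N)))"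
    using step.IH \<open>N \<ge> 1\<close> by (simp add: haar_diff_def haar_weight_def diff_divide_distrib)
  also have "\<dots> = (\<Sum>k\<in>{N..<2 * N}. (l k / node_length k) *\<^sub>R t k) - (l N / node_length N) *\<^sub>R t N
      + (l (2 * N) / node_length (2 * N)) *\<^sub>R t (2 * N)
      + (l (Suc (2 * N)) / node_length (Suc (2 * N))) *\<^sub>R t (Suc (2 * N))"
    unfolding split l[OF \<open>N \<ge> 1\<close>] t[OF \<open>N \<ge> 1\<close>] node_length_children[OF \<open>N \<ge> 1\<close>]
    by (simp add: add_divide_distrib mult_2_right)
  finally show ?case
    unfolding sum_split_node[OF \<open>N \<ge> 1\<close>] .
qed

section \<open>Pointwise limits of uniformly bounded operators\<close>

text \<open>
  A uniform bound makes the set of points of convergence closed, so convergence has to be checked on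
  a set with dense span only.
\<close>
lemma convergent_closed_subspace:
  fixes S :: "nat \<Rightarrow> 'a::real_normed_vector \<Rightarrow> 'b::banach"
  assumes lin: "\<And>n. linear (S n)" and K: "\<And>n x. norm (S n x) \<le> K * norm x"
  shows "subspace {x. convergent (\<lambda>n. S n x)}" "closed {x. convergent (\<lambda>n. S n x)}"
proof -
  show "subspace {x. convergent (\<lambda>n. S n x)}"
    by (intro subspaceI)
      (simp_all add: linear_0[OF lin] linear_add[OF lin] linear_cmul[OF lin] convergent_const
        convergent_add bounded_linear.convergent[OF bounded_linear_scaleR_right])
  show "closed {x. convergent (\<lambda>n. S n x)}"
    unfolding closed_sequential_limits
  proof (intro allI impI, elim conjE)
    fix y l assume y: "\<forall>n. y n \<in> {x. convergent (\<lambda>n. S n x)}" "y \<longlonglongrightarrow> l"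
    have "Cauchy (\<lambda>n. S n l)"
    proof (rule CauchyI)
      fix e :: real assume e: "e > 0"
      have "(\<lambda>m. \<bar>K\<bar> * norm (l - y m)) \<longlonglongrightarrow> \<bar>K\<bar> * norm (l - l)"
        by (intro tendsto_intros y)
      then obtain m where m: "\<bar>K\<bar> * norm (l - y m) < e / 3"
        using e order_tendstoD(2)[of _ "\<bar>K\<bar> * norm (l - l)" sequentially "e / 3"]
        by (auto simp: eventually_sequentially)
      have near: "norm (S n l - S n (y m)) < e / 3" for n
        using K[of n "l - y m"] mult_right_mono[OF abs_ge_self[of K] norm_ge_zero[of "l - y m"]] m
        by (simp add: linear_diff[OF lin])
      have "Cauchy (\<lambda>n. S n (y m))"
        using y(1) by (simp add: convergent_Cauchy)
      from CauchyD[OF this, of "e / 3"] e obtain N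
        where N: "\<And>i j. i \<ge> N \<Longrightarrow> j \<ge> N \<Longrightarrow> norm (S i (y m) - S j (y m)) < e / 3"
        by auto
      have "norm (S i l - S j l) < e" if "i \<ge> N" "j \<ge> N" for i j
      proof -
        have tri: "norm (a + b - c) \<le> norm a + norm b + norm c" for a b c :: 'b
          using norm_triangle_ineq4[of "a + b" c] norm_triangle_ineq[of a b] by linarith
        have "norm (S i l - S j l) \<le>
            norm (S i l - S i (y m)) + norm (S i (y m) - S j (y m)) + norm (S j l - S j (y m))"
          using tri[of "S i l - S i (y m)" "S i (y m) - S j (y m)" "S j l - S j (y m)"] by simp
        then show ?thesis using near[of i] near[of j] N[OF that] by simp
      qed
      then show "\<exists>M. \<forall>i\<ge>M. \<forall>j\<ge>M. norm (S i l - S j l) < e" by blast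
    qed
    then show "l \<in> {x. convergent (\<lambda>n. S n x)}" by (simp add: Cauchy_convergent)
  qed
qed

lemma convergence_closed_subspace:
  fixes S :: "nat \<Rightarrow> 'a::banach \<Rightarrow> 'a"
  assumes lin: "\<And>n. linear (S n)" and K: "\<And>n x. norm (S n x) \<le> K * norm x"
  shows "subspace {x. (\<lambda>n. S n x) \<longlonglongrightarrow> x}" "closed {x. (\<lambda>n. S n x) \<longlonglongrightarrow> x}"
proof -
  \<comment> \<open>Interleaved with the constant sequence \<open>x\<close>, the sequence \<open>S n x\<close> converges only if its limit is \<open>x\<close>.\<close>
  define R where "R n = (if even n then S (n div 2) else (\<lambda>x. x))" for n
  have R: "convergent (\<lambda>n. R n x) \<longleftrightarrow> (\<lambda>n. S n x) \<longlonglongrightarrow> x" for x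
  proof
    assume "convergent (\<lambda>n. R n x)"
    then obtain l where l: "(\<lambda>n. R n x) \<longlonglongrightarrow> l" by (auto simp: convergent_def)
    have "(\<lambda>n. S n x) \<longlonglongrightarrow> l" "(\<lambda>n. x) \<longlonglongrightarrow> l"
      using LIMSEQ_subseq_LIMSEQ[OF l, of "\<lambda>n. 2 * n"] LIMSEQ_subseq_LIMSEQ[OF l, of "\<lambda>n. Suc (2 * n)"]
      by (simp_all add: strict_mono_def o_def R_def)
    then show "(\<lambda>n. S n x) \<longlonglongrightarrow> x" by (simp add: LIMSEQ_const_iff)
  next
    assume "(\<lambda>n. S n x) \<longlonglongrightarrow> x"
    then have "(\<lambda>n. S (n div 2) x - x) \<longlonglongrightarrow> 0"
      by (intro LIM_zero filterlim_compose[OF _ filterlim_at_top_div_const_nat]) simp_all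
    then have "(\<lambda>n. R n x - x) \<longlonglongrightarrow> 0"
      by (rule Lim_transform_bound[rotated]) (simp add: R_def)
    then have "(\<lambda>n. R n x) \<longlonglongrightarrow> x" by (simp only: LIM_zero_iff)
    then show "convergent (\<lambda>n. R n x)" by (auto simp: convergent_def)
  qed
  have lin_R: "linear (R n)" for n by (simp add: R_def lin linear_ident)
  have "norm (R n x) \<le> max K 1 * norm x" for n x
    using order_trans[OF K mult_right_mono[of K "max K 1"]] mult_right_mono[of 1 "max K 1" "norm x"]
    by (simp add: R_def)
  from convergent_closed_subspace[of R, OF lin_R this]
  show "subspace {x. (\<lambda>n. S n x) \<longlonglongrightarrow> x}" "closed {x. (\<lambda>n. S n x) \<longlonglongrightarrow> x}"
    unfolding R .
qed

text \<open>
  By biorthogonality the partial sums are eventually stationary at every \<open>e j\<close>; boundedness and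
  density extend convergence to all vectors, and the functionals determine the coefficients.
\<close>
lemma schauder_basisI:
  fixes e :: "nat \<Rightarrow> 'a::banach"
  assumes f: "\<And>i. bounded_linear (f i)" and biorth: "\<And>i j. f i (e j) = (if i = j then 1 else 0)"
    and bound: "\<And>n x. norm (\<Sum>i<n. f i x *\<^sub>R e i) \<le> K * norm x"
    and dense: "\<And>C. subspace C \<Longrightarrow> closed C \<Longrightarrow> range e \<subseteq> C \<Longrightarrow> C = UNIV"
  shows "schauder_basis e"
  unfolding schauder_basis_def
proof
  fix x
  let ?S = "\<lambda>n x. \<Sum>i<n. f i x *\<^sub>R e i"
  have lin: "linear (?S n)" for n
    by (intro linear_compose_sum ballI bounded_linear.linear
        bounded_linear_scaleR_left[THEN bounded_linear_compose] f)
  have "{x. (\<lambda>n. ?S n x) \<longlonglongrightarrow> x} = UNIV"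
  proof (rule dense[OF convergence_closed_subspace[OF lin bound]])
    have "?S n (e j) = e j" if "n > j" for n j
      using that by (simp add: biorth if_distrib[of "\<lambda>c. c *\<^sub>R _"] cong: if_cong)
    then have "(\<lambda>n. ?S n (e j)) \<longlonglongrightarrow> e j" for j
      by (intro tendsto_eventually) (auto simp: eventually_sequentially intro: exI[of _ "Suc j"])
    then show "range e \<subseteq> {x. (\<lambda>n. ?S n x) \<longlonglongrightarrow> x}" by auto
  qed
  then have "(\<lambda>n. f n x *\<^sub>R e n) sums x"
    unfolding sums_def by blast
  moreover have "a = (\<lambda>n. f n x)" if "(\<lambda>n. a n *\<^sub>R e n) sums x" for a
  proof
    fix j
    have "(\<lambda>n. f j (a n *\<^sub>R e n)) sums f j x"
      by (rule bounded_linear.sums[OF f that])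
    moreover have "(\<lambda>n. f j (a n *\<^sub>R e n)) = (\<lambda>n. if n = j then a n else 0)"
      by (auto simp: linear_cmul[OF bounded_linear.linear[OF f]] biorth)
    ultimately have "(\<lambda>n. if n = j then a n else 0) sums f j x" by simp
    then show "a j = f j x"
      using sums_single[of j a] sums_unique2 by blast
  qed
  ultimately show "\<exists>!a. (\<lambda>n. a n *\<^sub>R e n) sums x"
    by (intro ex1I[of _ "\<lambda>n. f n x"]) blast+
qed

section \<open>The bi-parameter Haar system is a basis\<close>

abbreviation integral_on :: "nat \<Rightarrow> ('b::{banach, second_countable_topology} \<Rightarrow> real) \<Rightarrow> 'b L1 \<Rightarrow> real" where
  "integral_on k \<equiv> weighted_integral (indicator (node k))"

lemma indicator_node_measurable [measurable]: "(indicator (node k) :: real \<Rightarrow> real) \<in> borel_measurable unit_measure"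
  by (intro L1_measurable borel_measurable_indicator) simp

lemma bounded_linear_cell:
  "bounded_linear l \<Longrightarrow> bounded_linear (integral_on k l)"
  by (rule bounded_linear_weighted_integral[where B = 1]) (auto simp: indicator_def)

lemma bounded_linear_haar_integral:
  "bounded_linear l \<Longrightarrow> bounded_linear (weighted_integral (haar_fun k) l)"
  by (rule bounded_linear_weighted_integral[where B = 1]) (auto simp: haar_le_1)

lemma cell_integrable:
  fixes l :: "'b::{banach, second_countable_topology} \<Rightarrow> real"
  shows
  "bounded_linear l \<Longrightarrow> L1_integrable (\<lambda>x. indicator (node k) x * l (rep_L1 F x))"
  by (rule weighted_integrable[where B = 1 and l = l, OF indicator_node_measurable _ _ rep_L1_integrable])
    (simp_all add: indicator_def)

lemma cell_children:
  assumes "bounded_linear l" "k \<ge> 1"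
  shows "integral_on k l F =
    integral_on (2 * k) l F + integral_on (Suc (2 * k)) l F"
proof -
  note cell_integrable[OF assms(1), of _ F]
  then show ?thesis
    using assms(2) by (simp add: weighted_integral_def indicator_node_children[of k] distrib_right)
qed

lemma haar_integral_eq:
  assumes "bounded_linear l"
  shows "weighted_integral (haar_fun i) l F =
    haar_diff (\<lambda>k. integral_on k l F) i"
proof -
  note cell_integrable[OF assms, of _ F]
  then show ?thesis
    by (cases "i = 0") (simp_all add: weighted_integral_def haar_haar_index haar_diff_def left_diff_distrib)
qed

lemma cell_linear_functional:
  assumes "bounded_linear l" "bounded_linear l'"
  shows "integral_on k (\<lambda>y. l y + l' y) F =
      integral_on k l F + integral_on k l' F"
    and "integral_on k (\<lambda>y. l y - l' y) F =
      integral_on k l F - integral_on k l' F"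
proof -
  note cell_integrable[OF assms(1), of k F] cell_integrable[OF assms(2), of k F]
  then show "integral_on k (\<lambda>y. l y + l' y) F =
      integral_on k l F + integral_on k l' F"
    "integral_on k (\<lambda>y. l y - l' y) F =
      integral_on k l F - integral_on k l' F"
    by (simp_all add: weighted_integral_def algebra_simps)
qed

definition node_integral :: "nat \<Rightarrow> real L1 \<Rightarrow> real" where
  "node_integral v = integral_on v (\<lambda>y. y)"

lemma bounded_linear_node_integral: "bounded_linear (node_integral v)"
  unfolding node_integral_def by (rule bounded_linear_cell[OF bounded_linear_ident])

lemma haar_vector: "abs_L1 (haar_fun j) = haar_diff (\<lambda>v. step v (1::real)) j"
proof -
  have "haar_fun j = (\<lambda>x. haar_diff (\<lambda>k. indicator (node k) x) j)"
    by (rule ext) (rule haar_haar_index)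
  moreover have "L1_integrable (\<lambda>x. indicator (node k) x :: real)" for k
    using L1_integrable_indicator[of "node k" "1::real"] by simp
  ultimately show ?thesis
    by (cases "j = 0") (simp_all add: haar_diff_def step_def L1_ops(2))
qed

lemma tensor_haar: "tensor_L1 (haar_fun i) g = haar_diff (\<lambda>u. step u (abs_L1 g)) i"
  by (cases "i = 0")
    (simp_all add: tensor_L1_def haar_haar_index haar_diff_def step_def L1_ops(2) scaleR_diff_left)

lemma haar2_functional_eq:
  "haar2_functional (I, J) = weighted_integral (haar I) (weighted_integral (haar J) (\<lambda>y. y))"
  by (auto simp: haar2_functional_def weighted_integral_def fun_eq_iff)

lemma bounded_linear_haar2:
  "bounded_linear (haar2_functional (haar_index i, haar_index j))"
  unfolding haar2_functional_eq by (intro bounded_linear_haar_integral bounded_linear_ident)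

lemma haar_integrable: "L1_integrable (\<lambda>x. haar_fun i x *\<^sub>R y)"
  by (rule integrable_scaled[where B = 1]) (simp_all add: haar_le_1)

lemma haar_integrable_real [simp]: "L1_integrable (haar_fun i)"
  using haar_integrable[of i "1::real"] by simp

lemma haar2_biorthogonal:
  "haar2_functional (haar_index i, haar_index j) (tensor_L1 (haar_fun k) (haar_fun l)) =
    (if i = k \<and> j = l then haar_weight i * haar_weight j else 0)"
proof -
  have lin: "bounded_linear (weighted_integral (haar_fun j) (\<lambda>y::real. y))"
    by (intro bounded_linear_haar_integral bounded_linear_ident)
  have "weighted_integral (haar_fun j) (\<lambda>y. y) (abs_L1 (haar_fun l)) =
      (if j = l then haar_weight j else 0)"
    by (simp add: weighted_integral_abs bounded_linear_ident haar_orthogonal)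
  then show ?thesis
    unfolding haar2_functional_eq tensor_L1_def
    by (simp add: weighted_integral_abs lin haar_integrable linear_cmul[OF bounded_linear.linear[OF lin]]
        haar_orthogonal flip: mult.assoc)
qed

lemma norm_tensor_haar:
  "norm (tensor_L1 (haar_fun i) (haar_fun j)) = haar_weight i * haar_weight j"
proof -
  have sq: "\<bar>haar_fun i x\<bar> = haar_fun i x * haar_fun i x" for i x
    by (simp add: haar_haar_index haar_diff_def indicator_def)
  have "norm (abs_L1 (haar_fun j)) = haar_weight j" for j
    by (simp add: norm_abs_L1 sq haar_orthogonal)
  then show ?thesis
    unfolding tensor_L1_def by (simp add: norm_abs_L1 haar_integrable sq haar_orthogonal)
qed

text \<open>
  Iterated integration over disjoint nodes does not increase the norm.  The functionals \<open>l v\<close>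
  play the part of the integrals over the cells in the second variable, so that no jointly
  measurable representative is needed.
\<close>
lemma sum_cells_le:
  fixes l :: "'i \<Rightarrow> 'b::{banach, second_countable_topology} \<Rightarrow> real"
  assumes "finite V" and lin: "\<And>v. v \<in> V \<Longrightarrow> bounded_linear (l v)"
    and bound: "\<And>y. (\<Sum>v\<in>V. \<bar>l v y\<bar>) \<le> norm y" and N: "N \<ge> 1"
  shows "(\<Sum>u\<in>{N..<2 * N}. \<Sum>v\<in>V. \<bar>integral_on u (l v) F\<bar>) \<le> norm F"
proof -
  have int: "L1_integrable (\<lambda>x. indicator (node u) x * \<bar>l v (rep_L1 F x)\<bar>)" if "v \<in> V" for u v
    using integrable_norm[OF cell_integrable[OF lin[OF that], of u F]] by (simp add: abs_mult)
  have "(\<Sum>u\<in>{N..<2 * N}. \<Sum>v\<in>V. \<bar>integral_on u (l v) F\<bar>) \<le>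
      (\<Sum>u\<in>{N..<2 * N}. \<Sum>v\<in>V. LINT x|unit_measure. indicator (node u) x * \<bar>l v (rep_L1 F x)\<bar>)"
  proof (intro sum_mono)
    fix u v
    show "\<bar>integral_on u (l v) F\<bar> \<le>
        (LINT x|unit_measure. indicator (node u) x * \<bar>l v (rep_L1 F x)\<bar>)"
      using integral_norm_bound[of unit_measure "\<lambda>x. indicator (node u) x * l v (rep_L1 F x)"]
      by (simp add: weighted_integral_def abs_mult)
  qed
  also have "\<dots> = (LINT x|unit_measure. (\<Sum>u\<in>{N..<2 * N}. \<Sum>v\<in>V. indicator (node u) x * \<bar>l v (rep_L1 F x)\<bar>))"
    using int by (simp add: Bochner_Integration.integral_sum)
  also have "\<dots> \<le> (LINT x|unit_measure. norm (rep_L1 F x))"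
  proof (rule integral_mono)
    show "L1_integrable (\<lambda>x. \<Sum>u\<in>{N..<2 * N}. \<Sum>v\<in>V. indicator (node u) x * \<bar>l v (rep_L1 F x)\<bar>)"
      using int by (intro Bochner_Integration.integrable_sum) auto
    show "L1_integrable (\<lambda>x. norm (rep_L1 F x))"
      using rep_L1_integrable by (rule integrable_norm)
    fix x assume "x \<in> space unit_measure"
    then have "(\<Sum>u\<in>{N..<2 * N}. indicator (node u) x * (\<Sum>v\<in>V. \<bar>l v (rep_L1 F x)\<bar>)) =
        (\<Sum>v\<in>V. \<bar>l v (rep_L1 F x)\<bar>)"
      using sum_indicator_nodes[OF N, of x] by (simp flip: sum_distrib_right)
    then show "(\<Sum>u\<in>{N..<2 * N}. \<Sum>v\<in>V. indicator (node u) x * \<bar>l v (rep_L1 F x)\<bar>) \<le> norm (rep_L1 F x)"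
      using bound[of "rep_L1 F x"] by (simp add: sum_distrib_left)
  qed
  finally show ?thesis by (simp add: norm_L1_rep)
qed

lemma sum_node_integral_le: "N \<ge> 1 \<Longrightarrow> (\<Sum>v\<in>{N..<2 * N}. \<bar>node_integral v y\<bar>) \<le> norm y"
  using sum_cells_le[of "{()}" "\<lambda>_ y::real. y" N y]
  by (simp add: node_integral_def bounded_linear_ident)

definition cell_integral :: "nat \<Rightarrow> nat \<Rightarrow> real L1 L1 \<Rightarrow> real" where
  "cell_integral u v = integral_on u (node_integral v)"

lemma sum_cell_integral_le:
  "N \<ge> 1 \<Longrightarrow> M \<ge> 1 \<Longrightarrow> (\<Sum>u\<in>{N..<2 * N}. \<Sum>v\<in>{M..<2 * M}. \<bar>cell_integral u v F\<bar>) \<le> norm F"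
  unfolding cell_integral_def
  by (rule sum_cells_le) (simp_all add: bounded_linear_node_integral sum_node_integral_le)

lemma cell_integral_children:
  assumes "v \<ge> 1"
  shows "cell_integral u v F = cell_integral u (2 * v) F + cell_integral u (Suc (2 * v)) F"
proof -
  have "node_integral v = (\<lambda>y. node_integral (2 * v) y + node_integral (Suc (2 * v)) y)"
    unfolding node_integral_def by (rule ext) (rule cell_children[OF bounded_linear_ident assms])
  then show ?thesis
    by (simp add: cell_integral_def cell_linear_functional(1) bounded_linear_node_integral)
qed

lemma cell_integral_haar:
  "integral_on u (weighted_integral (haar_fun j) (\<lambda>y. y)) F =
    haar_diff (\<lambda>v. cell_integral u v F) j"
proof -
  have "weighted_integral (haar_fun j) (\<lambda>y. y) = (\<lambda>y. haar_diff (\<lambda>v. node_integral v y) j)"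
    unfolding node_integral_def by (rule ext) (rule haar_integral_eq[OF bounded_linear_ident])
  then show ?thesis
    by (simp add: haar_diff_def cell_integral_def cell_linear_functional(2) bounded_linear_node_integral)
qed

lemma step_scale: "k \<ge> 1 \<Longrightarrow> c *\<^sub>R step k y = step k (c *\<^sub>R y)"
  using linear_cmul[OF bounded_linear.linear[OF bounded_linear_step]] by metis

lemma step_sum: "k \<ge> 1 \<Longrightarrow> (\<Sum>i\<in>A. step k (f i)) = step k (sum f A)"
  using linear_sum[OF bounded_linear.linear[OF bounded_linear_step]] by metis

lemma step_haar_diff:
  "k \<ge> 1 \<Longrightarrow> step k (haar_diff t i) = haar_diff (\<lambda>v. step k (t v)) i"
  using linear_diff[OF bounded_linear.linear[OF bounded_linear_step]] by (auto simp: haar_diff_def)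

lemma product_step_children:
  assumes "u \<ge> 1" "v \<ge> 1"
  shows "step u (step v y) = step u (step (2 * v) y) + step u (step (Suc (2 * v)) y)"
  using linear_add[OF bounded_linear.linear[OF bounded_linear_step[OF assms(1)]]] step_children[OF assms(2), of y]
  by metis

lemma norm_sum_cells:
  assumes "N \<ge> 1" "M \<ge> 1"
  shows "norm (\<Sum>u\<in>{N..<2 * N}. \<Sum>v\<in>{M..<2 * M}. c u v *\<^sub>R step u (step v (1::real))) =
    (\<Sum>u\<in>{N..<2 * N}. \<Sum>v\<in>{M..<2 * M}. node_length u * node_length v * \<bar>c u v\<bar>)"
proof -
  have "(\<Sum>u\<in>{N..<2 * N}. \<Sum>v\<in>{M..<2 * M}. c u v *\<^sub>R step u (step v (1::real))) =
      (\<Sum>u\<in>{N..<2 * N}. step u (\<Sum>v\<in>{M..<2 * M}. step v (c u v)))"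
    using assms by (intro sum.cong refl) (simp add: step_scale step_sum)
  then show ?thesis
    using assms by (simp add: norm_sum_step sum_distrib_left mult.assoc)
qed

definition haar_term :: "nat \<times> nat \<Rightarrow> real L1 L1 \<Rightarrow> real L1 L1" where
  "haar_term = (\<lambda>(i, j) F. (haar2_functional (haar_index i, haar_index j) F / (haar_weight i * haar_weight j)) *\<^sub>R
     tensor_L1 (haar_fun i) (haar_fun j))"

text \<open>
  Applying the identity between Haar sums and averages in each variable, a rectangular partial sum
  is the averaging over a product partition, hence a contraction.
\<close>
lemma norm_rectangular_sum_le:
  "norm (\<Sum>p\<in>{..<N} \<times> {..<M}. haar_term p F) \<le> norm F"
proof (cases "N \<ge> 1 \<and> M \<ge> 1")
  case True
  then have N: "N \<ge> 1" and M: "M \<ge> 1" by auto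
  let ?l = "\<lambda>j. weighted_integral (haar_fun j) (\<lambda>y::real. y)"
  let ?h = "\<lambda>j. abs_L1 (haar_fun j)"
  have lin: "bounded_linear (?l j)" for j
    by (intro bounded_linear_haar_integral bounded_linear_ident)
  have outer: "(\<Sum>i<N. haar_term (i, j) F) = (\<Sum>u\<in>{N..<2 * N}.
      (integral_on u (?l j) F / (node_length u * haar_weight j)) *\<^sub>R step u (?h j))" for j
  proof -
    have "(\<Sum>i<N. haar_term (i, j) F) = (1 / haar_weight j) *\<^sub>R (\<Sum>i<N.
        (haar_diff (\<lambda>u. integral_on u (?l j) F) i / haar_weight i) *\<^sub>R
        haar_diff (\<lambda>u. step u (?h j)) i)"
      unfolding scaleR_sum_right
      by (intro sum.cong refl) (simp add: haar_term_def haar2_functional_eq haar_integral_eq[OF lin] tensor_haar mult.commute)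
    also have "\<dots> = (1 / haar_weight j) *\<^sub>R (\<Sum>u\<in>{N..<2 * N}.
        (integral_on u (?l j) F / node_length u) *\<^sub>R step u (?h j))"
      by (intro arg_cong[of _ _ "scaleR _"] haar_sum_eq_average[OF N] cell_children[OF lin] step_children)
    finally show ?thesis
      unfolding scaleR_sum_right by (simp add: mult.commute)
  qed
  have inner: "(\<Sum>j<M. (integral_on u (?l j) F / (node_length u * haar_weight j)) *\<^sub>R step u (?h j)) =
      (\<Sum>v\<in>{M..<2 * M}. (cell_integral u v F / (node_length u * node_length v)) *\<^sub>R step u (step v 1))"
    if u: "u \<ge> 1" for u
  proof -
    have "(\<Sum>j<M. (integral_on u (?l j) F / (node_length u * haar_weight j)) *\<^sub>R step u (?h j)) =
        (1 / node_length u) *\<^sub>R (\<Sum>j<M. (haar_diff (\<lambda>v. cell_integral u v F) j / haar_weight j) *\<^sub>R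
        haar_diff (\<lambda>v. step u (step v 1)) j)"
      unfolding scaleR_sum_right
      by (intro sum.cong refl) (simp add: cell_integral_haar haar_vector step_haar_diff[OF u] mult.commute)
    also have "\<dots> = (1 / node_length u) *\<^sub>R (\<Sum>v\<in>{M..<2 * M}. (cell_integral u v F / node_length v) *\<^sub>R step u (step v 1))"
      by (intro arg_cong[of _ _ "scaleR _"] haar_sum_eq_average[OF M] cell_integral_children
          product_step_children u)
    finally show ?thesis
      unfolding scaleR_sum_right by (simp add: mult.commute)
  qed
  have "(\<Sum>p\<in>{..<N} \<times> {..<M}. haar_term p F) = (\<Sum>j<M. \<Sum>i<N. haar_term (i, j) F)"
    by (subst sum.swap) (simp add: sum.cartesian_product case_prod_eta)
  also have "\<dots> = (\<Sum>u\<in>{N..<2 * N}. \<Sum>v\<in>{M..<2 * M}. (cell_integral u v F / (node_length u * node_length v)) *\<^sub>R step u (step v 1))"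
    unfolding outer using N by (subst sum.swap) (intro sum.cong refl inner, simp)
  also have "norm \<dots> = (\<Sum>u\<in>{N..<2 * N}. \<Sum>v\<in>{M..<2 * M}. \<bar>cell_integral u v F\<bar>)"
    unfolding norm_sum_cells[OF N M]
  proof (intro sum.cong refl)
    fix u v
    show "node_length u * node_length v * \<bar>cell_integral u v F / (node_length u * node_length v)\<bar> =
        \<bar>cell_integral u v F\<bar>"
      by (simp only: abs_divide abs_mult abs_of_pos[OF node_length_pos]) simp
  qed
  also have "\<dots> \<le> norm F" by (rule sum_cell_integral_le[OF N M])
  finally show ?thesis .
next
  case False
  then have "{..<N} \<times> {..<M} = {}" by auto
  then show ?thesis by (simp only:) simp
qed

text \<open>
  The value at a node and the Haar difference below it are the sum and the difference of the values
  at its halves.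
\<close>
lemma haar_diff_spans:
  fixes t :: "nat \<Rightarrow> 'a::real_vector"
  assumes C: "subspace C" and t: "\<And>k. k \<ge> 1 \<Longrightarrow> t k = t (2 * k) + t (Suc (2 * k))"
    and mem: "\<And>i. haar_diff t i \<in> C" and "k \<ge> 1"
  shows "t k \<in> C"
  using \<open>k \<ge> 1\<close>
proof (induction k rule: less_induct)
  case (less k)
  show ?case
  proof (cases "k = 1")
    case True
    then show ?thesis using mem[of 0] by (simp add: haar_diff_def)
  next
    case False
    define p where "p = k div 2"
    have p: "p \<ge> 1" "p < k" "k = 2 * p \<or> k = Suc (2 * p)" using False less.prems by (auto simp: p_def)
    have sum: "t (2 * p) + t (Suc (2 * p)) \<in> C"
      using less.IH[OF p(2,1)] t[OF p(1)] by simp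
    have diff: "t (2 * p) - t (Suc (2 * p)) \<in> C"
      using mem[of p] p(1) by (simp add: haar_diff_def)
    have "t (2 * p) = (1 / 2) *\<^sub>R ((t (2 * p) + t (Suc (2 * p))) + (t (2 * p) - t (Suc (2 * p))))"
      "t (Suc (2 * p)) = (1 / 2) *\<^sub>R ((t (2 * p) + t (Suc (2 * p))) - (t (2 * p) - t (Suc (2 * p))))"
      by (simp_all add: algebra_simps flip: scaleR_add_left)
    then have "t (2 * p) \<in> C" "t (Suc (2 * p)) \<in> C"
      using sum diff C by (metis subspace_add subspace_scale, metis subspace_diff subspace_scale)
    then show ?thesis using p(3) by auto
  qed
qed

lemma product_steps_dense:
  fixes C :: "real L1 L1 set"
  assumes C: "subspace C" "closed C" and mem: "\<And>u v. u \<ge> 1 \<Longrightarrow> v \<ge> 1 \<Longrightarrow> step u (step v (1::real)) \<in> C"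
  shows "C = UNIV"
proof (rule dyadic_steps_dense[OF C])
  fix u :: nat and y :: "real L1" assume u: "u \<ge> 1"
  have "{y. step u y \<in> C} = UNIV"
  proof (rule dyadic_steps_dense)
    show "subspace {y. step u y \<in> C}"
      using linear_subspace_vimage[OF bounded_linear.linear[OF bounded_linear_step[OF u]] C(1)]
      by (simp add: vimage_def)
    have "closed (step u -` C)"
      by (intro continuous_closed_vimage C(2) linear_continuous_at bounded_linear_step u)
    then show "closed {y. step u y \<in> C}"
      by (simp add: vimage_def)
    fix v and c :: real assume "v \<ge> (1::nat)"
    then have "step u (step v c) = c *\<^sub>R step u (step v 1)"
      using u by (simp add: step_scale)
    then show "step v c \<in> {y. step u y \<in> C}"
      using mem[OF u \<open>v \<ge> 1\<close>] C(1) by (simp add: subspace_scale)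
  qed
  then show "step u y \<in> C" by blast
qed

lemma haar_system_dense:
  fixes C :: "real L1 L1 set"
  assumes C: "subspace C" "closed C"
    and mem: "\<And>i j. tensor_L1 (haar_fun i) (haar_fun j) \<in> C"
  shows "C = UNIV"
proof (rule product_steps_dense[OF C])
  fix u v :: nat assume u: "u \<ge> 1" and v: "v \<ge> 1"
  have "haar_diff (\<lambda>v. step u (step v (1::real))) j \<in> C" for j
  proof -
    have "step u (abs_L1 (haar_fun j)) \<in> C"
      using mem by (intro haar_diff_spans[OF C(1) step_children _ u]) (simp_all flip: tensor_haar)
    then show ?thesis by (simp add: haar_vector step_haar_diff[OF u])
  qed
  then show "step u (step v (1::real)) \<in> C"
    by (intro haar_diff_spans[OF C(1) _ _ v, of "\<lambda>v. step u (step v (1::real))"] product_step_children u)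
qed

text \<open>
  Pairs are enumerated by the shells \<open>max i j = N\<close>.  The shell \<open>N\<close> occupies the positions from \<open>N\<^sup>2\<close> on:
  first \<open>(0, N), \<dots>, (N - 1, N)\<close>, then \<open>(N, 0), \<dots>, (N, N)\<close>.
\<close>
definition shell_index :: "nat \<times> nat \<Rightarrow> nat" where
  "shell_index = (\<lambda>(i, j). if i < j then j\<^sup>2 + i else i\<^sup>2 + i + j)"

definition shell_order :: "nat \<Rightarrow> nat \<times> nat" where
  "shell_order n = (let N = floor_sqrt n; r = n - N\<^sup>2 in if r < N then (r, N) else (N, r - N))"

lemma shell_bounds:
  "(max i j)\<^sup>2 \<le> shell_index (i, j)" "shell_index (i, j) < (Suc (max i j))\<^sup>2"
  by (auto simp: shell_index_def power2_eq_square max_def)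

lemma shell_order_index: "shell_order (shell_index p) = p"
proof (cases p)
  case (Pair i j)
  have "floor_sqrt (shell_index (i, j)) = max i j"
    using shell_bounds[of i j] by (intro floor_sqrt_unique) (simp_all add: power2_eq_square)
  then show ?thesis
    using Pair by (auto simp: shell_order_def shell_index_def Let_def max_def)
qed

lemma shell_index_order: "shell_index (shell_order n) = n"
proof -
  have "(floor_sqrt n)\<^sup>2 \<le> n" "n < (Suc (floor_sqrt n))\<^sup>2"
    using Suc_floor_sqrt_power2_gt[of n] by simp_all
  then show ?thesis
    by (auto simp: shell_order_def shell_index_def Let_def power2_eq_square)
qed

lemma bij_shell_order: "bij shell_order"
  by (rule o_bij[of shell_index]) (auto simp: fun_eq_iff shell_order_index shell_index_order)

lemma shell_order_image: "shell_order ` {..<n} = {p. shell_index p < n}"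
  by (auto simp: shell_index_order intro!: image_eqI[of _ _ "shell_index _"] simp: shell_order_index)

lemma shell_index_less_iff:
  assumes "r \<le> 2 * N"
  shows "shell_index (i, j) < N\<^sup>2 + r \<longleftrightarrow>
    (i < N \<and> j < N) \<or> (j = N \<and> i < N \<and> i < r) \<or> (i = N \<and> j \<le> N \<and> N + j < r)"
proof -
  consider "max i j < N" | "max i j > N" | "max i j = N" by linarith
  then show ?thesis
  proof cases
    case 1
    then have "(Suc (max i j))\<^sup>2 \<le> N\<^sup>2" by (intro power_mono) auto
    then have "shell_index (i, j) < N\<^sup>2 + r" using shell_bounds(2)[of i j] by linarith
    then show ?thesis using 1 by auto
  next
    case 2
    then have "(Suc N)\<^sup>2 \<le> (max i j)\<^sup>2" by (intro power_mono) auto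
    moreover have "(Suc N)\<^sup>2 = N\<^sup>2 + 2 * N + 1" by (simp add: power2_eq_square)
    ultimately show ?thesis using shell_bounds(1)[of i j] 2 assms by (auto simp: max_def split: if_splits)
  next
    case 3
    then show ?thesis by (auto simp: shell_index_def max_def split: if_splits)
  qed
qed

text \<open>
  An initial segment of the enumeration is a rectangle together with a piece of a row or of a column,
  and that piece is the difference of two rectangles.
\<close>
lemma norm_shell_sum_le: "norm (\<Sum>p\<in>{p. shell_index p < n}. haar_term p F) \<le> 3 * norm F"
proof -
  define N where "N = floor_sqrt n"
  define r where "r = n - N\<^sup>2"
  have "N\<^sup>2 \<le> n" "n < (Suc N)\<^sup>2"
    using Suc_floor_sqrt_power2_gt[of n] by (simp_all add: N_def)
  then have n: "n = N\<^sup>2 + r" "r \<le> 2 * N"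
    by (auto simp: r_def power2_eq_square)
  let ?R = "\<lambda>N M. \<Sum>p\<in>{..<N} \<times> {..<M}. haar_term p F"
  have tri: "norm (a + (b - c)) \<le> 3 * norm F" if "norm a \<le> norm F" "norm b \<le> norm F" "norm c \<le> norm F"
    for a b c :: "real L1 L1"
    using that norm_triangle_ineq[of a "b - c"] norm_triangle_ineq4[of b c] by linarith
  have split: "(\<Sum>p\<in>A \<union> (B - C). haar_term p F) =
      (\<Sum>p\<in>A. haar_term p F) + ((\<Sum>p\<in>B. haar_term p F) - (\<Sum>p\<in>C. haar_term p F))"
    if "finite A" "finite B" "C \<subseteq> B" "A \<inter> (B - C) = {}" for A B C
    using that by (simp add: sum.union_disjoint sum_diff)
  show ?thesis
  proof (cases "r \<le> N")
    case True
    have eq: "{p. shell_index p < n} = {..<N} \<times> {..<N} \<union> ({..<r} \<times> {..<Suc N} - {..<r} \<times> {..<N})"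
      using True unfolding n(1) by (auto simp: shell_index_less_iff[OF n(2)])
    have "(\<Sum>p\<in>{p. shell_index p < n}. haar_term p F) = ?R N N + (?R r (Suc N) - ?R r N)"
      unfolding eq using True by (intro split) auto
    then show ?thesis by (simp only:) (intro tri norm_rectangular_sum_le)
  next
    case False
    define s where "s = r - N"
    have eq: "{p. shell_index p < n} = {..<N} \<times> {..<Suc N} \<union> ({..<Suc N} \<times> {..<s} - {..<N} \<times> {..<s})"
      using False n(2) unfolding n(1) by (auto simp: shell_index_less_iff[OF n(2)] s_def)
    have "(\<Sum>p\<in>{p. shell_index p < n}. haar_term p F) = ?R N (Suc N) + (?R (Suc N) s - ?R N s)"
      unfolding eq using False by (intro split) auto
    then show ?thesis by (simp only:) (intro tri norm_rectangular_sum_le)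
  qed
qed

lemma normalized_haar2_eq:
  "normalized_haar2 (haar_index i, haar_index j) =
    tensor_L1 (haar_fun i) (haar_fun j) /\<^sub>R (haar_weight i * haar_weight j)"
  by (simp add: normalized_haar2_def norm_tensor_haar)

theorem normalized_haar2_basis:
  "normalized_basis_on (dyadic_plus \<times> dyadic_plus) normalized_haar2 haar2_functional"
proof -
  define \<pi> where "\<pi> = map_prod haar_index haar_index \<circ> shell_order"
  have bij: "bij_betw \<pi> UNIV (dyadic_plus \<times> dyadic_plus)"
    unfolding \<pi>_def
    using bij_betw_trans[OF bij_shell_order bij_betw_map_prod[OF bij_haar_index bij_haar_index, unfolded UNIV_Times_UNIV]] .
  have ex: "\<exists>i j. p = (haar_index i, haar_index j)" if "p \<in> dyadic_plus \<times> dyadic_plus" for p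
    using that bij_haar_index by (cases p) (auto simp: bij_betw_def image_iff)
  have biorth: "haar2_functional (haar_index i, haar_index j) (normalized_haar2 (haar_index k, haar_index l)) =
      (if i = k \<and> j = l then 1 else 0)" for i j k l
    unfolding normalized_haar2_eq
    by (simp add: linear_cmul[OF bounded_linear.linear[OF bounded_linear_haar2]] haar2_biorthogonal
        field_simps)
  have "schauder_basis (\<lambda>n. normalized_haar2 (\<pi> n))"
  proof (rule schauder_basisI[where f = "\<lambda>n. haar2_functional (\<pi> n)" and K = 3])
    show "bounded_linear (haar2_functional (\<pi> n))" for n
      by (cases "shell_order n") (simp add: \<pi>_def bounded_linear_haar2)
    show "haar2_functional (\<pi> m) (normalized_haar2 (\<pi> n)) = (if m = n then 1 else 0)" for m n
      using bij_shell_order[THEN bij_is_inj, THEN inj_eq, of m n]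
      by (cases "shell_order m"; cases "shell_order n") (auto simp: \<pi>_def biorth)
    show "norm (\<Sum>i<n. haar2_functional (\<pi> i) F *\<^sub>R normalized_haar2 (\<pi> i)) \<le> 3 * norm F" for n F
    proof -
      have "haar2_functional (\<pi> i) F *\<^sub>R normalized_haar2 (\<pi> i) = haar_term (shell_order i) F" for i
        by (cases "shell_order i") (simp add: \<pi>_def haar_term_def normalized_haar2_eq divide_inverse)
      then have "(\<Sum>i<n. haar2_functional (\<pi> i) F *\<^sub>R normalized_haar2 (\<pi> i)) =
          (\<Sum>p\<in>shell_order ` {..<n}. haar_term p F)"
        using bij_shell_order[THEN bij_is_inj] by (simp add: sum.reindex inj_on_subset)
      then show ?thesis
        using norm_shell_sum_le by (simp add: shell_order_image)
    qed
    fix C :: "real L1 L1 set"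
    assume C: "subspace C" "closed C" "range (\<lambda>n. normalized_haar2 (\<pi> n)) \<subseteq> C"
    show "C = UNIV"
    proof (rule haar_system_dense[OF C(1,2)])
      fix i j
      have "normalized_haar2 (haar_index i, haar_index j) = normalized_haar2 (\<pi> (shell_index (i, j)))"
        by (simp add: \<pi>_def shell_order_index)
      then have "normalized_haar2 (haar_index i, haar_index j) \<in> C"
        using C(3) by auto
      then have "(haar_weight i * haar_weight j) *\<^sub>R normalized_haar2 (haar_index i, haar_index j) \<in> C"
        by (rule subspace_scale[OF C(1)])
      moreover have "haar_weight i * haar_weight j \<noteq> 0" by simp
      ultimately show "tensor_L1 (haar_fun i) (haar_fun j) \<in> C"
        unfolding normalized_haar2_eq scaleR_scaleR by (metis right_inverse scaleR_one)
    qed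
  qed
  moreover have "norm (normalized_haar2 p) = 1" if "p \<in> dyadic_plus \<times> dyadic_plus" for p
  proof -
    from ex[OF that] obtain i j where p: "p = (haar_index i, haar_index j)" by blast
    have "haar_weight i * haar_weight j > 0" by simp
    then show ?thesis
      unfolding p normalized_haar2_eq norm_scaleR norm_tensor_haar
      by (metis abs_inverse abs_of_pos left_inverse less_irrefl)
  qed
  moreover have "bounded_linear (haar2_functional p)" if "p \<in> dyadic_plus \<times> dyadic_plus" for p
    using ex[OF that] bounded_linear_haar2 by auto
  moreover have "haar2_functional p (normalized_haar2 q) = (if p = q then 1 else 0)"
    if "p \<in> dyadic_plus \<times> dyadic_plus" "q \<in> dyadic_plus \<times> dyadic_plus" for p q
  proof -
    from ex[OF that(1)] ex[OF that(2)] obtain i j k l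
      where "p = (haar_index i, haar_index j)" "q = (haar_index k, haar_index l)" by blast
    then show ?thesis by (simp add: biorth inj_eq[OF inj_haar_index])
  qed
  ultimately show ?thesis
    unfolding normalized_basis_on_def using bij by blast
qed

section \<open>Averaging over the dyadic levels\<close>

lemma node_integral_step:
  assumes "i \<in> {N..<2 * N}" "j \<in> {N..<2 * N}"
  shows "node_integral i (step j c) = (if i = j then node_length i * c else 0)"
proof -
  have "i \<ge> 1" "j \<ge> 1" using assms by auto
  have "indicator (node i) x * indicator (node j) x = (if i = j then indicator (node i) x else (0::real))" for x
    using nodes_disjoint[OF assms] by (auto simp: indicator_def)
  then have "(LINT x|unit_measure. indicator (node i) x * indicator (node j) x :: real) = (if i = j then node_length i else 0)"
    using \<open>i \<ge> 1\<close> node_subset_unit[of i] by (auto simp: measure_node Int_absorb2)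
  then show ?thesis
    unfolding node_integral_def
    using weighted_integral_step[OF indicator_node_measurable bounded_linear_ident \<open>j \<ge> 1\<close>, of i c] by simp
qed

lemma node_integral_children:
  "k \<ge> 1 \<Longrightarrow> node_integral k f = node_integral (2 * k) f + node_integral (Suc (2 * k)) f"
  unfolding node_integral_def by (rule cell_children[OF bounded_linear_ident])

lemma step_0 [simp]: "step k 0 = 0"
  by (simp add: step_def L1_zero)

definition average :: "nat \<Rightarrow> real L1 \<Rightarrow> real L1" where
  "average N f = (\<Sum>k\<in>{N..<2 * N}. step k (node_integral k f / node_length k))"

lemma norm_average: "N \<ge> 1 \<Longrightarrow> norm (average N f) = (\<Sum>k\<in>{N..<2 * N}. \<bar>node_integral k f\<bar>)"
  by (simp add: average_def norm_sum_step less_imp_le)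

lemma norm_average_le: "N \<ge> 1 \<Longrightarrow> norm (average N f) \<le> norm f"
  by (simp only: norm_average sum_node_integral_le)

lemma linear_average: "N \<ge> 1 \<Longrightarrow> linear (average N)"
  unfolding average_def
  by (intro linear_compose_sum ballI bounded_linear.linear
      bounded_linear_compose[OF bounded_linear_step] bounded_linear_divide
      bounded_linear_compose[OF bounded_linear_divide bounded_linear_node_integral]) auto

lemma average_step:
  assumes "j \<ge> 1" "j < 2 * N"
  shows "average N (step j c) = step j c"
  using assms
proof (induction "2 * N - j" arbitrary: j rule: less_induct)
  case less
  have N: "N \<ge> 1" using less.prems by simp
  show ?case
  proof (cases "j < N")
    case True
    then have "average N (step (2 * j) c) = step (2 * j) c"
      "average N (step (Suc (2 * j)) c) = step (Suc (2 * j)) c"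
      using less.prems by (intro less.hyps; simp)+
    then show ?thesis
      using less.prems step_children[of j c] linear_add[OF linear_average[OF N]] by simp
  next
    case False
    then have j: "j \<in> {N..<2 * N}" using less.prems by simp
    have "average N (step j c) = (\<Sum>k\<in>{N..<2 * N}. if k = j then step j c else 0)"
      unfolding average_def using j
      by (intro sum.cong refl) (auto simp: node_integral_step[OF _ j])
    then show ?thesis using j by simp
  qed
qed

lemma average_tendsto: "(\<lambda>l. average (2 ^ l) f) \<longlonglongrightarrow> f"
proof -
  have "{f. (\<lambda>l. average (2 ^ l) f) \<longlonglongrightarrow> f} = UNIV"
  proof (rule dyadic_steps_dense)
    have lin: "linear (average (2 ^ l))" for l by (rule linear_average) simp
    have bound: "norm (average (2 ^ l) f) \<le> 1 * norm f" for l f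
      using norm_average_le[of "2 ^ l"] by simp
    show "subspace {f. (\<lambda>l. average (2 ^ l) f) \<longlonglongrightarrow> f}" "closed {f. (\<lambda>l. average (2 ^ l) f) \<longlonglongrightarrow> f}"
      using convergence_closed_subspace[of "\<lambda>l. average (2 ^ l)", OF lin bound] by auto
    fix k :: nat and c :: real assume "k \<ge> 1"
    have "average (2 ^ l) (step k c) = step k c" if "l \<ge> k" for l
    proof (rule average_step[OF \<open>k \<ge> 1\<close>])
      have "k < 2 ^ k" by (rule less_exp)
      also have "\<dots> \<le> 2 ^ l" using that by (intro power_increasing) auto
      finally show "k < 2 * 2 ^ l" by simp
    qed
    then have "(\<lambda>l. average (2 ^ l) (step k c)) \<longlonglongrightarrow> step k c"
      by (intro tendsto_eventually) (auto simp: eventually_sequentially)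
    then show "step k c \<in> {f. (\<lambda>l. average (2 ^ l) f) \<longlonglongrightarrow> f}" by simp
  qed
  then show ?thesis by blast
qed

section \<open>\<open>L\<^sup>1\<close> of the square is \<open>L\<^sup>1\<close> of the interval\<close>

text \<open>
  For nodes \<open>u\<close>, \<open>v\<close> of a common level, the binary digits below the leading one are interleaved.
  The squares \<open>node u \<times> node v\<close> of side \<open>1 / 2 ^ l\<close> thereby correspond to the nodes of level \<open>2 l\<close>,
  and the four quarters of a square to the four grandchildren of a node.
\<close>
fun interleave :: "nat \<Rightarrow> nat \<Rightarrow> nat" where
  "interleave u v = (if u \<le> 1 then 1
     else 4 * interleave (u div 2) (v div 2) + 2 * (u mod 2) + v mod 2)"

declare interleave.simps [simp del]

lemma interleave_children:
  assumes "u \<ge> 1"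
  shows "interleave (2 * u) (2 * v) = 4 * interleave u v"
    and "interleave (2 * u) (Suc (2 * v)) = Suc (4 * interleave u v)"
    and "interleave (Suc (2 * u)) (2 * v) = 4 * interleave u v + 2"
    and "interleave (Suc (2 * u)) (Suc (2 * v)) = 4 * interleave u v + 3"
  using assms by (subst interleave.simps; simp)+

abbreviation level :: "nat \<Rightarrow> nat set" where
  "level l \<equiv> {2 ^ l..<2 * 2 ^ l}"

lemma level_children:
  "u \<in> level l \<Longrightarrow> 2 * u \<in> level (Suc l)" "u \<in> level l \<Longrightarrow> Suc (2 * u) \<in> level (Suc l)"
  by auto

lemma level_parent: "u \<in> level (Suc l) \<Longrightarrow> u div 2 \<in> level l"
  by auto

lemma level_ge_1: "u \<in> level l \<Longrightarrow> u \<ge> 1"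
  using one_le_power[of "2::nat" l] by (auto intro: order_trans)

lemma bij_interleave: "bij_betw (\<lambda>(u, v). interleave u v) (level l \<times> level l) (level (2 * l))"
proof (induction l)
  case 0
  have "level 0 = {1}" by auto
  then show ?case by (simp add: bij_betw_def interleave.simps)
next
  case (Suc l)
  have rec: "interleave u v = 4 * interleave (u div 2) (v div 2) + 2 * (u mod 2) + v mod 2"
    if "u \<in> level (Suc l)" for u v
    using that level_ge_1[OF level_parent[OF that]] by (subst interleave.simps) auto
  have inj: "inj_on (\<lambda>(u, v). interleave u v) (level (Suc l) \<times> level (Suc l))"
  proof (rule inj_onI, clarify)
    fix u v u' v'
    assume mem: "u \<in> level (Suc l)" "v \<in> level (Suc l)" "u' \<in> level (Suc l)" "v' \<in> level (Suc l)"
      and eq: "interleave u v = interleave u' v'"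
    have digit: "m = n \<and> c = c'" if "2 * m + c = 2 * n + c'" "c < 2" "c' < 2" for m n c c' :: nat
      using that by presburger
    have digits: "a = a' \<and> b = b' \<and> c = c'"
      if "4 * a + 2 * b + c = 4 * a' + 2 * b' + c'" "b < 2" "b' < 2" "c < 2" "c' < 2" for a b c a' b' c' :: nat
      using digit[of "2 * a + b" c "2 * a' + b'" c'] digit[of a b a' b'] that by simp
    have d: "interleave (u div 2) (v div 2) = interleave (u' div 2) (v' div 2)" "u mod 2 = u' mod 2" "v mod 2 = v' mod 2"
      using digits[OF eq[unfolded rec[OF mem(1)] rec[OF mem(3)]]] by auto
    have "(u div 2, v div 2) = (u' div 2, v' div 2)"
    proof (rule inj_onD[OF bij_betw_imp_inj_on[OF Suc]])
      show "(case (u div 2, v div 2) of (u, v) \<Rightarrow> interleave u v) =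
          (case (u' div 2, v' div 2) of (u, v) \<Rightarrow> interleave u v)"
        using d(1) by simp
    qed (intro SigmaI level_parent mem)+
    then show "u = u' \<and> v = v'"
      using d(2,3) by (metis Pair_inject div_mult_mod_eq)
  qed
  have "(\<lambda>(u, v). interleave u v) ` (level (Suc l) \<times> level (Suc l)) \<subseteq> level (2 * Suc l)"
  proof clarify
    fix u v assume mem: "u \<in> level (Suc l)" "v \<in> level (Suc l)"
    have "interleave (u div 2) (v div 2) \<in> level (2 * l)"
      using bij_betw_apply[OF Suc SigmaI[OF level_parent[OF mem(1)] level_parent[OF mem(2)]]] by simp
    moreover have "2 * (u mod 2) + v mod 2 < 4" by linarith
    ultimately show "interleave u v \<in> level (2 * Suc l)"
      unfolding rec[OF mem(1)] by auto
  qed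
  moreover have "card (level (2 * Suc l)) = card ((\<lambda>(u, v). interleave u v) ` (level (Suc l) \<times> level (Suc l)))"
  proof -
    have card: "card (level k) = 2 ^ k" for k by simp
    show ?thesis
      unfolding card_image[OF inj] card_cartesian_product card by (metis mult_2 power_add)
  qed
  ultimately have "(\<lambda>(u, v). interleave u v) ` (level (Suc l) \<times> level (Suc l)) = level (2 * Suc l)"
    by (intro card_subset_eq) auto
  with inj show ?case by (simp add: bij_betw_def)
qed

lemma interleave_level: "u \<in> level l \<Longrightarrow> v \<in> level l \<Longrightarrow> interleave u v \<in> level (2 * l)"
  using bij_betw_apply[OF bij_interleave, of "(u, v)" l] by simp

lemma interleave_eq_iff:
  assumes "u \<in> level l" "v \<in> level l" "u' \<in> level l" "v' \<in> level l"
  shows "interleave u v = interleave u' v' \<longleftrightarrow> u = u' \<and> v = v'"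
  using inj_on_eq_iff[OF bij_betw_imp_inj_on[OF bij_interleave[of l]], of "(u, v)" "(u', v')"] assms by simp

text \<open>
  The averages of \<open>f\<close> over the nodes of level \<open>2 l\<close>, placed on the corresponding squares.
\<close>
definition square_average :: "nat \<Rightarrow> real L1 \<Rightarrow> real L1 L1" where
  "square_average l f = (\<Sum>u\<in>level l. \<Sum>v\<in>level l. (4 ^ l * node_integral (interleave u v) f) *\<^sub>R step u (step v 1))"

lemma norm_square_average: "norm (square_average l f) = norm (average (2 ^ (2 * l)) f)"
proof -
  have "norm (square_average l f) = (\<Sum>u\<in>level l. \<Sum>v\<in>level l. \<bar>node_integral (interleave u v) f\<bar>)"
    unfolding square_average_def
  proof (subst norm_sum_cells)
    show "(\<Sum>u\<in>level l. \<Sum>v\<in>level l. node_length u * node_length v * \<bar>4 ^ l * node_integral (interleave u v) f\<bar>) =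
        (\<Sum>u\<in>level l. \<Sum>v\<in>level l. \<bar>node_integral (interleave u v) f\<bar>)"
    proof (intro sum.cong refl)
      fix u v assume "u \<in> level l" "v \<in> level l"
      moreover have "(4::real) ^ l = 2 ^ l * 2 ^ l" by (simp flip: power_mult_distrib)
      ultimately show "node_length u * node_length v * \<bar>4 ^ l * node_integral (interleave u v) f\<bar> =
          \<bar>node_integral (interleave u v) f\<bar>"
        by (simp only: node_length_level abs_mult) simp
    qed
  qed simp_all
  also have "\<dots> = (\<Sum>p\<in>level l \<times> level l. \<bar>node_integral ((\<lambda>(u, v). interleave u v) p) f\<bar>)"
    by (simp add: sum.cartesian_product case_prod_unfold)
  also have "\<dots> = (\<Sum>w\<in>level (2 * l). \<bar>node_integral w f\<bar>)"
    by (rule sum.reindex_bij_betw[OF bij_interleave])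
  also have "\<dots> = norm (average (2 ^ (2 * l)) f)"
    by (simp add: norm_average)
  finally show ?thesis .
qed

lemma norm_square_average_le: "norm (square_average l f) \<le> 1 * norm f"
  using norm_average_le[of "2 ^ (2 * l)" f] by (simp add: norm_square_average)

lemma linear_square_average: "linear (square_average l)"
  unfolding square_average_def
  by (intro linear_compose_sum ballI bounded_linear.linear bounded_linear_node_integral
      bounded_linear_compose[OF bounded_linear_scaleR_left]
      bounded_linear_compose[OF bounded_linear_mult_right])

lemma step_grandchildren:
  assumes "w \<ge> 1"
  shows "step w c = step (4 * w) c + step (Suc (4 * w)) c + step (4 * w + 2) c + step (4 * w + 3) c"
  using assms step_children[of w c] step_children[of "2 * w" c] step_children[of "Suc (2 * w)" c]
  by (simp add: add.assoc numeral_3_eq_3)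

lemma node_integral_grandchildren:
  assumes "w \<ge> 1"
  shows "node_integral w f = node_integral (4 * w) f + node_integral (Suc (4 * w)) f +
    node_integral (4 * w + 2) f + node_integral (4 * w + 3) f"
  using assms node_integral_children[of w f] node_integral_children[of "2 * w" f]
    node_integral_children[of "Suc (2 * w)" f]
  by (simp add: add.assoc numeral_3_eq_3)

lemma product_step_split:
  assumes "u \<ge> 1" "v \<ge> 1"
  shows "step u (step v (1::real)) = step (2 * u) (step (2 * v) 1) + step (2 * u) (step (Suc (2 * v)) 1) +
    step (Suc (2 * u)) (step (2 * v) 1) + step (Suc (2 * u)) (step (Suc (2 * v)) 1)"
  using assms step_children[of u "step v (1::real)"] product_step_children[of "2 * u" v "1::real"]
    product_step_children[of "Suc (2 * u)" v "1::real"]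
  by (simp add: add.assoc)

lemma cell_integral_split:
  assumes "u \<ge> 1" "v \<ge> 1"
  shows "cell_integral u v F = cell_integral (2 * u) (2 * v) F + cell_integral (2 * u) (Suc (2 * v)) F +
    cell_integral (Suc (2 * u)) (2 * v) F + cell_integral (Suc (2 * u)) (Suc (2 * v)) F"
proof -
  have "cell_integral u v F = cell_integral (2 * u) v F + cell_integral (Suc (2 * u)) v F"
    unfolding cell_integral_def by (rule cell_children[OF bounded_linear_node_integral assms(1)])
  then show ?thesis
    using assms(2) cell_integral_children[of v "2 * u" F] cell_integral_children[of v "Suc (2 * u)" F] by simp
qed

lemma square_average_step:
  assumes "u \<in> level l" "v \<in> level l"
  shows "square_average (l + k) (step (interleave u v) 1) = step u (step v 1)"
  using assms
proof (induction k arbitrary: l u v)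
  case 0
  have w: "interleave u v \<in> level (2 * l)" by (rule interleave_level[OF 0])
  have "square_average l (step (interleave u v) 1) =
      (\<Sum>u'\<in>level l. \<Sum>v'\<in>level l. if u' = u \<and> v' = v then step u (step v 1) else 0)"
    unfolding square_average_def
  proof (intro sum.cong refl)
    fix u' v' assume mem: "u' \<in> level l" "v' \<in> level l"
    have "node_integral (interleave u' v') (step (interleave u v) 1) = (if u' = u \<and> v' = v then 1 / 4 ^ l else 0)"
      using node_integral_step[OF interleave_level[OF mem] w, of 1] node_length_level[OF w]
      by (simp add: interleave_eq_iff[OF mem 0] power_mult)
    then show "(4 ^ l * node_integral (interleave u' v') (step (interleave u v) 1)) *\<^sub>R step u' (step v' (1::real)) =
        (if u' = u \<and> v' = v then step u (step v 1) else 0)"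
      by simp
  qed
  also have "\<dots> = (\<Sum>u'\<in>level l. if u' = u then step u (step v 1) else 0)"
    using 0(2) by (intro sum.cong refl) simp
  also have "\<dots> = step u (step v 1)" using 0(1) by simp
  finally show ?case by simp
next
  case (Suc k)
  have u: "u \<ge> 1" and v: "v \<ge> 1" and w: "interleave u v \<ge> 1"
    using Suc.prems level_ge_1 interleave_level by blast+
  note IH = Suc.IH[of _ "Suc l", simplified add_Suc add_Suc_right[symmetric]]
  have "square_average (l + Suc k) (step (interleave u v) 1) =
      square_average (l + Suc k) (step (interleave (2 * u) (2 * v)) 1) +
      square_average (l + Suc k) (step (interleave (2 * u) (Suc (2 * v))) 1) +
      square_average (l + Suc k) (step (interleave (Suc (2 * u)) (2 * v)) 1) +
      square_average (l + Suc k) (step (interleave (Suc (2 * u)) (Suc (2 * v))) 1)"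
    unfolding interleave_children[OF u] step_grandchildren[OF w, of 1]
    by (simp only: linear_add[OF linear_square_average])
  also have "\<dots> = step u (step v 1)"
    unfolding product_step_split[OF u v]
    using Suc.prems by (simp only: IH level_children)
  finally show ?case .
qed

lemma cell_integral_step:
  assumes "u \<in> level l" "v \<in> level l" "u' \<in> level l" "v' \<in> level l"
  shows "cell_integral u v (step u' (step v' 1)) = (if u = u' \<and> v = v' then 1 / 4 ^ l else 0)"
proof -
  have "cell_integral u v (step u' (step v' 1)) =
      (LINT x|unit_measure. indicator (node u) x * indicator (node u') x) * node_integral v (step v' 1)"
    unfolding cell_integral_def
    by (rule weighted_integral_step[OF indicator_node_measurable bounded_linear_node_integral level_ge_1[OF assms(3)]])
  also have "(LINT x|unit_measure. indicator (node u) x * indicator (node u') x) = node_integral u (step u' 1)"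
    unfolding node_integral_def
    using weighted_integral_step[OF indicator_node_measurable bounded_linear_ident level_ge_1[OF assms(3)], of u 1] by simp
  also have "(4::real) ^ l = 2 ^ l * 2 ^ l" by (simp flip: power_mult_distrib)
  ultimately show ?thesis
    using assms by (simp add: node_integral_step[of _ "2 ^ l"] node_length_level[of _ l])
qed

lemma bounded_linear_cell_integral: "bounded_linear (cell_integral u v)"
  unfolding cell_integral_def by (intro bounded_linear_cell bounded_linear_node_integral)

text \<open>
  On the cells of the approximation itself this is the disjointness of the cells, and a larger
  square is a union of such cells.
\<close>
lemma cell_integral_square_average:
  assumes "u \<in> level l" "v \<in> level l"
  shows "cell_integral u v (square_average (l + k) f) = node_integral (interleave u v) f"
  using assms
proof (induction k arbitrary: l u v)
  case 0
  note lin = bounded_linear.linear[OF bounded_linear_cell_integral[of u v]]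
  have "cell_integral u v (square_average l f) =
      (\<Sum>u'\<in>level l. \<Sum>v'\<in>level l. if u = u' \<and> v = v' then node_integral (interleave u v) f else 0)"
    unfolding square_average_def linear_sum[OF lin]
    by (intro sum.cong refl) (simp add: linear_cmul[OF lin] cell_integral_step[OF 0])
  also have "\<dots> = (\<Sum>u'\<in>level l. if u = u' then node_integral (interleave u v) f else 0)"
    using 0(2) by (intro sum.cong refl) simp
  also have "\<dots> = node_integral (interleave u v) f" using 0(1) by simp
  finally show ?case by simp
next
  case (Suc k)
  have u: "u \<ge> 1" and v: "v \<ge> 1" and w: "interleave u v \<ge> 1"
    using Suc.prems level_ge_1 interleave_level by blast+
  note IH = Suc.IH[of _ "Suc l", simplified add_Suc add_Suc_right[symmetric]]
  show ?case
    unfolding cell_integral_split[OF u v]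
    using Suc.prems
    by (simp only: IH level_children interleave_children[OF u] node_integral_grandchildren[OF w])
qed

lemma square_steps_dense:
  fixes C :: "real L1 set"
  assumes C: "subspace C" "closed C"
    and mem: "\<And>l u v. u \<in> level l \<Longrightarrow> v \<in> level l \<Longrightarrow> step (interleave u v) (1::real) \<in> C"
  shows "C = UNIV"
proof (rule dyadic_steps_dense[OF C])
  have even: "step w (1::real) \<in> C" if w: "w \<in> level (2 * l)" for w l
  proof -
    have "w \<in> (\<lambda>(u, v). interleave u v) ` (level l \<times> level l)"
      using w unfolding bij_betw_imp_surj_on[OF bij_interleave[of l]] .
    then obtain u v where "u \<in> level l" "v \<in> level l" "w = interleave u v"
      by (elim imageE SigmaE) simp
    then show ?thesis using mem by simp
  qed
  fix k :: nat and c :: real assume k: "k \<ge> 1"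
  then have lev: "k \<in> level (floor_log k)"
    using floor_log_exp2_le[of k] floor_log_exp2_gt[of k] by simp
  have "step k (1::real) \<in> C"
  proof (cases "even (floor_log k)")
    case True
    then obtain l where "floor_log k = 2 * l" by (elim evenE)
    then show ?thesis using even[of k l] lev by simp
  next
    case False
    then obtain l where "Suc (floor_log k) = 2 * Suc l" by (elim oddE) simp
    then have "step (2 * k) (1::real) \<in> C" "step (Suc (2 * k)) (1::real) \<in> C"
      using even[of _ "Suc l"] level_children[OF lev] by metis+
    then show ?thesis
      unfolding step_children[OF k] by (rule subspace_add[OF C(1)])
  qed
  then have "c *\<^sub>R step k (1::real) \<in> C" by (rule subspace_scale[OF C(1)])
  then show "step k c \<in> C" by (simp add: step_scale[OF k])
qed

text \<open>
  A dyadic rectangle is a finite union of dyadic squares.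
\<close>
lemma equal_level_steps_dense:
  fixes C :: "real L1 L1 set"
  assumes C: "subspace C" "closed C"
    and mem: "\<And>l u v. u \<in> level l \<Longrightarrow> v \<in> level l \<Longrightarrow> step u (step v (1::real)) \<in> C"
  shows "C = UNIV"
proof (rule product_steps_dense[OF C])
  have 1: "step u (step v (1::real)) \<in> C" if "u \<in> level l" "v \<in> level (l + d)" for l d u v
    using that
  proof (induction d arbitrary: l u)
    case (Suc d)
    have "step (2 * u) (step v (1::real)) \<in> C" "step (Suc (2 * u)) (step v (1::real)) \<in> C"
      using Suc.IH[OF level_children(1)[OF Suc.prems(1)]] Suc.IH[OF level_children(2)[OF Suc.prems(1)]] Suc.prems(2)
      by simp_all
    then show ?case
      unfolding step_children[OF level_ge_1[OF Suc.prems(1)]] by (rule subspace_add[OF C(1)])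
  qed (use mem in simp)
  have 2: "step u (step v (1::real)) \<in> C" if "v \<in> level l" "u \<in> level (l + d)" for l d u v
    using that
  proof (induction d arbitrary: l v)
    case (Suc d)
    have "step u (step (2 * v) (1::real)) \<in> C" "step u (step (Suc (2 * v)) (1::real)) \<in> C"
      using Suc.IH[OF level_children(1)[OF Suc.prems(1)]] Suc.IH[OF level_children(2)[OF Suc.prems(1)]] Suc.prems(2)
      by simp_all
    then show ?case
      unfolding product_step_children[OF level_ge_1[OF Suc.prems(2)] level_ge_1[OF Suc.prems(1)]]
      by (rule subspace_add[OF C(1)])
  qed (use mem in simp)
  fix u v :: nat assume "u \<ge> 1" "v \<ge> 1"
  then have "u \<in> level (floor_log u)" "v \<in> level (floor_log v)"
    using floor_log_exp2_le[of u] floor_log_exp2_gt[of u] floor_log_exp2_le[of v] floor_log_exp2_gt[of v] by simp_all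
  then show "step u (step v (1::real)) \<in> C"
    using 1[of u "floor_log u" v "floor_log v - floor_log u"] 2[of v "floor_log v" u "floor_log u - floor_log v"]
    by (cases "floor_log u \<le> floor_log v") auto
qed

text \<open>
  The isometry from \<open>L\<^sup>1\<close> of the interval onto \<open>L\<^sup>1(L\<^sup>1)\<close> that carries nodes of even level to squares.
  Obtaining it as a limit of averages avoids the interleaving of the digits of points.
\<close>
definition fold_square :: "real L1 \<Rightarrow> real L1 L1" where
  "fold_square f = lim (\<lambda>l. square_average l f)"

lemma fold_square_tendsto: "(\<lambda>l. square_average l f) \<longlonglongrightarrow> fold_square f"
proof -
  have "{f. convergent (\<lambda>l. square_average l f)} = UNIV"
  proof (rule square_steps_dense)
    note convergent_closed_subspace[of square_average, OF linear_square_average norm_square_average_le]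
    then show "subspace {f. convergent (\<lambda>l. square_average l f)}" "closed {f. convergent (\<lambda>l. square_average l f)}"
      by auto
    fix l u v assume "u \<in> level l" "v \<in> level l"
    then have "square_average m (step (interleave u v) 1) = step u (step v 1)" if "m \<ge> l" for m
      using square_average_step[of u l v "m - l"] that by simp
    then have "(\<lambda>m. square_average m (step (interleave u v) 1)) \<longlonglongrightarrow> step u (step v 1)"
      by (intro tendsto_eventually) (auto simp: eventually_sequentially)
    then show "step (interleave u v) 1 \<in> {f. convergent (\<lambda>l. square_average l f)}"
      by (auto simp: convergent_def)
  qed
  then show ?thesis
    unfolding fold_square_def convergent_LIMSEQ_iff[symmetric] by blast
qed

lemma fold_square_step:
  assumes "u \<in> level l" "v \<in> level l"
  shows "fold_square (step (interleave u v) 1) = step u (step v 1)"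
proof (rule LIMSEQ_unique[OF fold_square_tendsto])
  have "square_average m (step (interleave u v) 1) = step u (step v 1)" if "m \<ge> l" for m
    using square_average_step[OF assms, of "m - l"] that by simp
  then show "(\<lambda>m. square_average m (step (interleave u v) 1)) \<longlonglongrightarrow> step u (step v 1)"
    by (intro tendsto_eventually) (auto simp: eventually_sequentially)
qed

text \<open>
  The approximations have the norm of the averages of \<open>f\<close>, which converge to \<open>f\<close>.
\<close>
lemma norm_fold_square: "norm (fold_square f) = norm f"
proof (rule LIMSEQ_unique)
  show "(\<lambda>l. norm (square_average l f)) \<longlonglongrightarrow> norm (fold_square f)"
    by (intro tendsto_norm fold_square_tendsto)
  have "(\<lambda>l. average (2 ^ (2 * l)) f) \<longlonglongrightarrow> f"
    using LIMSEQ_subseq_LIMSEQ[OF average_tendsto, of "\<lambda>l. 2 * l"] by (simp add: strict_mono_def o_def)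
  then show "(\<lambda>l. norm (square_average l f)) \<longlonglongrightarrow> norm f"
    unfolding norm_square_average by (rule tendsto_norm)
qed

lemma bounded_linear_fold_square: "bounded_linear fold_square"
proof (rule bounded_linear_intro[where K = 1])
  fix f g and c :: real
  show "fold_square (f + g) = fold_square f + fold_square g"
    using tendsto_add[OF fold_square_tendsto[of f] fold_square_tendsto[of g]] fold_square_tendsto[of "f + g"]
    unfolding linear_add[OF linear_square_average] by (rule LIMSEQ_unique[rotated])
  show "fold_square (c *\<^sub>R f) = c *\<^sub>R fold_square f"
    using tendsto_scaleR[OF tendsto_const fold_square_tendsto[of f]] fold_square_tendsto[of "c *\<^sub>R f"]
    unfolding linear_cmul[OF linear_square_average] by (rule LIMSEQ_unique[rotated])
qed (simp add: norm_fold_square)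

lemma surj_fold_square: "surj fold_square"
proof (rule equal_level_steps_dense)
  show "subspace (range fold_square)"
    by (rule linear_subspace_image[OF bounded_linear.linear[OF bounded_linear_fold_square] subspace_UNIV])
  have "complete (range fold_square)"
    by (rule complete_isometric_image[of 1])
      (simp_all add: bounded_linear_fold_square norm_fold_square complete_UNIV)
  then show "closed (range fold_square)" by (rule complete_imp_closed)
  fix l u v assume "u \<in> level l" "v \<in> level l"
  then show "step u (step v (1::real)) \<in> range fold_square"
    by (metis fold_square_step rangeI)
qed

lemma cell_integral_fold_square:
  assumes "u \<in> level l" "v \<in> level l"
  shows "cell_integral u v (fold_square f) = node_integral (interleave u v) f"
proof (rule LIMSEQ_unique)
  show "(\<lambda>m. cell_integral u v (square_average m f)) \<longlonglongrightarrow> cell_integral u v (fold_square f)"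
    by (rule bounded_linear.tendsto[OF bounded_linear_cell_integral fold_square_tendsto])
  have "cell_integral u v (square_average m f) = node_integral (interleave u v) f" if "m \<ge> l" for m
    using cell_integral_square_average[OF assms, of "m - l"] that by simp
  then show "(\<lambda>m. cell_integral u v (square_average m f)) \<longlonglongrightarrow> node_integral (interleave u v) f"
    by (intro tendsto_eventually) (auto simp: eventually_sequentially)
qed

section \<open>Multiplication operators\<close>

definition multiply :: "(real \<Rightarrow> real) \<Rightarrow> real L1 \<Rightarrow> real L1" where
  "multiply \<phi> F = abs_L1 (\<lambda>x. \<phi> x * rep_L1 F x)"

definition bounded_weight :: "real \<Rightarrow> (real \<Rightarrow> real) \<Rightarrow> bool" where
  "bounded_weight B \<phi> \<longleftrightarrow> \<phi> \<in> borel_measurable unit_measure \<and> (\<forall>x\<in>{0..<1}. \<bar>\<phi> x\<bar> \<le> B)"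

lemma L1_eqI:
  assumes "AE x in unit_measure. rep_L1 F x = rep_L1 G x"
  shows "F = G"
  using abs_L1_eqI[OF rep_L1_integrable rep_L1_integrable assms] by (simp add: abs_rep_L1)

lemma multiply_integrable:
  assumes "bounded_weight B \<phi>"
  shows "L1_integrable (\<lambda>x. \<phi> x * rep_L1 F x)"
  using integrable_scaled[of \<phi> B "rep_L1 F", OF _ _ rep_L1_integrable] assms by (simp add: bounded_weight_def)

lemma rep_multiply:
  assumes "bounded_weight B \<phi>"
  shows "AE x in unit_measure. rep_L1 (multiply \<phi> F) x = \<phi> x * rep_L1 F x"
  unfolding multiply_def by (rule rep_abs_L1[OF multiply_integrable[OF assms]])

lemma norm_multiply:
  assumes "bounded_weight B \<phi>"
  shows "norm (multiply \<phi> F) = (LINT x|unit_measure. \<bar>\<phi> x\<bar> * \<bar>rep_L1 F x\<bar>)"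
  unfolding multiply_def norm_abs_L1[OF multiply_integrable[OF assms]] by (simp add: abs_mult)

lemma norm_multiply_le:
  assumes "bounded_weight B \<phi>"
  shows "norm (multiply \<phi> F) \<le> B * norm F"
proof -
  have "(LINT x|unit_measure. \<bar>\<phi> x\<bar> * \<bar>rep_L1 F x\<bar>) \<le> (LINT x|unit_measure. B * \<bar>rep_L1 F x\<bar>)"
  proof (rule integral_mono)
    show "L1_integrable (\<lambda>x. \<bar>\<phi> x\<bar> * \<bar>rep_L1 F x\<bar>)"
      using integrable_norm[OF multiply_integrable[OF assms]] by (simp add: abs_mult)
    show "L1_integrable (\<lambda>x. B * \<bar>rep_L1 F x\<bar>)"
      using rep_L1_integrable[of F] by simp
  qed (use assms in \<open>auto simp: bounded_weight_def intro!: mult_right_mono\<close>)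
  also have "\<dots> = B * norm F"
    by (simp add: norm_L1_rep)
  finally show ?thesis
    unfolding norm_multiply[OF assms] .
qed

lemma bounded_linear_multiply:
  assumes "bounded_weight B \<phi>"
  shows "bounded_linear (multiply \<phi>)"
proof (rule bounded_linear_intro[where K = B])
  fix F G and c :: real
  note int = multiply_integrable[OF assms]
  show "multiply \<phi> (F + G) = multiply \<phi> F + multiply \<phi> G"
    unfolding multiply_def L1_ops(1)[OF int int]
    by (intro abs_L1_eqI int Bochner_Integration.integrable_add AE_mp[OF rep_L1_ops(1)[of F G] AE_I2])
      (simp add: algebra_simps)
  show "multiply \<phi> (c *\<^sub>R F) = c *\<^sub>R multiply \<phi> F"
    unfolding multiply_def scaleR_abs_L1[OF int]
    by (intro abs_L1_eqI int Bochner_Integration.integrable_scaleR_right AE_mp[OF rep_L1_ops(3)[of c F] AE_I2])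
      simp
  show "norm (multiply \<phi> F) \<le> norm F * B"
    using norm_multiply_le[OF assms, of F] by (simp add: mult.commute)
qed

lemma multiply_multiply:
  assumes "bounded_weight B \<phi>" "bounded_weight B' \<psi>"
  shows "multiply \<phi> (multiply \<psi> F) = multiply (\<lambda>x. \<phi> x * \<psi> x) F"
proof -
  have phi: "\<bar>\<phi> x\<bar> \<le> B" and psi: "\<bar>\<psi> x\<bar> \<le> B'" if "x \<in> {0..<1}" for x
    using assms that by (auto simp: bounded_weight_def)
  have "bounded_weight (B * B') (\<lambda>x. \<phi> x * \<psi> x)"
    unfolding bounded_weight_def
  proof (intro conjI ballI)
    show "(\<lambda>x. \<phi> x * \<psi> x) \<in> borel_measurable unit_measure"
      using assms by (intro borel_measurable_times) (auto simp: bounded_weight_def)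
    fix x :: real assume "x \<in> {0..<1}"
    then show "\<bar>\<phi> x * \<psi> x\<bar> \<le> B * B'"
      unfolding abs_mult using phi[of x] psi[of x] by (intro mult_mono) auto
  qed
  note int = multiply_integrable[OF this]
  show ?thesis
    unfolding multiply_def[of \<phi>] multiply_def[of "\<lambda>x. \<phi> x * \<psi> x"]
    by (intro abs_L1_eqI int multiply_integrable[OF assms(1)] AE_mp[OF rep_multiply[OF assms(2), of F] AE_I2]) simp
qed

definition restr :: "real set \<Rightarrow> real L1 \<Rightarrow> real L1" where
  "restr A = multiply (indicator A)"

lemma bounded_weight_indicator: "A \<in> sets borel \<Longrightarrow> bounded_weight 1 (indicator A)"
  by (auto simp: bounded_weight_def indicator_def intro!: L1_measurable)

lemma linear_restr: "A \<in> sets borel \<Longrightarrow> linear (restr A)"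
  unfolding restr_def by (intro bounded_linear.linear bounded_linear_multiply[of 1] bounded_weight_indicator)

lemma restr_sum: "A \<in> sets borel \<Longrightarrow> restr A (sum f I) = (\<Sum>i\<in>I. restr A (f i))"
  using linear_sum[OF linear_restr] by blast

lemma norm_restr: "A \<in> sets borel \<Longrightarrow> norm (restr A F) = (LINT x|unit_measure. indicator A x * \<bar>rep_L1 F x\<bar>)"
  unfolding restr_def using norm_multiply[OF bounded_weight_indicator] by simp

lemma restr_abs_integrable:
  fixes F :: "real L1"
  shows "A \<in> sets borel \<Longrightarrow> L1_integrable (\<lambda>x. indicator A x * \<bar>rep_L1 F x\<bar>)"
  using integrable_norm[OF multiply_integrable[OF bounded_weight_indicator, of A F]] by (simp add: abs_mult)

lemma norm_restr_Un:
  assumes "A \<in> sets borel" "B \<in> sets borel" "A \<inter> B = {}"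
  shows "norm (restr (A \<union> B) F) = norm (restr A F) + norm (restr B F)"
proof -
  have "(indicator (A \<union> B) x :: real) = indicator A x + indicator B x" for x
    using assms(3) by (auto simp: indicator_def)
  then show ?thesis
    using assms(1,2) restr_abs_integrable[OF assms(1), of F] restr_abs_integrable[OF assms(2), of F]
    by (simp add: norm_restr distrib_right)
qed

lemma norm_restr_Diff:
  assumes "A \<in> sets borel" "B \<in> sets borel" "B \<subseteq> A"
  shows "norm (restr (A - B) F) = norm (restr A F) - norm (restr B F)"
  using norm_restr_Un[of B "A - B" F] assms by (simp add: Un_absorb1)

lemma norm_restr_le: "A \<in> sets borel \<Longrightarrow> norm (restr A F) \<le> norm F"
  unfolding restr_def using norm_multiply_le[OF bounded_weight_indicator, of A F] by simp

lemma restr_restr: "A \<in> sets borel \<Longrightarrow> B \<in> sets borel \<Longrightarrow> restr A (restr B F) = restr (A \<inter> B) F"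
  unfolding restr_def
  by (simp add: multiply_multiply[OF bounded_weight_indicator bounded_weight_indicator]
      flip: indicator_inter_arith)

lemma restr_empty [simp]: "restr {} F = 0"
  by (simp add: restr_def multiply_def L1_zero)

lemma restr_diff:
  assumes "A \<in> sets borel" "B \<in> sets borel" "B \<subseteq> A"
  shows "restr (A - B) F = restr A F - restr B F"
proof (rule L1_eqI)
  note r = rep_multiply[OF bounded_weight_indicator, folded restr_def]
  show "AE x in unit_measure. rep_L1 (restr (A - B) F) x = rep_L1 (restr A F - restr B F) x"
    using r[OF sets.Diff[OF assms(1,2)], of F] r[OF assms(1), of F] r[OF assms(2), of F]
      rep_L1_ops(2)[of "restr A F" "restr B F"]
    by eventually_elim (use assms(3) in \<open>auto simp: indicator_def\<close>)
qed

lemma sum_norm_restr_nodes: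
  assumes "N \<ge> 1"
  shows "(\<Sum>k\<in>{N..<2 * N}. norm (restr (node k) F)) = norm F"
proof -
  have "(\<Sum>k\<in>{N..<2 * N}. norm (restr (node k) F)) =
      (LINT x|unit_measure. (\<Sum>k\<in>{N..<2 * N}. indicator (node k) x * \<bar>rep_L1 F x\<bar>))"
    unfolding norm_restr[OF node_borel]
    by (rule Bochner_Integration.integral_sum[symmetric]) (rule restr_abs_integrable[OF node_borel])
  also have "\<dots> = (LINT x|unit_measure. \<bar>rep_L1 F x\<bar>)"
  proof (rule Bochner_Integration.integral_cong[OF refl])
    fix x assume "x \<in> space unit_measure"
    then show "(\<Sum>k\<in>{N..<2 * N}. indicator (node k) x * \<bar>rep_L1 F x\<bar>) = \<bar>rep_L1 F x\<bar>"
      using sum_indicator_nodes[OF assms, of x] by (simp flip: sum_distrib_right)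
  qed
  finally show ?thesis by (simp add: norm_L1_rep)
qed

lemma node_integral_restr:
  assumes "A \<in> sets borel"
  shows "node_integral k (restr A F) = (LINT x|unit_measure. indicator (node k \<inter> A) x * rep_L1 F x)"
proof -
  have "node_integral k (restr A F) = (LINT x|unit_measure. indicator (node k) x * (indicator A x * rep_L1 F x))"
    unfolding node_integral_def restr_def multiply_def
    by (rule weighted_integral_abs[OF indicator_node_measurable bounded_linear_ident
          multiply_integrable[OF bounded_weight_indicator[OF assms]]])
  then show ?thesis by (simp add: indicator_inter_arith mult.assoc)
qed

lemma node_integral_restr_node: "node_integral k (restr (node k) F) = node_integral k F"
  by (simp add: node_integral_restr) (simp add: node_integral_def weighted_integral_def)

lemma abs_node_integral_le: "\<bar>node_integral k F\<bar> \<le> norm (restr (node k) F)"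
  unfolding node_integral_def weighted_integral_def norm_restr[OF node_borel]
  using integral_norm_bound[of unit_measure "\<lambda>x. indicator (node k) x * rep_L1 F x"] by (simp add: abs_mult)

lemma rep_step: "AE x in unit_measure. rep_L1 (step k (c::real)) x = indicator (node k) x * c"
  unfolding step_def using rep_abs_L1[OF L1_integrable_indicator[OF node_borel], of k c] by simp

section \<open>The quantile transform of a set of positive measure\<close>

text \<open>
  \<open>F\<close> is the distribution function of the normalized Lebesgue measure on \<open>E\<close>, and \<open>G\<close> its
  quantile function.  The measure has no atoms, so \<open>F\<close> is continuous and \<open>F \<circ> G = id\<close>.
\<close>
lemma quantile_transform:
  fixes E :: "real set"
  assumes E [measurable]: "E \<in> sets borel" and sub: "E \<subseteq> {0..<1}" and pos: "measure lborel E > 0"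
  obtains F G :: "real \<Rightarrow> real" where "F \<in> borel_measurable borel" "G \<in> borel_measurable unit_measure"
    "\<And>u. u \<in> {0..<1} \<Longrightarrow> G u \<in> {0..<1} \<and> F (G u) = u"
    "distr unit_measure borel G = density lborel (\<lambda>x. ennreal (indicator E x / measure lborel E))"
proof -
  define m where "m = measure lborel E"
  define F where "F s = measure lborel (E \<inter> {..s}) / m" for s
  define G where "G u = Inf {s \<in> {0..1}. u \<le> F s}" for u
  have m: "m > 0" using pos by (simp add: m_def)
  have fin: "emeasure lborel A < \<infinity>" if "A \<subseteq> E" "A \<in> sets borel" for A
  proof -
    have "emeasure lborel A \<le> emeasure lborel {0..<1::real}"
      using that sub by (intro emeasure_mono) auto
    then show ?thesis using le_less_trans by fastforce
  qed
  have F_diff: "0 \<le> F t - F s \<and> F t - F s \<le> (t - s) / m" if "s \<le> t" for s t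
  proof -
    have "measure lborel (E \<inter> {..t}) = measure lborel ((E \<inter> {..s}) \<union> (E \<inter> {s<..t}))"
      using that by (intro arg_cong[of _ _ "measure lborel"]) auto
    also have "\<dots> = measure lborel (E \<inter> {..s}) + measure lborel (E \<inter> {s<..t})"
      using fin[of "E \<inter> {..s}"] fin[of "E \<inter> {s<..t}"] by (intro measure_Union) auto
    finally have "F t - F s = measure lborel (E \<inter> {s<..t}) / m"
      by (simp add: F_def diff_divide_distrib[symmetric])
    moreover have "measure lborel (E \<inter> {s<..t}) \<le> measure lborel {s<..t}"
      using that by (intro measure_mono_fmeasurable) (auto simp: fmeasurable_def)
    ultimately show ?thesis
      using m that by (simp add: divide_right_mono)
  qed
  have mono: "mono F" using F_diff by (intro monoI) (metis diff_ge_0_iff_ge)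
  have cont: "continuous_on UNIV F"
  proof -
    have "\<bar>F t - F s\<bar> \<le> (1 / m) * \<bar>t - s\<bar>" for s t
      using F_diff[of s t] F_diff[of t s] by (cases "s \<le> t") auto
    then have "(1 / m)-lipschitz_on UNIV F"
      using m by (intro lipschitz_onI) (auto simp: dist_real_def)
    then show ?thesis by (rule lipschitz_on_continuous_on)
  qed
  have F_low: "F s = 0" if "s < 0" for s
  proof -
    have "E \<inter> {..s} = {}" using sub that by auto
    then show ?thesis by (simp add: F_def)
  qed
  have F_high: "F s = 1" if "s \<ge> 1" for s
  proof -
    have "E \<inter> {..s} = E" using sub that by auto
    then show ?thesis using m by (simp add: F_def m_def)
  qed
  have F0: "F 0 = 0"
  proof -
    have "measure lborel (E \<inter> {..0}) \<le> measure lborel {0::real}"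
      using sub by (intro measure_mono_fmeasurable) (auto simp: fmeasurable_def)
    then show ?thesis using m by (simp add: F_def measure_le_0_iff)
  qed
  have G_le_iff: "G u \<le> s \<longleftrightarrow> u \<le> F s" and G_mem: "G u \<in> {0..1} \<and> u \<le> F (G u)"
    if u: "u \<in> {0..<1}" and s: "s \<in> {0..1}" for u s
  proof -
    let ?A = "{s \<in> {0..1}. u \<le> F s}"
    have ne: "1 \<in> ?A" using u F_high by simp
    have bdd: "bdd_below ?A" by (intro bdd_belowI[of _ 0]) auto
    have "?A = {0..1} \<inter> {s. u \<le> F s}" by auto
    moreover have "closed {s. u \<le> F s}"
      by (intro closed_Collect_le continuous_on_const cont)
    ultimately have "closed ?A" by (simp only: closed_Int closed_atLeastAtMost)
    then have mem: "G u \<in> ?A"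
      unfolding G_def using ne bdd by (intro closed_contains_Inf) auto
    then show "G u \<in> {0..1} \<and> u \<le> F (G u)" by simp
    show "G u \<le> s \<longleftrightarrow> u \<le> F s"
    proof
      assume "G u \<le> s"
      then show "u \<le> F s" using mem monoD[OF mono, of "G u" s] by simp
    next
      assume "u \<le> F s"
      then show "G u \<le> s" unfolding G_def using s by (intro cInf_lower bdd) simp
    qed
  qed
  have FG: "G u \<in> {0..<1} \<and> F (G u) = u" if u: "u \<in> {0..<1}" for u
  proof -
    have mem: "G u \<in> {0..1}" "u \<le> F (G u)" using G_mem[OF u, of 0] by auto
    obtain s where s: "0 \<le> s" "s \<le> G u" "F s = u"
      using IVT'[of F 0 u "G u"] F0 u mem continuous_on_subset[OF cont] by auto
    then have "G u \<le> s" using G_le_iff[OF u, of s] mem by auto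
    then have "F (G u) = u" using s by simp
    then show ?thesis using mem u F_high[of "G u"] by (cases "G u = 1") auto
  qed
  have level: "{u \<in> {0..<1}. G u \<le> s} = (if s < 0 then {} else {0..<1} \<inter> {..F s})" for s
  proof -
    consider "s < 0" | "s \<in> {0..1}" | "s > 1" by fastforce
    then show ?thesis
    proof cases
      case 1
      have "s < G u" if "u \<in> {0..<1}" for u using FG[OF that] 1 by auto
      then show ?thesis using 1 by force
    next
      case 2
      then show ?thesis using G_le_iff by auto
    next
      case 3
      have "G u < s" if "u \<in> {0..<1}" for u using FG[OF that] 3 by auto
      then show ?thesis using F_high[of s] 3 by force
    qed
  qed
  have F_meas: "F \<in> borel_measurable borel"
    using cont by (rule borel_measurable_continuous_onI)
  have G_meas: "G \<in> borel_measurable unit_measure"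
    unfolding borel_measurable_iff_le
  proof
    fix s
    show "{w \<in> space unit_measure. G w \<le> s} \<in> sets unit_measure"
      unfolding space_unit level by (auto simp: sets_unit)
  qed
  have F_range: "0 \<le> F s" "F s \<le> 1" for s
    using F_low[of "min (s - 1) (-1)"] F_high[of "max s 1"] monoD[OF mono, of "min (s - 1) (-1)" s]
      monoD[OF mono, of s "max s 1"] by auto
  have "distr unit_measure borel G = density lborel (\<lambda>x. ennreal (indicator E x / m))"
  proof (rule measure_eqI_lessThan)
    fix x
    have "emeasure (distr unit_measure borel G) {x<..} = emeasure unit_measure ({0..<1} - {u \<in> {0..<1}. G u \<le> x})"
      by (subst emeasure_distr[OF G_meas]) (auto intro!: arg_cong[of _ _ "emeasure unit_measure"])
    also have "\<dots> = emeasure lborel ({0..<1} - {u \<in> {0..<1}. G u \<le> x})"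
      by (rule emeasure_restrict_space) auto
    also have "\<dots> = ennreal (1 - F x)"
    proof (cases "x < 0")
      case True
      then show ?thesis using F_low[of x] unfolding level by simp
    next
      case False
      have "{0..<1} - {0..<1} \<inter> {..F x} = {F x<..<1}" using F_range[of x] by auto
      then show ?thesis using False F_range[of x] unfolding level by simp
    qed
    finally have distr: "emeasure (distr unit_measure borel G) {x<..} = ennreal (1 - F x)" .
    have "emeasure (density lborel (\<lambda>x. ennreal (indicator E x / m))) {x<..} =
        (\<integral>\<^sup>+ y. ennreal (1 / m) * indicator (E \<inter> {x<..}) y \<partial>lborel)"
      by (subst emeasure_density) (auto intro!: nn_integral_cong simp: indicator_def)
    also have "\<dots> = ennreal (1 / m) * emeasure lborel (E \<inter> {x<..})"
      by (rule nn_integral_cmult_indicator) simp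
    also have "emeasure lborel (E \<inter> {x<..}) = ennreal (measure lborel (E \<inter> {x<..}))"
      using fin[of "E \<inter> {x<..}"] by (intro emeasure_eq_ennreal_measure) auto
    also have "measure lborel (E \<inter> {x<..}) = m - measure lborel (E \<inter> {..x})"
    proof -
      have "measure lborel ((E \<inter> {..x}) \<union> (E \<inter> {x<..})) =
          measure lborel (E \<inter> {..x}) + measure lborel (E \<inter> {x<..})"
        using fin[of "E \<inter> {..x}"] fin[of "E \<inter> {x<..}"] by (intro measure_Union) auto
      moreover have "(E \<inter> {..x}) \<union> (E \<inter> {x<..}) = E" by auto
      ultimately show ?thesis by (simp add: m_def)
    qed
    also have "ennreal (1 / m) * ennreal (m - measure lborel (E \<inter> {..x})) = ennreal (1 - F x)"
      using m by (subst ennreal_mult'[symmetric]) (simp_all add: F_def diff_divide_distrib)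
    finally show "emeasure (distr unit_measure borel G) {x<..} =
        emeasure (density lborel (\<lambda>x. ennreal (indicator E x / m))) {x<..}"
      using distr by simp
    show "emeasure (distr unit_measure borel G) {x<..} < \<infinity>"
      unfolding distr by simp
  qed simp_all
  then show thesis
    using that[OF F_meas G_meas FG] by (simp add: m_def)
qed

text \<open>
  The quantile function \<open>G\<close> of \<open>E\<close> carries Lebesgue measure to the normalized measure on \<open>E\<close>, and
  \<open>F \<circ> G = id\<close>.  Hence \<open>f \<mapsto> f \<circ> F\<close>, divided by the measure of \<open>E\<close>, embeds \<open>L\<^sup>1\<close> into \<open>L\<^sup>1(E)\<close> and
  composition with \<open>G\<close>, multiplied by it, is a left inverse.
\<close>
lemma L1_embeds_in_L1_of_subset:
  fixes E :: "real set"
  assumes E [measurable]: "E \<in> sets borel" and sub: "E \<subseteq> {0..<1}" and pos: "measure lborel E > 0"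
  obtains R U :: "real L1 \<Rightarrow> real L1" where "bounded_linear R" "bounded_linear U"
    "\<And>f. norm (R f) \<le> norm f" "\<And>f. norm (U f) \<le> norm f" "\<And>f. U (R f) = f" "\<And>f. restr E (R f) = R f"
proof -
  define m where "m = measure lborel E"
  have m: "m > 0" using pos by (simp add: m_def)
  obtain F G :: "real \<Rightarrow> real" where F [measurable]: "F \<in> borel_measurable borel"
    and G [measurable]: "G \<in> borel_measurable unit_measure"
    and FG: "\<And>u. u \<in> {0..<1} \<Longrightarrow> G u \<in> {0..<1} \<and> F (G u) = u"
    and distr: "distr unit_measure borel G = density lborel (\<lambda>x. ennreal (indicator E x / m))"
    using quantile_transform[OF assms] unfolding m_def by metis
  have AE_distr: "(AE x in distr unit_measure borel G. P x) \<longleftrightarrow> (AE x in unit_measure. x \<in> E \<longrightarrow> P x)" for P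
  proof -
    have "(AE x in distr unit_measure borel G. P x) \<longleftrightarrow> (AE x in lborel. x \<in> E \<longrightarrow> P x)"
      unfolding distr using m by (subst AE_density) (auto simp: indicator_def intro!: AE_cong)
    also have "\<dots> \<longleftrightarrow> (AE x in unit_measure. x \<in> E \<longrightarrow> P x)"
      using sub by (subst AE_restrict_space_iff) (auto intro!: AE_cong)
    finally show ?thesis .
  qed
  have AE_G: "AE u in unit_measure. G u \<in> E \<and> P (G u)" if "AE x in unit_measure. P x" for P
  proof -
    have "AE x in distr unit_measure borel G. x \<in> E \<and> P x"
      unfolding AE_distr using that by (auto elim: AE_mp)
    then show ?thesis by (rule AE_distrD[OF G])
  qed
  have AE_F: "AE x in unit_measure. x \<in> E \<longrightarrow> P (F x)" if P: "AE u in unit_measure. P u" for P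
  proof -
    obtain N where N: "{x \<in> space unit_measure. \<not> P x} \<subseteq> N" "emeasure unit_measure N = 0" "N \<in> sets unit_measure"
      using AE_E[OF P] by auto
    have [measurable]: "N \<in> sets borel" using N(3) by (simp add: sets_unit)
    have "AE u in unit_measure. u \<in> {0..<1} - N"
      using AE_not_in[of N unit_measure] N(2,3) AE_space[of unit_measure] by (auto simp: null_sets_def)
    then have "AE u in unit_measure. F (G u) \<in> {0..<1} - N"
      using AE_space[of unit_measure] by eventually_elim (use FG in auto)
    then have "AE x in distr unit_measure borel G. F x \<in> {0..<1} - N"
      by (subst AE_distr_iff) auto
    then have "AE x in unit_measure. x \<in> E \<longrightarrow> F x \<in> {0..<1} - N"
      unfolding AE_distr .
    then show ?thesis
      by eventually_elim (use N(1) in auto)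
  qed
  have ind: "indicator {0..<1} x * (indicator E x / m * h x) = indicator E x / m * h x" for h :: "real \<Rightarrow> real" and x
    using sub by (auto simp: indicator_def)
  have int_iff: "L1_integrable (\<lambda>u. h (G u)) \<longleftrightarrow> L1_integrable (\<lambda>x. indicator E x / m * h x)"
    and int_eq: "(LINT u|unit_measure. h (G u)) = (LINT x|unit_measure. indicator E x / m * h x)"
    if [measurable]: "h \<in> borel_measurable borel" for h :: "real \<Rightarrow> real"
  proof -
    have "L1_integrable (\<lambda>u. h (G u)) \<longleftrightarrow> integrable (distr unit_measure borel G) h"
      by (rule integrable_distr_eq[symmetric]) auto
    also have "\<dots> \<longleftrightarrow> integrable lborel (\<lambda>x. indicator E x / m * h x)"
      unfolding distr using m by (subst integrable_density) auto
    also have "\<dots> \<longleftrightarrow> L1_integrable (\<lambda>x. indicator E x / m * h x)"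
      by (subst integrable_restrict_space) (simp_all only: real_scaleR_def ind, simp)
    finally show "L1_integrable (\<lambda>u. h (G u)) \<longleftrightarrow> L1_integrable (\<lambda>x. indicator E x / m * h x)" .
    have "(LINT u|unit_measure. h (G u)) = integral\<^sup>L (distr unit_measure borel G) h"
      by (rule integral_distr[symmetric]) auto
    also have "\<dots> = (LINT x|lborel. indicator E x / m * h x)"
      unfolding distr using m by (subst integral_density) auto
    also have "\<dots> = (LINT x|unit_measure. indicator E x / m * h x)"
      by (subst integral_restrict_space) (simp_all only: real_scaleR_def ind, simp)
    finally show "(LINT u|unit_measure. h (G u)) = (LINT x|unit_measure. indicator E x / m * h x)" .
  qed
  \<comment> \<open>A representative is measurable on \<open>[0, 1)\<close> only, whereas \<open>F\<close> also takes the value 1.\<close>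
  define ext where "ext f x = indicator {0..<1} x * rep_L1 f x" for f :: "real L1" and x :: real
  have [measurable]: "ext f \<in> borel_measurable borel" for f
  proof -
    have "(\<lambda>x. indicator {0..<1} x *\<^sub>R rep_L1 f x) \<in> borel_measurable lborel"
      using rep_L1_measurable[of f] by (subst (asm) borel_measurable_restrict_space_iff) auto
    then show ?thesis by (simp add: ext_def[abs_def])
  qed
  have ext: "ext f x = rep_L1 f x" if "x \<in> {0..<1}" for f x
    using that by (simp add: ext_def)
  have ext_int: "L1_integrable (ext f)" for f
    by (rule Bochner_Integration.integrable_cong[THEN iffD1, OF refl _ rep_L1_integrable[of f]]) (simp add: ext)
  define R where "R f = abs_L1 (\<lambda>x. indicator E x / m * ext f (F x))" for f
  define U where "U g = abs_L1 (\<lambda>u. m * ext g (G u))" for g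
  have R_int: "L1_integrable (\<lambda>x. indicator E x / m * ext f (F x))" for f
  proof -
    have "L1_integrable (\<lambda>u. ext f (F (G u)))"
      by (rule Bochner_Integration.integrable_cong[THEN iffD1, OF refl _ ext_int[of f]]) (simp add: FG)
    then show ?thesis using int_iff[of "\<lambda>x. ext f (F x)"] by simp
  qed
  have U_int: "L1_integrable (\<lambda>u. m * ext g (G u))" for g
  proof -
    have "L1_integrable (\<lambda>x. indicator E x / m * ext g x)"
      using integrable_scaled[of "\<lambda>x. indicator E x / m" "1 / m" "ext g"] m ext_int
      by (simp add: L1_measurable indicator_def)
    then show ?thesis using int_iff[of "ext g"] by simp
  qed
  have R_norm: "norm (R f) = norm f" for f
  proof -
    have "norm (R f) = (LINT x|unit_measure. indicator E x / m * \<bar>ext f (F x)\<bar>)"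
      unfolding R_def norm_abs_L1[OF R_int] using m by (simp add: abs_mult)
    also have "\<dots> = (LINT u|unit_measure. \<bar>ext f (F (G u))\<bar>)"
      by (rule int_eq[symmetric]) simp
    also have "\<dots> = norm f"
      unfolding norm_L1_rep by (rule Bochner_Integration.integral_cong[OF refl]) (simp add: FG ext)
    finally show ?thesis .
  qed
  have U_norm: "norm (U g) \<le> norm g" for g
  proof -
    have "norm (U g) = m * (LINT u|unit_measure. \<bar>ext g (G u)\<bar>)"
      unfolding U_def norm_abs_L1[OF U_int] using m by (simp add: abs_mult)
    also have "(LINT u|unit_measure. \<bar>ext g (G u)\<bar>) = (LINT x|unit_measure. indicator E x / m * \<bar>ext g x\<bar>)"
      by (rule int_eq) simp
    also have "m * \<dots> = (LINT x|unit_measure. indicator E x * \<bar>ext g x\<bar>)"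
      unfolding integral_mult_right_zero[symmetric]
      by (rule Bochner_Integration.integral_cong[OF refl]) (use m in simp)
    also have "\<dots> = norm (restr E g)"
      unfolding norm_restr[OF E] by (rule Bochner_Integration.integral_cong[OF refl]) (simp add: ext)
    finally show ?thesis using norm_restr_le[OF E, of g] by simp
  qed
  have "bounded_linear R"
  proof (rule bounded_linear_intro[where K = 1])
    fix f g :: "real L1" and c :: real
    have "AE x in unit_measure. x \<in> E \<longrightarrow> ext (f + g) (F x) = ext f (F x) + ext g (F x)"
      by (rule AE_F, rule AE_mp[OF rep_L1_ops(1)[of f g] AE_I2]) (simp add: ext)
    then have "AE x in unit_measure. indicator E x / m * ext (f + g) (F x) =
        indicator E x / m * ext f (F x) + indicator E x / m * ext g (F x)"
      by eventually_elim (simp add: indicator_def add_divide_distrib)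
    then show "R (f + g) = R f + R g"
      unfolding R_def L1_ops(1)[OF R_int R_int]
      by (intro abs_L1_eqI R_int Bochner_Integration.integrable_add)
    have "AE x in unit_measure. x \<in> E \<longrightarrow> ext (c *\<^sub>R f) (F x) = c * ext f (F x)"
      by (rule AE_F, rule AE_mp[OF rep_L1_ops(3)[of c f] AE_I2]) (simp add: ext)
    then have "AE x in unit_measure. indicator E x / m * ext (c *\<^sub>R f) (F x) =
        c *\<^sub>R (indicator E x / m * ext f (F x))"
      by eventually_elim (simp add: indicator_def)
    then show "R (c *\<^sub>R f) = c *\<^sub>R R f"
      unfolding R_def scaleR_abs_L1[OF R_int]
      by (intro abs_L1_eqI R_int Bochner_Integration.integrable_scaleR_right)
  qed (simp add: R_norm)
  moreover have "bounded_linear U"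
  proof (rule bounded_linear_intro[where K = 1])
    fix f g :: "real L1" and c :: real
    have "AE u in unit_measure. G u \<in> E \<and> ext (f + g) (G u) = ext f (G u) + ext g (G u)"
      by (rule AE_G, rule AE_mp[OF rep_L1_ops(1)[of f g] AE_I2]) (simp add: ext)
    then have "AE u in unit_measure. m * ext (f + g) (G u) = m * ext f (G u) + m * ext g (G u)"
      by eventually_elim (simp add: algebra_simps)
    then show "U (f + g) = U f + U g"
      unfolding U_def L1_ops(1)[OF U_int U_int]
      by (intro abs_L1_eqI U_int Bochner_Integration.integrable_add)
    have "AE u in unit_measure. G u \<in> E \<and> ext (c *\<^sub>R f) (G u) = c * ext f (G u)"
      by (rule AE_G, rule AE_mp[OF rep_L1_ops(3)[of c f] AE_I2]) (simp add: ext)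
    then have "AE u in unit_measure. m * ext (c *\<^sub>R f) (G u) = c *\<^sub>R (m * ext f (G u))"
      by eventually_elim simp
    then show "U (c *\<^sub>R f) = c *\<^sub>R U f"
      unfolding U_def scaleR_abs_L1[OF U_int]
      by (intro abs_L1_eqI U_int Bochner_Integration.integrable_scaleR_right)
  qed (simp add: U_norm)
  moreover have "U (R f) = f" for f
  proof -
    have "AE u in unit_measure. G u \<in> E \<and> rep_L1 (R f) (G u) = indicator E (G u) / m * ext f (F (G u))"
      by (rule AE_G) (unfold R_def, rule rep_abs_L1[OF R_int])
    then have "AE u in unit_measure. m * ext (R f) (G u) = rep_L1 f u"
      using AE_space[of unit_measure] by eventually_elim (use m FG ext in auto)
    then have "U (R f) = abs_L1 (rep_L1 f)"
      unfolding U_def by (intro abs_L1_eqI U_int rep_L1_integrable)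
    then show ?thesis by (simp add: abs_rep_L1)
  qed
  moreover have "restr E (R f) = R f" for f
  proof (rule L1_eqI)
    have "AE x in unit_measure. rep_L1 (R f) x = indicator E x / m * ext f (F x)"
      unfolding R_def by (rule rep_abs_L1[OF R_int])
    then show "AE x in unit_measure. rep_L1 (restr E (R f)) x = rep_L1 (R f) x"
      using rep_multiply[OF bounded_weight_indicator[OF E], of "R f"]
      unfolding restr_def by eventually_elim (auto simp: indicator_def)
  qed
  ultimately show thesis
    using that[of R U] R_norm U_norm by simp
qed

section \<open>Perturbations of the identity\<close>

text \<open>
  A solution of \<open>A x = y\<close> is a fixed point of the contraction \<open>x \<mapsto> y + x - A x\<close>.
\<close>
lemma near_identity_invertible:
  fixes A :: "'a::banach \<Rightarrow> 'a"
  assumes A: "bounded_linear A" and near: "\<And>x. norm (A x - x) \<le> \<theta> * norm x" and \<theta>: "0 \<le> \<theta>" "\<theta> < 1"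
  obtains B where "bounded_linear B" "\<And>x. B (A x) = x" "\<And>y. norm (B y) \<le> norm y / (1 - \<theta>)"
proof -
  interpret A: bounded_linear A by fact
  have lower: "(1 - \<theta>) * norm x \<le> norm (A x)" for x
    using near[of x] norm_triangle_ineq2[of x "x - A x"] norm_triangle_ineq2[of x "A x"]
    by (simp add: algebra_simps norm_minus_commute)
  have inj: "inj A"
  proof (rule injI)
    fix x y assume "A x = A y"
    then have "(1 - \<theta>) * norm (x - y) \<le> 0" using lower[of "x - y"] by (simp add: A.diff)
    then show "x = y" using \<theta> by (simp add: mult_le_0_iff)
  qed
  have "\<exists>x. A x = y" for y
  proof -
    have "\<exists>!x. y + x - A x = x"
    proof (rule banach_fix_type[OF \<theta>], intro allI)
      fix x x'
      have "(y + x - A x) - (y + x' - A x') = - (A (x - x') - (x - x'))" by (simp add: A.diff)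
      then show "dist (y + x - A x) (y + x' - A x') \<le> \<theta> * dist x x'"
        using near[of "x - x'"] by (simp only: dist_norm norm_minus_cancel)
    qed
    then obtain x where "y + x - A x = x" by blast
    then have "A x = y" by (simp add: algebra_simps)
    then show ?thesis ..
  qed
  then have surj: "A (inv A y) = y" for y by (metis surjI surj_f_inv_f)
  have inv: "inv A (A x) = x" for x using inj by simp
  have bound: "norm (inv A y) \<le> norm y / (1 - \<theta>)" for y
    using lower[of "inv A y"] \<theta> by (simp add: surj pos_le_divide_eq mult.commute)
  have "bounded_linear (inv A)"
  proof (rule bounded_linear_intro[where K = "1 / (1 - \<theta>)"])
    show "inv A (x + y) = inv A x + inv A y" for x y
      by (metis A.add surj inv)
    show "inv A (c *\<^sub>R x) = c *\<^sub>R inv A x" for c x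
      by (metis A.scaleR surj inv)
  qed (use bound in simp)
  then show thesis using that inv bound by blast
qed

section \<open>Descendants of a node\<close>

lemma sum_descendants:
  fixes f :: "nat \<Rightarrow> 'a::comm_monoid_add"
  assumes "N \<le> M"
  shows "sum f {N * 2 ^ d..<M * 2 ^ d} = (\<Sum>i\<in>{N..<M}. \<Sum>j\<in>{i * 2 ^ d..<Suc i * 2 ^ d}. f j)"
  using assms
proof (induction M rule: dec_induct)
  case (step M)
  have "sum f {N * 2 ^ d..<Suc M * 2 ^ d} = sum f {N * 2 ^ d..<M * 2 ^ d} + sum f {M * 2 ^ d..<Suc M * 2 ^ d}"
    using step.hyps by (intro sum.atLeastLessThan_concat[symmetric]) auto
  then show ?case using step by simp
qed simp

lemma sum_level_descendants:
  fixes f :: "nat \<Rightarrow> 'a::comm_monoid_add"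
  shows "sum f (level (n + d)) = (\<Sum>i\<in>level n. \<Sum>j\<in>{i * 2 ^ d..<Suc i * 2 ^ d}. f j)"
  using sum_descendants[of "2 ^ n" "2 * 2 ^ n" f d] by (simp add: power_add mult.assoc)

lemma sum_level_children:
  fixes f :: "nat \<Rightarrow> 'a::comm_monoid_add"
  shows "sum f (level (Suc n)) = (\<Sum>i\<in>level n. f (2 * i) + f (Suc (2 * i)))"
  using sum_children[of "2 ^ n" "2 * 2 ^ n" f] by simp

lemma descendant_div: "j \<in> {i * 2 ^ d..<Suc i * 2 ^ d} \<Longrightarrow> j div 2 ^ d = i"
  by (intro div_nat_eqI) (simp_all add: mult.commute)

lemma step_descendants:
  assumes "i \<ge> 1"
  shows "step i c = (\<Sum>j\<in>{i * 2 ^ d..<Suc i * 2 ^ d}. step j c)"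
proof (induction d)
  case (Suc d)
  have "(\<Sum>j\<in>{i * 2 ^ Suc d..<Suc i * 2 ^ Suc d}. step j c) =
      (\<Sum>j\<in>{i * 2 ^ d..<Suc i * 2 ^ d}. step (2 * j) c + step (Suc (2 * j)) c)"
    using sum_children[of "i * 2 ^ d" "Suc i * 2 ^ d" "\<lambda>j. step j c"] by (simp add: mult_ac)
  also have "\<dots> = (\<Sum>j\<in>{i * 2 ^ d..<Suc i * 2 ^ d}. step j c)"
  proof (rule sum.cong[OF refl])
    fix j assume "j \<in> {i * 2 ^ d..<Suc i * 2 ^ d}"
    moreover have "1 \<le> i * 2 ^ d" using assms by simp
    ultimately have "j \<ge> 1" by (meson atLeastLessThan_iff order_trans)
    then show "step (2 * j) c + step (Suc (2 * j)) c = step j c" by (rule step_children[symmetric])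
  qed
  finally show ?case using Suc by simp
qed simp

lemma level_ancestor: "j \<in> level (n + d) \<Longrightarrow> j div 2 ^ d \<in> level n"
proof -
  assume "j \<in> level (n + d)"
  then have "2 ^ n * 2 ^ d \<le> j" "j < 2 * 2 ^ n * 2 ^ d" by (simp_all add: power_add mult.assoc)
  then show ?thesis by (simp add: less_eq_div_iff_mult_less_eq div_less_iff_less_mult)
qed

lemma node_ancestor_subset:
  assumes "j \<in> level (n + d)"
  shows "node j \<subseteq> node (j div 2 ^ d)"
  using assms
proof (induction d arbitrary: j)
  case (Suc d)
  have "node j \<subseteq> node (j div 2)"
    using level_ge_1[OF level_parent[of j "n + d"]] Suc.prems by (intro node_parent_subset) auto
  also have "\<dots> \<subseteq> node (j div 2 div 2 ^ d)"
    using level_parent[of j "n + d"] Suc.prems by (intro Suc.IH) simp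
  also have "j div 2 div 2 ^ d = j div 2 ^ Suc d" by (simp add: div_mult2_eq)
  finally show ?case .
qed simp

lemma level_disjoint:
  assumes "i \<in> level n" "j \<in> level n" "i \<noteq> j"
  shows "node i \<inter> node j = {}"
  using nodes_disjoint[of i "2 ^ n" j] assms by simp

section \<open>The diagonal part of an operator on \<open>L\<^sup>1\<close>\<close>

definition diagonal :: "(real L1 \<Rightarrow> real L1) \<Rightarrow> nat \<Rightarrow> real L1" where
  "diagonal T m = (\<Sum>j\<in>level m. restr (node j) (T (step j 1)))"

text \<open>
  For the nodes \<open>j\<close> of level \<open>n + d\<close>, the mass that \<open>T\<close> moves from node \<open>j\<close> to the rest of its ancestor of
  level \<open>n\<close>.
\<close>
definition off_diagonal :: "(real L1 \<Rightarrow> real L1) \<Rightarrow> nat \<Rightarrow> nat \<Rightarrow> real" where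
  "off_diagonal T n d =
     (\<Sum>j\<in>level (n + d). norm (restr (node (j div 2 ^ d) - node j) (T (step j 1))))"

definition outer_mass :: "(real L1 \<Rightarrow> real L1) \<Rightarrow> nat \<Rightarrow> real" where
  "outer_mass T m = (\<Sum>j\<in>level m. norm (restr (node 1 - node j) (T (step j 1))))"

text \<open>
  Mass that leaves node \<open>j\<close> either stays in the ancestor of level \<open>n\<close> or leaves it; by the triangle
  inequality the second part, summed over the descendants of a node \<open>i\<close> of level \<open>n\<close>, is at least
  what leaves node \<open>i\<close>.
\<close>
lemma outer_mass_split:
  assumes T: "bounded_linear T"
  shows "outer_mass T n + off_diagonal T n d \<le> outer_mass T (n + d)"
proof -
  let ?t = "\<lambda>j. T (step j 1)"
  have "outer_mass T n \<le> (\<Sum>i\<in>level n. \<Sum>j\<in>{i * 2 ^ d..<Suc i * 2 ^ d}. norm (restr (node 1 - node (j div 2 ^ d)) (?t j)))"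
    unfolding outer_mass_def
  proof (rule sum_mono)
    fix i assume i: "i \<in> level n"
    have "norm (restr (node 1 - node i) (?t i)) =
        norm (\<Sum>j\<in>{i * 2 ^ d..<Suc i * 2 ^ d}. restr (node 1 - node i) (?t j))"
      unfolding step_descendants[OF level_ge_1[OF i], of 1 d]
      by (simp add: linear_sum[OF bounded_linear.linear[OF T]] restr_sum)
    also have "\<dots> \<le> (\<Sum>j\<in>{i * 2 ^ d..<Suc i * 2 ^ d}. norm (restr (node 1 - node i) (?t j)))"
      by (rule norm_sum)
    also have "\<dots> = (\<Sum>j\<in>{i * 2 ^ d..<Suc i * 2 ^ d}. norm (restr (node 1 - node (j div 2 ^ d)) (?t j)))"
      by (intro sum.cong refl) (simp only: descendant_div)
    finally show "norm (restr (node 1 - node i) (?t i)) \<le>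
        (\<Sum>j\<in>{i * 2 ^ d..<Suc i * 2 ^ d}. norm (restr (node 1 - node (j div 2 ^ d)) (?t j)))" .
  qed
  also have "\<dots> = (\<Sum>j\<in>level (n + d). norm (restr (node 1 - node (j div 2 ^ d)) (?t j)))"
    by (rule sum_level_descendants[symmetric])
  finally have "outer_mass T n + off_diagonal T n d \<le>
      (\<Sum>j\<in>level (n + d). norm (restr (node 1 - node (j div 2 ^ d)) (?t j)) +
        norm (restr (node (j div 2 ^ d) - node j) (?t j)))"
    by (simp add: off_diagonal_def sum.distrib)
  also have "\<dots> = outer_mass T (n + d)"
    unfolding outer_mass_def
  proof (rule sum.cong[OF refl])
    fix j assume j: "j \<in> level (n + d)"
    have "node j \<subseteq> node (j div 2 ^ d)" by (rule node_ancestor_subset[OF j])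
    moreover have "node (j div 2 ^ d) \<subseteq> node 1"
      using node_subset_unit[OF level_ge_1[OF level_ancestor[OF j]]] by (simp only: node_1)
    ultimately have "node 1 - node j = (node 1 - node (j div 2 ^ d)) \<union> (node (j div 2 ^ d) - node j)"
      "(node 1 - node (j div 2 ^ d)) \<inter> (node (j div 2 ^ d) - node j) = {}" by auto
    then show "norm (restr (node 1 - node (j div 2 ^ d)) (?t j)) + norm (restr (node (j div 2 ^ d) - node j) (?t j)) =
        norm (restr (node 1 - node j) (?t j))"
      using norm_restr_Un[of "node 1 - node (j div 2 ^ d)" "node (j div 2 ^ d) - node j" "?t j"] by simp
  qed
  finally show ?thesis .
qed

lemma outer_mass_le:
  assumes C: "\<And>f. norm (T f) \<le> norm f * C"
  shows "outer_mass T m \<le> C"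
proof -
  have "outer_mass T m \<le> (\<Sum>j\<in>level m. C / 2 ^ m)"
    unfolding outer_mass_def
  proof (rule sum_mono)
    fix j assume j: "j \<in> level m"
    have "norm (restr (node 1 - node j) (T (step j 1))) \<le> norm (T (step j 1))"
      by (rule norm_restr_le) auto
    also have "\<dots> \<le> C / 2 ^ m"
      using C[of "step j 1"] by (simp add: norm_step[OF level_ge_1[OF j]] node_length_level[OF j])
    finally show "norm (restr (node 1 - node j) (T (step j 1))) \<le> C / 2 ^ m" .
  qed
  also have "\<dots> = C" by simp
  finally show ?thesis .
qed

text \<open>
  The outer masses increase and are bounded by the norm of \<open>T\<close>, so they converge, and the
  off-diagonal mass is bounded by their increments.
\<close>
lemma off_diagonal_vanishes:
  assumes T: "bounded_linear T"
  obtains \<eta> where "\<eta> \<longlonglongrightarrow> 0" "decseq \<eta>" "\<And>n d. off_diagonal T n d \<le> \<eta> n"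
proof -
  obtain C where C: "\<And>f. norm (T f) \<le> norm f * C"
    using bounded_linear.bounded[OF T] by blast
  have nonneg: "off_diagonal T n d \<ge> 0" for n d
    unfolding off_diagonal_def by (intro sum_nonneg) simp
  have inc: "incseq (outer_mass T)"
  proof (rule incseq_SucI)
    fix n
    show "outer_mass T n \<le> outer_mass T (Suc n)"
      using outer_mass_split[OF T, of n 1] nonneg[of n 1] by simp
  qed
  obtain L where L: "outer_mass T \<longlonglongrightarrow> L" "\<And>n. outer_mass T n \<le> L"
    using incseq_convergent[OF inc, of C] outer_mass_le[of T, OF C] by blast
  show thesis
  proof (rule that)
    show "(\<lambda>n. L - outer_mass T n) \<longlonglongrightarrow> 0"
      using tendsto_diff[OF tendsto_const L(1), of L] by simp
    show "decseq (\<lambda>n. L - outer_mass T n)"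
      using inc by (simp add: decseq_def incseq_def)
    show "off_diagonal T n d \<le> L - outer_mass T n" for n d
      using outer_mass_split[OF T, of n d] L(2)[of "n + d"] by simp
  qed
qed

text \<open>
  Splitting each indicator of level \<open>n\<close> into its descendants turns the difference into terms
  supported off the diagonal.
\<close>
lemma diagonal_diff_le:
  assumes T: "bounded_linear T"
  shows "norm (diagonal T n - diagonal T (n + d)) \<le> off_diagonal T n d"
proof -
  let ?t = "\<lambda>j. T (step j 1)"
  have "diagonal T n = (\<Sum>i\<in>level n. \<Sum>j\<in>{i * 2 ^ d..<Suc i * 2 ^ d}. restr (node (j div 2 ^ d)) (?t j))"
    unfolding diagonal_def
  proof (rule sum.cong[OF refl])
    fix i assume i: "i \<in> level n"
    have "restr (node i) (?t i) = (\<Sum>j\<in>{i * 2 ^ d..<Suc i * 2 ^ d}. restr (node i) (?t j))"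
      unfolding step_descendants[OF level_ge_1[OF i], of 1 d]
      by (simp add: linear_sum[OF bounded_linear.linear[OF T]] restr_sum)
    also have "\<dots> = (\<Sum>j\<in>{i * 2 ^ d..<Suc i * 2 ^ d}. restr (node (j div 2 ^ d)) (?t j))"
      by (intro sum.cong refl) (simp only: descendant_div)
    finally show "restr (node i) (?t i) = (\<Sum>j\<in>{i * 2 ^ d..<Suc i * 2 ^ d}. restr (node (j div 2 ^ d)) (?t j))" .
  qed
  also have "\<dots> = (\<Sum>j\<in>level (n + d). restr (node (j div 2 ^ d)) (?t j))"
    by (rule sum_level_descendants[symmetric])
  finally have "diagonal T n - diagonal T (n + d) =
      (\<Sum>j\<in>level (n + d). restr (node (j div 2 ^ d)) (?t j) - restr (node j) (?t j))"
    by (simp add: diagonal_def[of T "n + d"] sum_subtractf)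
  also have "\<dots> = (\<Sum>j\<in>level (n + d). restr (node (j div 2 ^ d) - node j) (?t j))"
    by (intro sum.cong refl restr_diff[symmetric] node_ancestor_subset) auto
  finally show ?thesis
    unfolding off_diagonal_def by (simp only: norm_sum)
qed

lemma restr_diagonal:
  assumes "j \<in> level m"
  shows "restr (node j) (diagonal T m) = restr (node j) (T (step j 1))"
proof -
  have "restr (node j) (diagonal T m) = (\<Sum>i\<in>level m. if i = j then restr (node j) (T (step j 1)) else 0)"
    unfolding diagonal_def restr_sum[OF node_borel]
  proof (intro sum.cong refl)
    fix i assume i: "i \<in> level m"
    show "restr (node j) (restr (node i) (T (step i 1))) = (if i = j then restr (node j) (T (step j 1)) else 0)"
      using level_disjoint[OF assms i] by (auto simp: restr_restr)
  qed
  then show ?thesis using assms by simp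
qed

lemma diagonal_limit:
  assumes T: "bounded_linear T" and \<eta>: "\<eta> \<longlonglongrightarrow> 0" "decseq \<eta>" "\<And>n d. off_diagonal T n d \<le> \<eta> n"
  obtains a where "\<And>n. norm (diagonal T n - a) \<le> \<eta> n"
proof -
  have diff: "norm (diagonal T n - diagonal T m) \<le> \<eta> n" if "m \<ge> n" for n m
    using diagonal_diff_le[OF T, of n "m - n"] \<eta>(3)[of n "m - n"] that by simp
  have "Cauchy (diagonal T)"
  proof (rule CauchyI)
    fix e :: real assume "e > 0"
    then obtain N where N: "\<eta> N < e / 2"
      using order_tendstoD(2)[OF \<eta>(1), of "e / 2"] by (auto simp: eventually_sequentially)
    have "norm (diagonal T i - diagonal T j) < e" if "i \<ge> N" "j \<ge> N" for i j
      using diff[OF that(1)] diff[OF that(2)] N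
        norm_triangle_ineq4[of "diagonal T N - diagonal T j" "diagonal T N - diagonal T i"] by simp
    then show "\<exists>M. \<forall>i\<ge>M. \<forall>j\<ge>M. norm (diagonal T i - diagonal T j) < e" by blast
  qed
  then obtain a where a: "diagonal T \<longlonglongrightarrow> a"
    by (auto simp: Cauchy_convergent_iff convergent_def)
  have "norm (diagonal T n - a) \<le> \<eta> n" for n
    by (rule LIMSEQ_le_const2[OF tendsto_norm[OF tendsto_diff[OF tendsto_const a]]]) (use diff in blast)
  then show thesis by (rule that)
qed

text \<open>
  This is \<open>h\<^sub>I \<otimes> h\<^sub>J\<close> carried to the interval, where the square \<open>I \<times> J\<close> corresponds to node \<open>w\<close>.
\<close>
definition quad :: "nat \<Rightarrow> real L1" where
  "quad w = step (4 * w) 1 - step (Suc (4 * w)) 1 - step (4 * w + 2) 1 + step (4 * w + 3) 1"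

definition quad_integral :: "nat \<Rightarrow> real L1 \<Rightarrow> real" where
  "quad_integral w F = node_integral (4 * w) F - node_integral (Suc (4 * w)) F
     - node_integral (4 * w + 2) F + node_integral (4 * w + 3) F"

lemma norm_restr_grandchildren:
  assumes "w \<ge> 1"
  shows "norm (restr (node w) F) = norm (restr (node (4 * w)) F) + norm (restr (node (Suc (4 * w))) F)
    + norm (restr (node (4 * w + 2)) F) + norm (restr (node (4 * w + 3)) F)"
proof -
  have split: "norm (restr (node k) F) = norm (restr (node (2 * k)) F) + norm (restr (node (Suc (2 * k))) F)"
    if "k \<ge> 1" for k
    using norm_restr_Un[of "node (2 * k)" "node (Suc (2 * k))" F] node_children[OF that] by simp
  show ?thesis
    using split[of w] split[of "2 * w"] split[of "Suc (2 * w)"] assms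
    by (simp add: numeral_3_eq_3)
qed

text \<open>
  In the expansion over the four grandchildren the diagonal terms carry the sign \<open>1 = (\<plusminus>1)\<^sup>2\<close> and add up
  to the integral of the diagonal part; the twelve cross terms are off-diagonal mass.
\<close>
lemma quad_near_diagonal:
  assumes T: "bounded_linear T" and w: "w \<in> level m"
  shows "\<bar>quad_integral w (T (quad w)) - node_integral w (diagonal T (m + 2))\<bar> \<le>
    (\<Sum>j\<in>{w * 2 ^ 2..<Suc w * 2 ^ 2}. norm (restr (node (j div 2 ^ 2) - node j) (T (step j 1))))"
proof -
  have w1: "w \<ge> 1" by (rule level_ge_1[OF w])
  let ?t = "\<lambda>j. T (step j 1)" and ?p = node_integral
  let ?a = "4 * w" and ?b = "Suc (4 * w)" and ?c = "4 * w + 2" and ?d = "4 * w + 3"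
  have set: "{w * 2 ^ 2..<Suc w * 2 ^ 2} = {?a, ?b, ?c, ?d}" by auto
  have lev: "j \<in> level (m + 2)" "node j \<subseteq> node w" "j div 2 ^ 2 = w" if "j \<in> {?a, ?b, ?c, ?d}" for j
  proof -
    show lev: "j \<in> level (m + 2)" using that w by (auto simp: power_add)
    show "j div 2 ^ 2 = w" using that by (intro descendant_div) (simp only: set)
    then show "node j \<subseteq> node w" using node_ancestor_subset[OF lev] by simp
  qed
  have D: "?p j (diagonal T (m + 2)) = ?p j (?t j)" if "j \<in> {?a, ?b, ?c, ?d}" for j
    using restr_diagonal[OF lev(1)[OF that], of T] node_integral_restr_node by metis
  have off: "norm (restr (node (j div 2 ^ 2) - node j) F) = norm (restr (node w) F) - norm (restr (node j) F)"
    if "j \<in> {?a, ?b, ?c, ?d}" for j F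
    using lev[OF that] by (simp add: norm_restr_Diff)
  note lin = linear_add[OF bounded_linear.linear] linear_diff[OF bounded_linear.linear]
  note linT = lin[OF T] and linp = lin[OF bounded_linear_node_integral]
  let ?q = "quad_integral w" and ?o = "\<lambda>j F. norm (restr (node (j div 2 ^ 2) - node j) F)"
  have bound: "\<bar>?q F - ?p ?a F\<bar> \<le> ?o ?a F" "\<bar>?q F + ?p ?b F\<bar> \<le> ?o ?b F"
    "\<bar>?q F + ?p ?c F\<bar> \<le> ?o ?c F" "\<bar>?q F - ?p ?d F\<bar> \<le> ?o ?d F" for F
  proof -
    have o: "?o ?a F = norm (restr (node w) F) - norm (restr (node ?a) F)"
      "?o ?b F = norm (restr (node w) F) - norm (restr (node ?b) F)"
      "?o ?c F = norm (restr (node w) F) - norm (restr (node ?c) F)"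
      "?o ?d F = norm (restr (node w) F) - norm (restr (node ?d) F)"
      by (rule off; simp)+
    show "\<bar>?q F - ?p ?a F\<bar> \<le> ?o ?a F" "\<bar>?q F + ?p ?b F\<bar> \<le> ?o ?b F"
      "\<bar>?q F + ?p ?c F\<bar> \<le> ?o ?c F" "\<bar>?q F - ?p ?d F\<bar> \<le> ?o ?d F"
      unfolding o norm_restr_grandchildren[OF w1] quad_integral_def
      using abs_node_integral_le[of ?a F] abs_node_integral_le[of ?b F] abs_node_integral_le[of ?c F]
        abs_node_integral_le[of ?d F] by linarith+
  qed
  have D': "?p w (diagonal T (m + 2)) = ?p ?a (?t ?a) + ?p ?b (?t ?b) + ?p ?c (?t ?c) + ?p ?d (?t ?d)"
    unfolding node_integral_grandchildren[OF w1] by (simp only: D insertI1 insertI2)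
  have q: "?q (T (quad w)) = ?q (?t ?a) - ?q (?t ?b) - ?q (?t ?c) + ?q (?t ?d)"
    unfolding quad_integral_def quad_def linT linp by simp
  have sum: "(\<Sum>j\<in>{w * 2 ^ 2..<Suc w * 2 ^ 2}. ?o j (?t j)) =
      ?o ?a (?t ?a) + ?o ?b (?t ?b) + ?o ?c (?t ?c) + ?o ?d (?t ?d)"
    unfolding set by simp
  show ?thesis
    unfolding D' q sum
    using bound(1)[of "?t ?a"] bound(2)[of "?t ?b"] bound(3)[of "?t ?c"] bound(4)[of "?t ?d"]
    by linarith
qed

text \<open>
  The positive part of \<open>\<delta> - \<bar>a\<bar>\<close> is dominated by \<open>\<bar>g n - a\<bar>\<close>.
\<close>
lemma AE_abs_ge_of_L1_limit:
  assumes lim: "g \<longlonglongrightarrow> (a :: real L1)" and ge: "\<And>n. AE x in unit_measure. \<delta> \<le> \<bar>rep_L1 (g n) x\<bar>"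
  shows "AE x in unit_measure. \<delta> \<le> \<bar>rep_L1 a x\<bar>"
proof -
  let ?h = "\<lambda>x. max 0 (\<delta> - \<bar>rep_L1 a x\<bar>)"
  have int: "L1_integrable ?h"
    using rep_L1_integrable[of a] by (intro integrable_max Bochner_Integration.integrable_diff integrable_abs) auto
  have "(LINT x|unit_measure. ?h x) \<le> norm (g n - a)" for n
    unfolding norm_L1_rep
  proof (rule integral_mono_AE[OF int integrable_norm[OF rep_L1_integrable]])
    show "AE x in unit_measure. ?h x \<le> norm (rep_L1 (g n - a) x)"
      using rep_L1_ops(2)[of "g n" a] ge[of n] by eventually_elim auto
  qed
  moreover have "(\<lambda>n. norm (g n - a)) \<longlonglongrightarrow> 0"
    using lim by (simp add: LIM_zero_iff tendsto_norm_zero_iff)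
  ultimately have "(LINT x|unit_measure. ?h x) \<le> 0"
    by (intro LIMSEQ_le_const) auto
  moreover have "(LINT x|unit_measure. ?h x) \<ge> 0" by (intro Bochner_Integration.integral_nonneg) simp
  ultimately have "AE x in unit_measure. ?h x = 0"
    using integral_nonneg_eq_0_iff_AE[OF int] by simp
  then show ?thesis by eventually_elim auto
qed

text \<open>
  The step function \<open>g l\<close> below, whose values are the normalized diagonal entries, has modulus at
  least \<open>\<delta>\<close> and converges to \<open>a\<close>.  The entries may have varying signs: convergence in \<open>L\<^sup>1\<close> takes
  care of them.
\<close>
lemma diagonal_limit_large:
  assumes T: "bounded_linear T" and \<eta>: "\<eta> \<longlonglongrightarrow> 0" "decseq \<eta>" "\<And>n d. off_diagonal T n d \<le> \<eta> n"
    and a: "\<And>n. norm (diagonal T n - a) \<le> \<eta> n"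
    and large: "\<And>l w. w \<in> level (2 * l) \<Longrightarrow> \<delta> / 4 ^ l \<le> \<bar>quad_integral w (T (quad w))\<bar>"
  shows "AE x in unit_measure. \<delta> \<le> \<bar>rep_L1 a x\<bar>"
proof -
  define g where "g l = (\<Sum>w\<in>level (2 * l). step w (4 ^ l * quad_integral w (T (quad w))))" for l
  have "AE x in unit_measure. \<delta> \<le> \<bar>rep_L1 (g l) x\<bar>" for l
  proof -
    let ?f = "\<lambda>x. \<Sum>w\<in>level (2 * l). indicator (node w) x *\<^sub>R (4 ^ l * quad_integral w (T (quad w)))"
    have g: "g l = abs_L1 ?f"
      unfolding g_def step_def by (intro sum_abs_L1 L1_integrable_indicator) simp_all
    have "L1_integrable ?f" by (intro Bochner_Integration.integrable_sum L1_integrable_indicator) simp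
    then have "AE x in unit_measure. rep_L1 (g l) x = ?f x"
      unfolding g by (rule rep_abs_L1)
    then show ?thesis
      using AE_space
    proof eventually_elim
      case (elim x)
      then obtain w where w: "w \<in> level (2 * l)" "x \<in> node w"
        using node_exists[of "2 ^ (2 * l)" x] by auto
      then have "rep_L1 (g l) x = 4 ^ l * quad_integral w (T (quad w))"
        using elim(1) sum_over_nodes[OF w] by simp
      then show ?case using large[OF w(1)] by (simp add: abs_mult field_simps)
    qed
  qed
  moreover have "g \<longlonglongrightarrow> a"
  proof -
    have near: "norm (g l - average (2 ^ (2 * l)) a) \<le> \<eta> (2 * l) + \<eta> (2 * l)" for l
    proof -
      let ?D = "diagonal T (2 * l + 2)" and ?q = "\<lambda>w. quad_integral w (T (quad w))"
      have "g l - average (2 ^ (2 * l)) a = (\<Sum>w\<in>level (2 * l). step w (4 ^ l * (?q w - node_integral w a)))"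
        unfolding g_def average_def sum_subtractf[symmetric]
      proof (intro sum.cong refl)
        fix w assume w: "w \<in> level (2 * l)"
        have len: "node_length w = 1 / 4 ^ l"
          using node_length_level[OF w] by (simp add: power_mult)
        show "step w (4 ^ l * ?q w) - step w (node_integral w a / node_length w) =
            step w (4 ^ l * (?q w - node_integral w a))"
          unfolding linear_diff[OF bounded_linear.linear[OF bounded_linear_step[OF level_ge_1[OF w]]], symmetric] len
          by (simp add: algebra_simps)
      qed
      also have "norm \<dots> = (\<Sum>w\<in>level (2 * l). \<bar>?q w - node_integral w a\<bar>)"
        by (subst norm_sum_step) (auto simp: node_length_level[of _ "2 * l"] abs_mult power_mult)
      also have "\<dots> \<le> (\<Sum>w\<in>level (2 * l). \<bar>?q w - node_integral w ?D\<bar> + \<bar>node_integral w (?D - a)\<bar>)"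
        by (intro sum_mono) (simp add: linear_diff[OF bounded_linear.linear[OF bounded_linear_node_integral]])
      also have "\<dots> \<le> off_diagonal T (2 * l) 2 + norm (?D - a)"
        unfolding sum.distrib
      proof (rule add_mono)
        show "(\<Sum>w\<in>level (2 * l). \<bar>?q w - node_integral w ?D\<bar>) \<le> off_diagonal T (2 * l) 2"
          unfolding off_diagonal_def sum_level_descendants
          by (intro sum_mono quad_near_diagonal[OF T])
        show "(\<Sum>w\<in>level (2 * l). \<bar>node_integral w (?D - a)\<bar>) \<le> norm (?D - a)"
          by (rule sum_node_integral_le) simp
      qed
      also have "\<dots> \<le> \<eta> (2 * l) + \<eta> (2 * l)"
        using \<eta>(3)[of "2 * l" 2] a[of "2 * l + 2"] decseqD[OF \<eta>(2), of "2 * l" "2 * l + 2"] by linarith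
      finally show ?thesis .
    qed
    have "(\<lambda>l. \<eta> (2 * l) + \<eta> (2 * l)) \<longlonglongrightarrow> 0 + 0"
      using LIMSEQ_subseq_LIMSEQ[OF \<eta>(1), of "\<lambda>l. 2 * l"] by (intro tendsto_add) (simp_all add: strict_mono_def o_def)
    then have "(\<lambda>l. g l - average (2 ^ (2 * l)) a) \<longlonglongrightarrow> 0"
      unfolding add_0 by (rule Lim_null_comparison[OF always_eventually[OF allI[OF near]]])
    moreover have "(\<lambda>l. average (2 ^ (2 * l)) a) \<longlonglongrightarrow> a"
      using LIMSEQ_subseq_LIMSEQ[OF average_tendsto, of "\<lambda>l. 2 * l"] by (simp add: strict_mono_def o_def)
    ultimately show ?thesis
      using tendsto_add[of "\<lambda>l. g l - average (2 ^ (2 * l)) a" 0 sequentially "\<lambda>l. average (2 ^ (2 * l)) a" a] by simp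
  qed
  ultimately show ?thesis by (rule AE_abs_ge_of_L1_limit[rotated])
qed

section \<open>A set on which the off-diagonal part is small\<close>

text \<open>
  A node is bad if the error is too large at the node itself or at one of its ancestors of level
  at least \<open>n\<close>.
\<close>
primrec bad_nodes :: "(nat \<Rightarrow> nat \<Rightarrow> real) \<Rightarrow> real \<Rightarrow> nat \<Rightarrow> nat \<Rightarrow> nat set" where
  "bad_nodes \<omega> e n 0 = {j \<in> level n. e * node_length j < \<omega> 0 j}"
| "bad_nodes \<omega> e n (Suc d) =
    {j \<in> level (Suc (n + d)). j div 2 \<in> bad_nodes \<omega> e n d \<or> e * node_length j < \<omega> (Suc d) j}"

lemma bad_nodes_level: "bad_nodes \<omega> e n d \<subseteq> level (n + d)"
  by (induction d) auto

text \<open>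
  At a node where the error first becomes too large the estimate holds by definition, and
  subadditivity of the error hands it down to all descendants.
\<close>
lemma sum_bad_nodes_le:
  assumes subadd: "\<And>d j. j \<in> level (n + d) \<Longrightarrow> \<omega> d j \<le> \<omega> (Suc d) (2 * j) + \<omega> (Suc d) (Suc (2 * j))"
  shows "(\<Sum>j\<in>bad_nodes \<omega> e n d. e * node_length j) \<le> (\<Sum>j\<in>bad_nodes \<omega> e n d. \<omega> d j)"
proof (induction d)
  case 0
  show ?case by (rule sum_mono) auto
next
  case (Suc d)
  let ?B = "bad_nodes \<omega> e n d"
  let ?old = "{j \<in> level (Suc (n + d)). j div 2 \<in> ?B}"
  let ?new = "{j \<in> level (Suc (n + d)). j div 2 \<notin> ?B \<and> e * node_length j < \<omega> (Suc d) j}"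
  have split: "bad_nodes \<omega> e n (Suc d) = ?old \<union> ?new" "?old \<inter> ?new = {}" by auto
  have fin: "finite ?old" "finite ?new" by auto
  have old: "sum f ?old = (\<Sum>i\<in>?B. f (2 * i) + f (Suc (2 * i)))" for f :: "nat \<Rightarrow> real"
  proof -
    have "sum f ?old = (\<Sum>j\<in>level (Suc (n + d)). if j div 2 \<in> ?B then f j else 0)"
      by (rule sum.inter_filter) simp
    also have "\<dots> = (\<Sum>i\<in>level (n + d). if i \<in> ?B then f (2 * i) + f (Suc (2 * i)) else 0)"
      unfolding sum_level_children by (intro sum.cong refl) auto
    also have "\<dots> = (\<Sum>i\<in>{i \<in> level (n + d). i \<in> ?B}. f (2 * i) + f (Suc (2 * i)))"
      by (rule sum.inter_filter[symmetric]) simp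
    also have "{i \<in> level (n + d). i \<in> ?B} = ?B" using bad_nodes_level[of \<omega> e n d] by blast
    finally show ?thesis .
  qed
  have "(\<Sum>j\<in>?old. e * node_length j) = (\<Sum>i\<in>?B. e * node_length i)"
    unfolding old
  proof (rule sum.cong[OF refl])
    fix i assume "i \<in> ?B"
    then have "i \<ge> 1" using bad_nodes_level[of \<omega> e n d] level_ge_1 by blast
    then show "e * node_length (2 * i) + e * node_length (Suc (2 * i)) = e * node_length i"
      by (simp add: node_length_children)
  qed
  also have "\<dots> \<le> (\<Sum>i\<in>?B. \<omega> d i)" by (rule Suc)
  also have "\<dots> \<le> (\<Sum>j\<in>?old. \<omega> (Suc d) j)"
    unfolding old by (intro sum_mono subadd) (use bad_nodes_level[of \<omega> e n d] in blast)
  finally have "(\<Sum>j\<in>?old. e * node_length j) \<le> (\<Sum>j\<in>?old. \<omega> (Suc d) j)" .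
  moreover have "(\<Sum>j\<in>?new. e * node_length j) \<le> (\<Sum>j\<in>?new. \<omega> (Suc d) j)"
    by (rule sum_mono) auto
  ultimately show ?case
    unfolding split(1) by (simp only: sum.union_disjoint[OF fin split(2)] add_mono)
qed

text \<open>
  The bad nodes of each level have total length at most \<open>c / e < 1\<close>, and their unions increase with
  the level.  What remains has positive measure, and so has its part in some node \<open>Q\<close> of level \<open>n\<close>.
\<close>
lemma good_set:
  fixes \<omega> :: "nat \<Rightarrow> nat \<Rightarrow> real"
  assumes subadd: "\<And>d j. j \<in> level (n + d) \<Longrightarrow> \<omega> d j \<le> \<omega> (Suc d) (2 * j) + \<omega> (Suc d) (Suc (2 * j))"
    and nonneg: "\<And>d j. 0 \<le> \<omega> d j"
    and total: "\<And>d. (\<Sum>j\<in>level (n + d). \<omega> d j) \<le> c" and "c < e" "0 < e"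
  obtains E Q where "E \<in> sets borel" "Q \<in> level n" "E \<subseteq> node Q" "measure lborel E > 0"
    "\<And>d j. j \<in> level (n + d) \<Longrightarrow> node j \<inter> E \<noteq> {} \<Longrightarrow> j div 2 ^ d = Q \<and> \<omega> d j \<le> e * node_length j"
proof -
  interpret finite_measure unit_measure by (rule finite_unit_measure)
  let ?\<mu> = "measure unit_measure"
  define B where "B d = (\<Union>j\<in>bad_nodes \<omega> e n d. node j)" for d
  have lev: "j \<in> level (n + d)" if "j \<in> bad_nodes \<omega> e n d" for j d
    using that bad_nodes_level[of \<omega> e n d] by blast
  have fin: "finite (bad_nodes \<omega> e n d)" for d
    by (rule finite_subset[OF bad_nodes_level]) simp
  have node_sets: "node j \<in> sets unit_measure" if "j \<ge> 1" for j
    using node_subset_unit[OF that] by (simp add: sets_unit)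
  have bad_sets: "node j \<in> sets unit_measure" if "j \<in> bad_nodes \<omega> e n d" for j d
    by (rule node_sets[OF level_ge_1[OF lev[OF that]]])
  have B_sets: "B d \<in> sets unit_measure" for d
    unfolding B_def by (rule sets.finite_UN[OF fin bad_sets])
  have B_small: "?\<mu> (B d) \<le> c / e" for d
  proof -
    have "?\<mu> (B d) \<le> (\<Sum>j\<in>bad_nodes \<omega> e n d. ?\<mu> (node j))"
      unfolding B_def by (intro finite_measure_subadditive_finite fin image_subsetI bad_sets)
    also have "\<dots> = (\<Sum>j\<in>bad_nodes \<omega> e n d. node_length j)"
      by (intro sum.cong refl measure_node level_ge_1[OF lev])
    finally have "e * ?\<mu> (B d) \<le> (\<Sum>j\<in>bad_nodes \<omega> e n d. e * node_length j)"
      using \<open>0 < e\<close> by (simp add: sum_distrib_left[symmetric])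
    also have "\<dots> \<le> (\<Sum>j\<in>bad_nodes \<omega> e n d. \<omega> d j)" by (rule sum_bad_nodes_le[of n \<omega>, OF subadd])
    also have "\<dots> \<le> (\<Sum>j\<in>level (n + d). \<omega> d j)"
      using bad_nodes_level nonneg by (intro sum_mono2) auto
    also have "\<dots> \<le> c" by (rule total)
    finally show ?thesis using \<open>0 < e\<close> by (simp add: field_simps)
  qed
  have "incseq B"
  proof (rule incseq_SucI)
    fix d
    show "B d \<subseteq> B (Suc d)"
      unfolding B_def
    proof (rule UN_least)
      fix j assume j: "j \<in> bad_nodes \<omega> e n d"
      then have "2 * j \<in> bad_nodes \<omega> e n (Suc d)" "Suc (2 * j) \<in> bad_nodes \<omega> e n (Suc d)"
        using level_children[OF lev[OF j]] by simp_all
      then show "node j \<subseteq> (\<Union>j\<in>bad_nodes \<omega> e n (Suc d). node j)"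
        using node_children(1)[OF level_ge_1[OF lev[OF j]]] by blast
    qed
  qed
  then have "(\<lambda>d. ?\<mu> (B d)) \<longlonglongrightarrow> ?\<mu> (\<Union>d. B d)"
    using B_sets by (intro finite_Lim_measure_incseq) auto
  then have B_union: "?\<mu> (\<Union>d. B d) \<le> c / e"
    by (rule LIMSEQ_le_const2) (use B_small in blast)
  define E0 where "E0 = {0..<1} - (\<Union>d. B d)"
  have E0_sets: "E0 \<in> sets unit_measure"
    using B_sets sets.top[of unit_measure] unfolding E0_def by (intro sets.Diff) auto
  have "?\<mu> E0 = 1 - ?\<mu> (\<Union>d. B d)"
    using finite_measure_compl[of "\<Union>d. B d"] B_sets measure_node[of 1] unfolding E0_def
    by (simp add: node_1[simplified])
  then have E0_pos: "?\<mu> E0 > 0"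
    using B_union \<open>c < e\<close> \<open>0 < e\<close> by (smt (verit) divide_less_eq_1)
  have "\<exists>Q\<in>level n. ?\<mu> (E0 \<inter> node Q) > 0"
  proof (rule ccontr)
    assume neg: "\<not> ?thesis"
    have "E0 = (\<Union>Q\<in>level n. E0 \<inter> node Q)"
      using node_exists[of "2 ^ n"] unfolding E0_def by (auto; metis atLeastLessThan_iff one_le_power one_le_numeral)
    then have "?\<mu> E0 \<le> (\<Sum>Q\<in>level n. ?\<mu> (E0 \<inter> node Q))"
      using finite_measure_subadditive_finite[of "level n" "\<lambda>Q. E0 \<inter> node Q"] E0_sets node_sets level_ge_1
      by (metis (no_types, lifting) finite_atLeastLessThan image_subsetI sets.Int)
    also have "\<dots> \<le> 0"
      using neg by (intro sum_nonpos) (auto simp: not_less)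
    finally show False using E0_pos by simp
  qed
  then obtain Q where Q: "Q \<in> level n" "?\<mu> (E0 \<inter> node Q) > 0" by blast
  define E where "E = E0 \<inter> node Q"
  have E_sets: "E \<in> sets unit_measure"
    unfolding E_def using E0_sets node_sets[OF level_ge_1[OF Q(1)]] by blast
  show thesis
  proof (rule that[of E Q])
    show "E \<in> sets borel" "E \<subseteq> node Q" "Q \<in> level n"
      using E_sets Q(1) by (auto simp: sets_unit E_def)
    have "?\<mu> E = measure lborel E"
      using E_sets by (intro measure_restrict_space) (auto simp: sets_unit)
    then show "measure lborel E > 0" using Q(2) by (simp add: E_def)
    fix d j assume j: "j \<in> level (n + d)" and "node j \<inter> E \<noteq> {}"
    then obtain x where x: "x \<in> node j" "x \<in> E0" "x \<in> node Q" by (auto simp: E_def)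
    have "x \<in> node (j div 2 ^ d)" using node_ancestor_subset[OF j] x(1) by blast
    then have "j div 2 ^ d = Q"
      using level_disjoint[OF level_ancestor[OF j] Q(1)] x(3) by blast
    moreover have "j \<notin> bad_nodes \<omega> e n d"
      using x(1,2) by (auto simp: E0_def B_def)
    then have "\<omega> d j \<le> e * node_length j"
      using j by (cases d) (auto simp: not_less)
    ultimately show "j div 2 ^ d = Q \<and> \<omega> d j \<le> e * node_length j" ..
  qed
qed

section \<open>Factoring the identity of \<open>L\<^sup>1\<close>\<close>

text \<open>
  How far \<open>T\<close> is from multiplication by \<open>a\<close> on the indicator of node \<open>j\<close>.  The error is seen only
  on the ancestor \<open>d\<close> levels above \<open>j\<close>, because mass that \<open>T\<close> sends further away is not small.
\<close>
definition local_error :: "(real L1 \<Rightarrow> real L1) \<Rightarrow> real L1 \<Rightarrow> nat \<Rightarrow> nat \<Rightarrow> real" where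
  "local_error T a d j = norm (restr (node (j div 2 ^ d)) (T (step j 1) - restr (node j) a))"

lemma local_error_subadditive:
  assumes T: "bounded_linear T" and j: "j \<in> level (n + d)"
  shows "local_error T a d j \<le> local_error T a (Suc d) (2 * j) + local_error T a (Suc d) (Suc (2 * j))"
proof -
  have j1: "j \<ge> 1" by (rule level_ge_1[OF j])
  have "node (Suc (2 * j)) = node j - node (2 * j)" using node_children[OF j1] by blast
  moreover have "node (2 * j) \<subseteq> node j" using node_children[OF j1] by blast
  ultimately have "restr (node j) a = restr (node (2 * j)) a + restr (node (Suc (2 * j))) a"
    by (simp add: restr_diff)
  then have "T (step j 1) - restr (node j) a =
      (T (step (2 * j) 1) - restr (node (2 * j)) a) + (T (step (Suc (2 * j)) 1) - restr (node (Suc (2 * j))) a)"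
    by (simp add: step_children[OF j1, of 1] linear_add[OF bounded_linear.linear[OF T]])
  moreover have "2 * j div 2 ^ Suc d = j div 2 ^ d" "Suc (2 * j) div 2 ^ Suc d = j div 2 ^ d"
    by (simp_all add: div_mult2_eq)
  ultimately show ?thesis
    unfolding local_error_def by (simp add: linear_add[OF linear_restr] norm_triangle_ineq)
qed

text \<open>
  Away from node \<open>j\<close> the error is the off-diagonal mass of \<open>T\<close>; on node \<open>j\<close> it is the distance of the
  diagonal part from \<open>a\<close>.
\<close>
lemma sum_local_error_le:
  assumes off: "off_diagonal T n d \<le> c" and a: "norm (diagonal T (n + d) - a) \<le> c"
  shows "(\<Sum>j\<in>level (n + d). local_error T a d j) \<le> 2 * c"
proof -
  let ?D = "diagonal T (n + d)"
  have "local_error T a d j = norm (restr (node (j div 2 ^ d) - node j) (T (step j 1))) + norm (restr (node j) (?D - a))"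
    if j: "j \<in> level (n + d)" for j
  proof -
    have sub: "node j \<subseteq> node (j div 2 ^ d)" by (rule node_ancestor_subset[OF j])
    let ?v = "T (step j 1) - restr (node j) a"
    have "local_error T a d j = norm (restr (node (j div 2 ^ d) - node j) ?v) + norm (restr (node j) ?v)"
      unfolding local_error_def using norm_restr_Diff[OF node_borel node_borel sub, of ?v] by simp
    also have "restr (node (j div 2 ^ d) - node j) ?v = restr (node (j div 2 ^ d) - node j) (T (step j 1))"
    proof -
      have "(node (j div 2 ^ d) - node j) \<inter> node j = {}" by blast
      then show ?thesis by (simp add: linear_diff[OF linear_restr] restr_restr)
    qed
    also have "restr (node j) ?v = restr (node j) (?D - a)"
      using restr_diagonal[OF j, of T] by (simp add: linear_diff[OF linear_restr] restr_restr)
    finally show ?thesis .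
  qed
  then have "(\<Sum>j\<in>level (n + d). local_error T a d j) = off_diagonal T n d + (\<Sum>j\<in>level (n + d). norm (restr (node j) (?D - a)))"
    by (simp add: off_diagonal_def sum.distrib)
  also have "(\<Sum>j\<in>level (n + d). norm (restr (node j) (?D - a))) = norm (?D - a)"
    by (rule sum_norm_restr_nodes) simp
  finally show ?thesis using off a by simp
qed

text \<open>
  The averages of a function supported in \<open>E\<close> are combinations of indicators of good nodes, and on each
  of these \<open>T\<close> is, within the node \<open>Q\<close>, close to multiplication by \<open>a\<close>.  Dividing by the
  function \<open>a\<close> costs a factor \<open>1 / \<delta>\<close>.
\<close>
lemma almost_multiplication_on_good_set:
  fixes a :: "real L1"
  assumes T: "bounded_linear T" and \<delta>: "\<delta> > 0" and e: "e \<ge> 0"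
    and a: "AE x in unit_measure. \<delta> \<le> \<bar>rep_L1 a x\<bar>"
    and good: "\<And>d j. j \<in> level (n + d) \<Longrightarrow> node j \<inter> E \<noteq> {} \<Longrightarrow>
      j div 2 ^ d = Q \<and> local_error T a d j \<le> e * node_length j"
    and E: "E \<in> sets borel"
  obtains \<psi> where "bounded_weight (1 / \<delta>) \<psi>"
    "\<And>f. restr E f = f \<Longrightarrow> norm (multiply \<psi> (T f) - f) \<le> e / \<delta> * norm f"
proof -
  \<comment> \<open>The case distinction only bounds the weight everywhere; almost everywhere the first case holds.\<close>
  define \<psi> where "\<psi> x = indicator (node Q) x * (if \<delta> \<le> \<bar>rep_L1 a x\<bar> then 1 / rep_L1 a x else 0)" for x
  have weight: "bounded_weight (1 / \<delta>) \<psi>"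
    unfolding bounded_weight_def
  proof (intro conjI ballI)
    show "\<psi> \<in> borel_measurable unit_measure"
      unfolding \<psi>_def[abs_def] by measurable
    show "\<bar>\<psi> x\<bar> \<le> 1 / \<delta>" for x
      using \<delta> by (auto simp: \<psi>_def indicator_def field_simps)
  qed
  note lin = bounded_linear.linear[OF bounded_linear_multiply[OF weight]]
  note linT = bounded_linear.linear[OF T]
  have node_est: "norm (multiply \<psi> (T (step j 1)) - step j 1) \<le> e / \<delta> * node_length j"
    if j: "j \<in> level (n + d)" and meet: "node j \<inter> E \<noteq> {}" for d j
  proof -
    have Q: "j div 2 ^ d = Q" and err: "local_error T a d j \<le> e * node_length j"
      using good[OF j meet] by auto
    have sub: "node j \<subseteq> node Q" using node_ancestor_subset[OF j] Q by simp
    let ?v = "T (step j 1) - restr (node j) a"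
    have "multiply \<psi> (restr (node j) a) = step j 1"
    proof (rule L1_eqI)
      show "AE x in unit_measure. rep_L1 (multiply \<psi> (restr (node j) a)) x = rep_L1 (step j 1) x"
        using a rep_multiply[OF weight, of "restr (node j) a"]
          rep_multiply[OF bounded_weight_indicator[OF node_borel], of j a, folded restr_def] rep_step[of j 1]
        by eventually_elim (use sub \<delta> in \<open>auto simp: \<psi>_def indicator_def\<close>)
    qed
    then have "multiply \<psi> (T (step j 1)) - step j 1 = multiply \<psi> ?v"
      by (simp add: linear_diff[OF lin])
    also have "\<dots> = multiply \<psi> (restr (node Q) ?v)"
    proof -
      have "(\<lambda>x. \<psi> x * indicator (node Q) x) = \<psi>" by (auto simp: \<psi>_def indicator_def)
      then show ?thesis
        unfolding restr_def multiply_multiply[OF weight bounded_weight_indicator[OF node_borel]] by simp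
    qed
    also have "norm \<dots> \<le> 1 / \<delta> * norm (restr (node Q) ?v)"
      by (rule norm_multiply_le[OF weight])
    also have "\<dots> \<le> 1 / \<delta> * (e * node_length j)"
      using err \<delta> unfolding local_error_def Q by (intro mult_left_mono) auto
    finally show ?thesis by simp
  qed
  have est: "norm (multiply \<psi> (T f) - f) \<le> e / \<delta> * norm f" if f: "restr E f = f" for f
  proof -
    let ?A = "\<lambda>d. average (2 ^ (n + d)) f"
    have "norm (multiply \<psi> (T (?A d)) - ?A d) \<le> e / \<delta> * norm f" for d
    proof -
      let ?c = "\<lambda>j. node_integral j f / node_length j"
      have A: "?A d = (\<Sum>j\<in>level (n + d). ?c j *\<^sub>R step j 1)"
        unfolding average_def by (intro sum.cong refl) (simp add: step_scale[OF level_ge_1])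
      have "multiply \<psi> (T (?A d)) - ?A d = (\<Sum>j\<in>level (n + d). ?c j *\<^sub>R (multiply \<psi> (T (step j 1)) - step j 1))"
        unfolding A by (simp add: linear_sum[OF linT] linear_sum[OF lin] linear_cmul[OF linT] linear_cmul[OF lin]
            sum_subtractf scaleR_diff_right)
      also have "norm \<dots> \<le> (\<Sum>j\<in>level (n + d). norm (?c j *\<^sub>R (multiply \<psi> (T (step j 1)) - step j 1)))"
        by (rule norm_sum)
      also have "\<dots> \<le> (\<Sum>j\<in>level (n + d). e / \<delta> * \<bar>node_integral j f\<bar>)"
      proof (rule sum_mono)
        fix j assume j: "j \<in> level (n + d)"
        show "norm (?c j *\<^sub>R (multiply \<psi> (T (step j 1)) - step j 1)) \<le> e / \<delta> * \<bar>node_integral j f\<bar>"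
        proof (cases "node j \<inter> E = {}")
          case True
          then have "node_integral j f = 0"
            using node_integral_restr[OF E, of j f] f by simp
          then show ?thesis by simp
        next
          case False
          have "\<bar>?c j\<bar> * norm (multiply \<psi> (T (step j 1)) - step j 1) \<le> \<bar>?c j\<bar> * (e / \<delta> * node_length j)"
            by (intro mult_left_mono node_est[OF j False]) simp
          also have "\<dots> = e / \<delta> * \<bar>node_integral j f\<bar>"
            by (simp add: abs_divide)
          finally show ?thesis by simp
        qed
      qed
      also have "\<dots> = e / \<delta> * (\<Sum>j\<in>level (n + d). \<bar>node_integral j f\<bar>)"
        by (simp add: sum_distrib_left)
      also have "\<dots> \<le> e / \<delta> * norm f"
        using e \<delta> by (intro mult_left_mono sum_node_integral_le) auto
      finally show ?thesis .
    qed
    moreover have "(\<lambda>d. norm (multiply \<psi> (T (?A d)) - ?A d)) \<longlonglongrightarrow> norm (multiply \<psi> (T f) - f)"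
    proof -
      have "?A \<longlonglongrightarrow> f"
        using LIMSEQ_ignore_initial_segment[OF average_tendsto[of f], of n] by (simp add: add.commute)
      then show ?thesis
        by (intro tendsto_intros bounded_linear.tendsto[OF bounded_linear_multiply[OF weight]]
            bounded_linear.tendsto[OF T])
    qed
    ultimately show ?thesis by (intro LIMSEQ_le_const2) auto
  qed
  show thesis by (rule that[OF weight est])
qed

text \<open>
  Compressing \<open>T\<close>, divided by \<open>a\<close>, to the copy of \<open>L\<^sup>1\<close> inside \<open>L\<^sup>1(E)\<close> gives an operator within \<open>\<theta>\<close> of the
  identity.
\<close>
theorem L1_identity_factors:
  fixes T :: "real L1 \<Rightarrow> real L1"
  assumes T: "bounded_linear T" and \<delta>: "\<delta> > 0" and \<theta>: "0 < \<theta>" "\<theta> < 1"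
    and large: "\<And>l w. w \<in> level (2 * l) \<Longrightarrow> \<delta> / 4 ^ l \<le> \<bar>quad_integral w (T (quad w))\<bar>"
  obtains R S :: "real L1 \<Rightarrow> real L1" where "bounded_linear R" "bounded_linear S" "\<And>f. norm (R f) \<le> norm f"
    "\<And>f. norm (S f) \<le> norm f / (\<delta> * (1 - \<theta>))" "\<And>f. S (T (R f)) = f"
proof -
  obtain \<eta> where \<eta>: "\<eta> \<longlonglongrightarrow> 0" "decseq \<eta>" "\<And>n d. off_diagonal T n d \<le> \<eta> n"
    using off_diagonal_vanishes[OF T] by blast
  obtain a where a: "\<And>n. norm (diagonal T n - a) \<le> \<eta> n"
    using diagonal_limit[OF T \<eta>] by blast
  have a_large: "AE x in unit_measure. \<delta> \<le> \<bar>rep_L1 a x\<bar>"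
    by (rule diagonal_limit_large[OF T \<eta> a large])
  have "\<theta> * \<delta> / 2 > 0" using \<theta> \<delta> by simp
  then obtain n where n: "\<eta> n < \<theta> * \<delta> / 2"
    using eventually_happens'[OF sequentially_bot order_tendstoD(2)[OF \<eta>(1)]] by blast
  have total: "(\<Sum>j\<in>level (n + d). local_error T a d j) \<le> 2 * \<eta> n" for d
    using a[of "n + d"] decseqD[OF \<eta>(2), of n "n + d"] by (intro sum_local_error_le \<eta>(3)) simp
  obtain E Q where E: "E \<in> sets borel" "Q \<in> level n" "E \<subseteq> node Q" "measure lborel E > 0"
    and good: "\<And>d j. j \<in> level (n + d) \<Longrightarrow> node j \<inter> E \<noteq> {} \<Longrightarrow>
      j div 2 ^ d = Q \<and> local_error T a d j \<le> \<theta> * \<delta> * node_length j"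
  proof (rule good_set[of n "local_error T a" "2 * \<eta> n" "\<theta> * \<delta>"])
    show "local_error T a d j \<le> local_error T a (Suc d) (2 * j) + local_error T a (Suc d) (Suc (2 * j))"
      if "j \<in> level (n + d)" for d j
      by (rule local_error_subadditive[OF T that])
  qed (use total n \<theta> \<delta> in \<open>auto simp: local_error_def\<close>)
  have "0 \<le> \<theta> * \<delta>" using \<theta> \<delta> by simp
  from almost_multiplication_on_good_set[OF T \<delta> this a_large good E(1)]
  obtain \<psi> where weight: "bounded_weight (1 / \<delta>) \<psi>"
    and near: "\<And>f. restr E f = f \<Longrightarrow> norm (multiply \<psi> (T f) - f) \<le> \<theta> * \<delta> / \<delta> * norm f"
    by blast
  have E_unit: "E \<subseteq> {0..<1}" using E(3) node_subset_unit[OF level_ge_1[OF E(2)]] by blast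
  obtain R U :: "real L1 \<Rightarrow> real L1" where R: "bounded_linear R" "\<And>f. norm (R f) \<le> norm f"
    and U: "bounded_linear U" "\<And>f. norm (U f) \<le> norm f" and UR: "\<And>f. U (R f) = f" "\<And>f. restr E (R f) = R f"
    by (rule L1_embeds_in_L1_of_subset[OF E(1) E_unit E(4)]) (rule that; assumption)
  define A where "A f = U (multiply \<psi> (T (R f)))" for f
  have lin: "bounded_linear (\<lambda>f. U (multiply \<psi> f))"
    by (rule bounded_linear_compose[OF U(1) bounded_linear_multiply[OF weight]])
  have "bounded_linear A"
    unfolding A_def by (rule bounded_linear_compose[OF lin bounded_linear_compose[OF T R(1)]])
  moreover have A_near: "norm (A f - f) \<le> \<theta> * norm f" for f
  proof -
    have "A f - f = U (multiply \<psi> (T (R f)) - R f)"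
      by (simp add: A_def UR linear_diff[OF bounded_linear.linear[OF U(1)]])
    then have "norm (A f - f) \<le> norm (multiply \<psi> (T (R f)) - R f)" using U(2) by simp
    also have "\<dots> \<le> \<theta> * norm (R f)" using near[OF UR(2), of f] \<delta> by simp
    also have "\<dots> \<le> \<theta> * norm f" using R(2) \<theta> by (intro mult_left_mono) auto
    finally show ?thesis .
  qed
  ultimately obtain B where B: "bounded_linear B" "\<And>f. B (A f) = f" "\<And>f. norm (B f) \<le> norm f / (1 - \<theta>)"
    using near_identity_invertible[of A \<theta>, OF _ A_near less_imp_le[OF \<theta>(1)] \<theta>(2)] by blast
  show thesis
  proof (rule that[of R "\<lambda>f. B (U (multiply \<psi> f))"])
    show "bounded_linear (\<lambda>f. B (U (multiply \<psi> f)))"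
      by (rule bounded_linear_compose[OF B(1) lin])
    show "norm (B (U (multiply \<psi> f))) \<le> norm f / (\<delta> * (1 - \<theta>))" for f
    proof -
      have "norm (B (U (multiply \<psi> f))) \<le> norm (U (multiply \<psi> f)) / (1 - \<theta>)" by (rule B(3))
      also have "\<dots> \<le> (1 / \<delta> * norm f) / (1 - \<theta>)"
        using U(2)[of "multiply \<psi> f"] norm_multiply_le[OF weight, of f] \<theta> by (intro divide_right_mono) auto
      finally show ?thesis by simp
    qed
    show "B (U (multiply \<psi> (T (R f)))) = f" for f
      using B(2)[of f] by (simp add: A_def)
  qed (use R in auto)
qed

section \<open>Transfer to the square\<close>

lemma haar2_fold_square:
  assumes "u \<in> level l" "v \<in> level l"
  shows "haar2_functional (haar_index u, haar_index v) (fold_square f) = quad_integral (interleave u v) f"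
proof -
  have u: "u \<ge> 1" and v: "v \<ge> 1" using assms level_ge_1 by blast+
  note lin = bounded_linear_haar_integral[OF bounded_linear_ident]
  have "haar2_functional (haar_index u, haar_index v) (fold_square f) =
      haar_diff (\<lambda>k. haar_diff (\<lambda>m. cell_integral k m (fold_square f)) v) u"
    unfolding haar2_functional_eq haar_integral_eq[OF lin] cell_integral_haar ..
  moreover note cell = cell_integral_fold_square[of _ "Suc l", OF level_children(1)[OF assms(1)] level_children(1)[OF assms(2)]]
    cell_integral_fold_square[of _ "Suc l", OF level_children(1)[OF assms(1)] level_children(2)[OF assms(2)]]
    cell_integral_fold_square[of _ "Suc l", OF level_children(2)[OF assms(1)] level_children(1)[OF assms(2)]]
    cell_integral_fold_square[of _ "Suc l", OF level_children(2)[OF assms(1)] level_children(2)[OF assms(2)]]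
  ultimately show ?thesis
    using u v unfolding quad_integral_def haar_diff_def cell interleave_children[OF u] by simp
qed

lemma fold_square_quad:
  assumes "u \<in> level l" "v \<in> level l"
  shows "fold_square (quad (interleave u v)) = tensor_L1 (haar_fun u) (haar_fun v)"
proof -
  have u: "u \<ge> 1" and v: "v \<ge> 1" using assms level_ge_1 by blast+
  note lin = bounded_linear.linear[OF bounded_linear_fold_square]
  have lin_step: "step k (y - z) = step k y - step k z" if "k \<ge> 1" for k and y z :: "real L1"
    by (rule linear_diff[OF bounded_linear.linear[OF bounded_linear_step[OF that]]])
  note fold = fold_square_step[OF level_children(1)[OF assms(1)] level_children(1)[OF assms(2)]]
    fold_square_step[OF level_children(1)[OF assms(1)] level_children(2)[OF assms(2)]]
    fold_square_step[OF level_children(2)[OF assms(1)] level_children(1)[OF assms(2)]]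
    fold_square_step[OF level_children(2)[OF assms(1)] level_children(2)[OF assms(2)]]
  note fold = fold[unfolded interleave_children[OF u]]
  show ?thesis
    unfolding quad_def linear_add[OF lin] linear_diff[OF lin] fold tensor_haar haar_vector
    using u v by (simp add: haar_diff_def lin_step)
qed

theorem large_diagonal_imp_factors:
  fixes T :: "real L1 L1 \<Rightarrow>\<^sub>L real L1 L1"
  assumes \<delta>: "\<delta> > 0"
    and diag: "\<And>p. p \<in> dyadic_plus \<times> dyadic_plus \<Longrightarrow> \<delta> \<le> \<bar>haar2_functional p (T (normalized_haar2 p))\<bar>"
    and \<epsilon>: "\<epsilon> > 0"
  shows "id_factors_through (1 / \<delta> + \<epsilon>) T"
proof -
  let ?J = fold_square
  define J' where "J' = inv fold_square"
  have inj: "inj ?J"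
  proof (rule injI)
    fix f g assume "?J f = ?J g"
    then have "norm (f - g) = 0"
      by (simp add: linear_diff[OF bounded_linear.linear[OF bounded_linear_fold_square]] flip: norm_fold_square)
    then show "f = g" by simp
  qed
  have J'J: "J' (?J f) = f" and JJ': "?J (J' F) = F" for f F
    unfolding J'_def using inj surj_fold_square by (simp_all add: surj_f_inv_f)
  have norm_J': "norm (J' F) = norm F" for F
    using norm_fold_square[of "J' F"] by (simp add: JJ')
  have J': "bounded_linear J'"
  proof (rule bounded_linear_intro[where K = 1])
    show "J' (F + G) = J' F + J' G" for F G
      by (metis J'J JJ' linear_add[OF bounded_linear.linear[OF bounded_linear_fold_square]])
    show "J' (c *\<^sub>R F) = c *\<^sub>R J' F" for c F
      by (metis J'J JJ' linear_cmul[OF bounded_linear.linear[OF bounded_linear_fold_square]])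
  qed (simp add: norm_J')
  define T' where "T' f = J' (T (?J f))" for f
  have T': "bounded_linear T'"
    unfolding T'_def
    by (intro bounded_linear_compose[OF J'] bounded_linear_compose[OF blinfun.bounded_linear_right] bounded_linear_fold_square)
  have large: "\<delta> / 4 ^ l \<le> \<bar>quad_integral w (T' (quad w))\<bar>" if w: "w \<in> level (2 * l)" for l w
  proof -
    have "w \<in> (\<lambda>(u, v). interleave u v) ` (level l \<times> level l)"
      using w unfolding bij_betw_imp_surj_on[OF bij_interleave[of l]] .
    then obtain u v where uv: "u \<in> level l" "v \<in> level l" and w: "w = interleave u v"
      by (elim imageE SigmaE) simp
    let ?p = "(haar_index u, haar_index v)" and ?h = "tensor_L1 (haar_fun u) (haar_fun v)"
    have weight: "haar_weight u * haar_weight v = 1 / 4 ^ l"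
      using level_ge_1[OF uv(1)] level_ge_1[OF uv(2)]
      by (simp add: haar_weight_def node_length_level[OF uv(1)] node_length_level[OF uv(2)] flip: power_mult_distrib)
    have "?p \<in> dyadic_plus \<times> dyadic_plus"
      using bij_haar_index by (auto simp: bij_betw_def)
    then have "\<delta> \<le> \<bar>haar2_functional ?p (T (normalized_haar2 ?p))\<bar>" by (rule diag)
    also have "haar2_functional ?p (T (normalized_haar2 ?p)) = 4 ^ l * haar2_functional ?p (T ?h)"
      unfolding normalized_haar2_eq weight
      by (simp add: blinfun.scaleR_right linear_cmul[OF bounded_linear.linear[OF bounded_linear_haar2]])
    also have "haar2_functional ?p (T ?h) = quad_integral w (T' (quad w))"
      unfolding w T'_def fold_square_quad[OF uv] haar2_fold_square[OF uv, symmetric] JJ' ..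
    finally show ?thesis by (simp add: abs_mult field_simps)
  qed
  define \<theta> where "\<theta> = \<delta> * \<epsilon> / (1 + \<delta> * \<epsilon>)"
  have "\<delta> * \<epsilon> > 0" using \<delta> \<epsilon> by simp
  then have \<theta>: "0 < \<theta>" "\<theta> < 1" "1 / (\<delta> * (1 - \<theta>)) = 1 / \<delta> + \<epsilon>"
    using \<delta> by (simp_all add: \<theta>_def field_simps)
  obtain R S :: "real L1 \<Rightarrow> real L1" where R: "bounded_linear R" "\<And>f. norm (R f) \<le> norm f" and S: "bounded_linear S"
    "\<And>f. norm (S f) \<le> norm f / (\<delta> * (1 - \<theta>))" and SR: "\<And>f. S (T' (R f)) = f"
    by (rule L1_identity_factors[OF T' \<delta> \<theta>(1,2) large]) (assumption, (rule that; assumption))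
  define R' S' where "R' = Blinfun (\<lambda>F. ?J (R (J' F)))" and "S' = Blinfun (\<lambda>F. ?J (S (J' F)))"
  have R': "blinfun_apply R' F = ?J (R (J' F))" for F
    unfolding R'_def
    by (intro bounded_linear_Blinfun_apply[THEN fun_cong] bounded_linear_compose[OF bounded_linear_fold_square]
        bounded_linear_compose[OF R(1)] J')
  have S': "blinfun_apply S' F = ?J (S (J' F))" for F
    unfolding S'_def
    by (intro bounded_linear_Blinfun_apply[THEN fun_cong] bounded_linear_compose[OF bounded_linear_fold_square]
        bounded_linear_compose[OF S(1)] J')
  have "norm R' \<le> 1"
  proof (rule norm_blinfun_bound)
    show "norm (blinfun_apply R' F) \<le> 1 * norm F" for F
      using R(2)[of "J' F"] by (simp add: R' norm_fold_square norm_J')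
  qed simp
  moreover have "norm S' \<le> 1 / \<delta> + \<epsilon>"
  proof (rule norm_blinfun_bound)
    fix F
    have "norm (S (J' F)) \<le> (1 / (\<delta> * (1 - \<theta>))) * norm F" using S(2)[of "J' F"] by (simp add: norm_J')
    then show "norm (blinfun_apply S' F) \<le> (1 / \<delta> + \<epsilon>) * norm F"
      unfolding \<theta>(3) by (simp add: S' norm_fold_square)
  qed (use \<delta> \<epsilon> in simp)
  ultimately have "norm R' * norm S' \<le> 1 * (1 / \<delta> + \<epsilon>)" by (intro mult_mono) auto
  moreover have "S' o\<^sub>L T o\<^sub>L R' = id_blinfun"
  proof (rule blinfun_eqI)
    fix F
    have "J' (T (?J (R (J' F)))) = T' (R (J' F))" by (simp add: T'_def)
    then show "blinfun_apply (S' o\<^sub>L T o\<^sub>L R') F = blinfun_apply id_blinfun F"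
      by (simp add: R' S' SR JJ')
  qed
  ultimately show ?thesis
    unfolding id_factors_through_def by auto
qed

theorem corollary6p4:
  shows "factorization_property (\<lambda>\<delta>. 1 / \<delta>) (dyadic_plus \<times> dyadic_plus)
    normalized_haar2 haar2_functional"
  unfolding factorization_property_def
proof (intro conjI allI impI)
  show "normalized_basis_on (dyadic_plus \<times> dyadic_plus) normalized_haar2 haar2_functional"
    by (rule normalized_haar2_basis)
  fix \<delta> :: real and T :: "real L1 L1 \<Rightarrow>\<^sub>L real L1 L1"
  assume \<delta>: "\<delta> > 0"
    and inf: "(INF p\<in>dyadic_plus \<times> dyadic_plus. \<bar>haar2_functional p (T (normalized_haar2 p))\<bar>) \<ge> \<delta>"
  have "\<delta> \<le> \<bar>haar2_functional p (T (normalized_haar2 p))\<bar>" if "p \<in> dyadic_plus \<times> dyadic_plus" for p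
  proof -
    have "(INF p\<in>dyadic_plus \<times> dyadic_plus. \<bar>haar2_functional p (T (normalized_haar2 p))\<bar>) \<le>
        \<bar>haar2_functional p (T (normalized_haar2 p))\<bar>"
      using that by (intro cINF_lower bdd_belowI2[of _ 0]) auto
    then show ?thesis using inf by simp
  qed
  then show "id_almost_factors_through (1 / \<delta>) T"
    unfolding id_almost_factors_through_def using large_diagonal_imp_factors[OF \<delta>] by blast
qed

end
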